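(* Let $X$ be a real random variable whose distribution is in the domain of attraction of the normal law, with $E(X)=0$. With $L_n$ and $\delta_n$ as defined in the context, $\delta_n\to0$ and $$\sup_{-\infty<x<\infty}|L_n(x)|\asymp\delta_n$$ as $n\to\infty$. This property continues to hold if the supremum over all $x$ is replaced by the supremum over $x\in\{-x_0,x_0,x_1\}$, where $x_0>3^{1/2}$ and $x_1$ is any real number not equal to $\pm x_0$; that is, for all such fixed $x_0,x_1$, $$\sup_{x\in\{-x_0,x_0,x_1\}}|L_n(x)|\asymp\delta_n .$$ Furthermore, if $E(|X|^3)<\infty$, $E(X^2)=1$ and $E(X^3)=\gamma$, then $$\sup_{-\infty<x<\infty}\bigl|n^{1/2}L_n(x)-\tfrac16\gamma(2x^2+1)\phi(x)\bigr|\to0$$ as $n\to\infty$.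
   Context: $\Phi$ and $\phi$ are the standard normal distribution and density functions, and $I(\cdot)$ denotes an indicator. The distribution of $X$ is in the domain of attraction of the normal law if, for independent copies $X_1,X_2,\ldots$ of $X$, there are constants $a_n>0$ and $c_n$ such that $(X_1+\cdots+X_n-c_n)/a_n$ converges in distribution to the standard normal law (in particular $X$ is nondegenerate). For sequences, $a_n\asymp d_n$ means $0<\liminf_{n\to\infty}a_n/d_n\le\limsup_{n\to\infty}a_n/d_n<\infty$. For all sufficiently large $n$ put $$b_n=\sup\{x>0: n x^{-2}E[X^2I(|X|\le x)]\ge 1\},$$ $$L_n(x)=n\,E\bigl(\Phi[x\{1+(X/b_n)^2\}^{1/2}-(X/b_n)]-\Phi(x)\bigr),$$ $$\delta_n=nP(|X|>b_n)+nb_n^{-1}|E\{XI(|X|\le b_n)\}|+nb_n^{-3}|E\{X^3I(|X|\le b_n)\}|+nb_n^{-4}E\{X^4I(|X|\le b_n)\}.$$ *)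

theory Defs
  imports "HOL-Probability.Probability"
begin

text \<open>The independent copies of \<open>X\<close> are the coordinates of the countable power of
  the law of \<open>X\<close>.\<close>

definition normal_domain_of_attraction :: "'a measure \<Rightarrow> ('a \<Rightarrow> real) \<Rightarrow> bool" where
  "normal_domain_of_attraction M X \<longleftrightarrow>
     (\<exists>a c. (\<forall>n. a n > 0) \<and>
       weak_conv_m
         (\<lambda>n. distr (\<Pi>\<^sub>M i\<in>(UNIV :: nat set). distr M borel X) borel
                (\<lambda>\<omega>. ((\<Sum>i<n. \<omega> i) - c n) / a n))
         std_normal_distribution)"

definition asymp_same_order :: "(nat \<Rightarrow> real) \<Rightarrow> (nat \<Rightarrow> real) \<Rightarrow> bool" where
  "asymp_same_order a d \<longleftrightarrow>
     0 < liminf (\<lambda>n. ereal (a n / d n)) \<and>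
     liminf (\<lambda>n. ereal (a n / d n)) \<le> limsup (\<lambda>n. ereal (a n / d n)) \<and>
     limsup (\<lambda>n. ereal (a n / d n)) < \<infinity>"

definition std_normal_cdf :: "real \<Rightarrow> real" where
  "std_normal_cdf = cdf std_normal_distribution"

definition trunc_moment :: "'a measure \<Rightarrow> ('a \<Rightarrow> real) \<Rightarrow> nat \<Rightarrow> real \<Rightarrow> real" where
  "trunc_moment M X k x = (\<integral>\<omega>. X \<omega> ^ k * indicator {\<omega>. \<bar>X \<omega>\<bar> \<le> x} \<omega> \<partial>M)"

text \<open>For \<open>X\<close> in the normal domain of attraction, the set below is nonempty and bounded
  above for all large \<open>n\<close>. For the finitely many other \<open>n\<close> the value of \<open>trunc_scale\<close>
  carries no meaning.\<close>

definition trunc_scale :: "'a measure \<Rightarrow> ('a \<Rightarrow> real) \<Rightarrow> nat \<Rightarrow> real" where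
  "trunc_scale M X n = Sup {x. x > 0 \<and> real n / x ^ 2 * trunc_moment M X 2 x \<ge> 1}"

definition leading_term :: "'a measure \<Rightarrow> ('a \<Rightarrow> real) \<Rightarrow> nat \<Rightarrow> real \<Rightarrow> real" where
  "leading_term M X n x =
     real n * (\<integral>\<omega>. std_normal_cdf
                      (x * sqrt (1 + (X \<omega> / trunc_scale M X n) ^ 2) - X \<omega> / trunc_scale M X n)
                    - std_normal_cdf x \<partial>M)"

definition rate :: "'a measure \<Rightarrow> ('a \<Rightarrow> real) \<Rightarrow> nat \<Rightarrow> real" where
  "rate M X n =
     real n * measure M {\<omega> \<in> space M. \<bar>X \<omega>\<bar> > trunc_scale M X n}
     + real n / trunc_scale M X n * \<bar>trunc_moment M X 1 (trunc_scale M X n)\<bar>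
     + real n / trunc_scale M X n ^ 3 * \<bar>trunc_moment M X 3 (trunc_scale M X n)\<bar>
     + real n / trunc_scale M X n ^ 4 * trunc_moment M X 4 (trunc_scale M X n)"

end

theory Submission imports Defs begin

text \<open>Put \<open>u = X / b\<^sub>n\<close>. As a function of \<open>u\<close>, the integrand of \<open>L\<^sub>n(x)\<close> has no quadratic Taylor term, its
  linear and cubic coefficients are \<open>- \<phi>(x)\<close> and \<open>(2x\<^sup>2 + 1)\<phi>(x)/6\<close>, and the remainder is \<open>O(u\<^sup>4)\<close>
  uniformly in \<open>x\<close>. So \<open>L\<^sub>n(x)\<close> is an explicit combination of the truncated first and third moments, up
  to the truncated fourth moment and the tail. Conversely, \<open>L\<^sub>n(x) - L\<^sub>n(-x)\<close> is the expectation of a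
  function of \<open>u\<close> that is bounded below by a multiple of \<open>min(u\<^sup>4, 1)\<close> as soon as \<open>x > sqrt 3\<close>, which
  controls the fourth moment and the tail; two points with different \<open>x\<^sup>2\<close> then determine the first
  and the third moment.

  That \<open>\<delta>\<^sub>n\<close> tends to 0 rests on \<open>t\<^sup>2 P(|X| > t) = o(E X\<^sup>2 I(|X| \<le> t))\<close>. Let \<open>Y\<close> be the symmetrization of
  \<open>X\<close>. Convergence to the normal law forces \<open>E(1 - cos(2sY)) / E(1 - cos(sY)) \<rightarrow> 4\<close> as \<open>s \<rightarrow> 0\<close>, that is,
  \<open>E sin\<^sup>4(sY/2)\<close> is negligible against \<open>E sin\<^sup>2(sY/2)\<close>. Averaging over \<open>s\<close> in \<open>[S, 2S]\<close> turns the former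
  into a bound for the tail of \<open>Y\<close> at \<open>4/S\<close>.\<close>

section \<open>The standard normal distribution function\<close>

text \<open>The threshold sqrt 3 comes from the term of order u^4 in the integrand of L_n(x) -
  L_n(-x): its coefficient is a positive multiple of x (x^2 - 3) phi(x). That the resulting bound
  persists for all u, not only near 0, is the hyperbolic inequality \<open>sinh_le_cosh_div\<close>.

  Convergence to the normal law informs about the characteristic function only at arguments t / a_n,
  and only up to a phase due to the centering. Moduli remove the phase, and this is how the
  symmetrization enters. The gaps between the arguments are closed by proving that a_(n+1) is
  eventually at most 2 a_n: every small s is then t / a_N with t in [1, 2], and since the limit 4
  does not depend on t, compactness of [1, 2] suffices. The average over s is unavoidable because
  for a single s the sine may vanish at large values of Y.

  The first moment is the one term of \<delta>_n that no pointwise comparison on the truncated range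
  can make small. As E X = 0, it is minus a moment over |X| > b_n, which is estimated
  dyadically.\<close>

lemma std_normal_cdf_diff:
  assumes "c \<le> u"
  shows "std_normal_cdf u - std_normal_cdf c = (LBINT y=c..u. std_normal_density y)"
proof -
  interpret real_distribution std_normal_distribution by (rule real_dist_normal_dist)
  have "std_normal_cdf u - std_normal_cdf c = measure std_normal_distribution {c<..u}"
    unfolding std_normal_cdf_def using assms
    by (cases "c = u") (auto intro!: cdf_diff_eq)
  also have "\<dots> = (\<integral>y. indicator {c<..u} y \<partial>std_normal_distribution)"
    by simp
  also have "\<dots> = (LBINT y:{c<..u}. std_normal_density y)"
    unfolding set_lebesgue_integral_def
    by (subst integral_density) (auto intro!: Bochner_Integration.integral_cong)
  also have "\<dots> = (LBINT y=c..u. std_normal_density y)"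
    using assms by (subst interval_integral_Ioc) auto
  finally show ?thesis .
qed

lemma DERIV_std_normal_cdf [derivative_intros]:
  "(std_normal_cdf has_real_derivative std_normal_density x) (at x)"
proof -
  \<comment> \<open>Any base point strictly below \<open>x\<close> serves: it keeps \<open>x\<close>
    interior to the interval of the fundamental theorem, and the representation valid near
    \<open>x\<close>.\<close>
  let ?c = "x - 1"
  have "((\<lambda>u. LBINT y=?c..u. std_normal_density y) has_vector_derivative std_normal_density x)
      (at x within {x-1..x+1})"
    by (rule interval_integral_FTC2) (auto intro!: continuous_intros simp: normal_density_def)
  then have "((\<lambda>u. LBINT y=?c..u. std_normal_density y) has_vector_derivative std_normal_density x) (at x)"
    by (subst (asm) at_within_interior) (auto simp: interior_cbox)
  then have "((\<lambda>u. std_normal_cdf ?c + (LBINT y=?c..u. std_normal_density y))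
      has_real_derivative std_normal_density x) (at x)"
    unfolding has_real_derivative_iff_has_vector_derivative[symmetric]
    by (auto intro!: derivative_eq_intros)
  then show ?thesis
  proof (rule DERIV_cong_ev[THEN iffD1, rotated -1])
    show "\<forall>\<^sub>F u in nhds x. std_normal_cdf ?c + (LBINT y=?c..u. std_normal_density y) = std_normal_cdf u"
    proof -
      have "\<forall>\<^sub>F u in nhds x. u \<in> {?c<..}"
        by (rule eventually_nhds_in_open) auto
      then show ?thesis
      proof eventually_elim
        case (elim u)
        then show ?case using std_normal_cdf_diff[of ?c u] by simp
      qed
    qed
  qed auto
qed

lemmas DERIV_std_normal_cdf' [derivative_intros] = DERIV_chain2[OF DERIV_std_normal_cdf]

lemma DERIV_std_normal_density [derivative_intros]:
  "(std_normal_density has_real_derivative - x * std_normal_density x) (at x)"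
  unfolding std_normal_density_def[abs_def]
  by (auto intro!: derivative_eq_intros simp: field_simps)

lemmas DERIV_std_normal_density' [derivative_intros] = DERIV_chain2[OF DERIV_std_normal_density]

lemma std_normal_cdf_bounds: "0 \<le> std_normal_cdf x" "std_normal_cdf x \<le> 1"
proof -
  interpret real_distribution std_normal_distribution by (rule real_dist_normal_dist)
  show "0 \<le> std_normal_cdf x" "std_normal_cdf x \<le> 1"
    unfolding std_normal_cdf_def by (auto intro: cdf_nonneg cdf_bounded_prob)
qed

text \<open>The density is even, so the sum of the two values has derivative 0; the constant is read
  off at infinity.\<close>

lemma std_normal_cdf_minus: "std_normal_cdf (- x) = 1 - std_normal_cdf x"
proof -
  interpret real_distribution std_normal_distribution by (rule real_dist_normal_dist)
  let ?g = "\<lambda>x. std_normal_cdf x + std_normal_cdf (- x)"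
  have const: "?g y = ?g 0" for y
    by (rule DERIV_isconst_all[rule_format])
       (auto intro!: derivative_eq_intros simp: std_normal_density_def)
  have "(?g \<longlongrightarrow> 1 + 0) at_top"
    unfolding std_normal_cdf_def
    by (intro tendsto_add cdf_lim_at_top_prob filterlim_compose[OF cdf_lim_at_bot filterlim_uminus_at_bot_at_top])
  moreover have "(?g \<longlongrightarrow> ?g 0) at_top"
    by (intro tendsto_eventually always_eventually allI) (rule const)
  ultimately have "?g 0 = 1"
    using tendsto_unique[of at_top ?g] by auto
  with const[of x] show ?thesis by auto
qed

lemma std_normal_cdf_measurable [measurable]: "std_normal_cdf \<in> borel_measurable borel"
  by (intro borel_measurable_continuous_onI continuous_at_imp_continuous_on ballI)
     (rule DERIV_isCont[OF DERIV_std_normal_cdf])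

section \<open>Hyperbolic inequalities\<close>

lemma sinh_le_mult_cosh:
  fixes w :: real
  assumes "0 \<le> w"
  shows "sinh w \<le> w * cosh w"
proof -
  have "(\<lambda>w::real. w * cosh w - sinh w) 0 \<le> (\<lambda>w. w * cosh w - sinh w) w"
    by (rule DERIV_nonneg_imp_nondecreasing[OF assms])
       (auto intro!: exI derivative_eq_intros mult_nonneg_nonneg)
  then show ?thesis by simp
qed

text \<open>The difference of the two sides has derivative \<open>v * (sinh v - v)\<close>. The
  constant 1/3 is the exact leading Taylor coefficient, so nothing is lost at the threshold x^2 =
  3.\<close>

lemma mult_cosh_minus_sinh_ge:
  fixes w :: real
  assumes "0 \<le> w"
  shows "w ^ 3 / 3 \<le> w * cosh w - sinh w"
proof -
  have le: "v \<le> sinh v" if "0 \<le> v" for v :: real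
  proof -
    have "(\<lambda>v::real. sinh v - v) 0 \<le> (\<lambda>v. sinh v - v) v"
      by (rule DERIV_nonneg_imp_nondecreasing[OF that])
         (auto intro!: exI derivative_eq_intros simp: cosh_real_ge_1)
    then show ?thesis by simp
  qed
  have "(\<lambda>w::real. w * cosh w - sinh w - w ^ 3 / 3) 0 \<le> (\<lambda>w. w * cosh w - sinh w - w ^ 3 / 3) w"
  proof (rule DERIV_nonneg_imp_nondecreasing[OF assms])
    fix v :: real assume "0 \<le> v" "v \<le> w"
    show "\<exists>y. ((\<lambda>w. w * cosh w - sinh w - w ^ 3 / 3) has_real_derivative y) (at v) \<and> 0 \<le> y"
      using mult_left_mono[OF le[OF \<open>0 \<le> v\<close>] \<open>0 \<le> v\<close>]
      by (intro exI[of _ "v * sinh v - v * v"] conjI)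
         (auto intro!: derivative_eq_intros simp: field_simps power2_eq_square)
  qed
  then show ?thesis by simp
qed

text \<open>Hyperbolic form of the Cusa-Huygens inequality. Two differentiations reduce it to
  \<open>sinh_le_mult_cosh\<close>.\<close>

lemma three_sinh_le:
  fixes v :: real
  assumes "0 \<le> v"
  shows "3 * sinh v \<le> v * (2 + cosh v)"
proof -
  have le: "0 \<le> 2 - 2 * cosh v + v * sinh v" if "0 \<le> v" for v :: real
  proof -
    have "(\<lambda>v::real. 2 - 2 * cosh v + v * sinh v) 0 \<le> (\<lambda>v. 2 - 2 * cosh v + v * sinh v) v"
    proof (rule DERIV_nonneg_imp_nondecreasing[OF that])
      fix t :: real assume "0 \<le> t"
      then show "\<exists>y. ((\<lambda>v. 2 - 2 * cosh v + v * sinh v) has_real_derivative y) (at t) \<and> 0 \<le> y"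
        using sinh_le_mult_cosh[of t]
        by (intro exI[of _ "t * cosh t - sinh t"] conjI) (auto intro!: derivative_eq_intros)
    qed
    then show ?thesis by simp
  qed
  have "(\<lambda>v::real. v * (2 + cosh v) - 3 * sinh v) 0 \<le> (\<lambda>v. v * (2 + cosh v) - 3 * sinh v) v"
  proof (rule DERIV_nonneg_imp_nondecreasing[OF assms])
    fix t :: real assume "0 \<le> t"
    then show "\<exists>y. ((\<lambda>v. v * (2 + cosh v) - 3 * sinh v) has_real_derivative y) (at t) \<and> 0 \<le> y"
      using le[of t]
      by (intro exI[of _ "2 - 2 * cosh t + t * sinh t"] conjI) (auto intro!: derivative_eq_intros)
  qed
  then show ?thesis by simp
qed

text \<open>Applied with \<open>s = u\<^sup>2\<close> and \<open>w = x u sqrt(1 + u\<^sup>2)\<close>; the third hypothesis then says \<open>x\<^sup>2 \<ge> 3\<close>.\<close>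

lemma sinh_le_cosh_div:
  fixes w s :: real
  assumes "0 \<le> w" "0 \<le> s" "3 * s * (1 + s) \<le> w\<^sup>2"
  shows "sinh w \<le> w / (1 + s) * cosh w"
proof (rule ccontr)
  assume neg: "\<not> ?thesis"
  define S C where "S = sinh w" and "C = cosh w"
  have C2: "C\<^sup>2 = 1 + S\<^sup>2" by (simp add: C_def S_def cosh_square_eq)
  have C1: "C \<ge> 1" by (simp add: C_def cosh_real_ge_1)
  have lt: "w * C < S * (1 + s)"
    using neg assms(2) by (simp add: S_def C_def field_simps)
  have "0 < w" using lt assms S_def by (cases "w = 0") auto
  then have "0 < S" by (simp add: S_def)
  have le: "S \<le> w * C" using sinh_le_mult_cosh[OF assms(1)] by (simp add: S_def C_def)
  \<comment> \<open>The negated claim bounds the first factor by \<open>S * s\<close> and the second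
    strictly by \<open>S * (1 + s)\<close>. Thus \<open>s\<close> survives only as
    \<open>3 * s * (1 + s)\<close>, which the third hypothesis replaces by
    \<open>w\<^sup>2\<close>.\<close>
  have "3 * ((w * C - S) * (w * C)) \<le> 3 * ((S * s) * (w * C))"
    using lt \<open>0 < w\<close> C1 by (intro mult_left_mono mult_right_mono) (auto simp: algebra_simps)
  also have "\<dots> < 3 * ((S * s) * (S * (1 + s)))"
  proof -
    have "0 < S * s" using lt le by (simp add: algebra_simps)
    then show ?thesis using lt by (intro mult_strict_left_mono) auto
  qed
  also have "\<dots> = S\<^sup>2 * (3 * s * (1 + s))" by (simp add: power2_eq_square)
  also have "\<dots> \<le> S\<^sup>2 * w\<^sup>2" by (intro mult_left_mono assms) auto
  finally have "w * (3 * (w * C\<^sup>2 - S * C)) < w * (w * S\<^sup>2)"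
    by (simp add: power2_eq_square algebra_simps)
  then have "3 * (w * C\<^sup>2 - S * C) < w * S\<^sup>2" using \<open>0 < w\<close> by simp
  \<comment> \<open>With \<open>C\<^sup>2 = 1 + S\<^sup>2\<close> the inequality just found reads
    \<open>3 * w + 2 * w * S\<^sup>2 < 3 * S * C\<close>; Cusa-Huygens at \<open>2 * w\<close> is
    its exact negation.\<close>
  moreover have "3 * sinh (2 * w) \<le> (2 * w) * (2 + cosh (2 * w))"
    by (rule three_sinh_le) (use assms in auto)
  then have "3 * S * C \<le> w * (2 + (C\<^sup>2 + S\<^sup>2))"
    unfolding sinh_double cosh_double S_def C_def by (simp add: algebra_simps)
  ultimately show False by (simp add: C2 algebra_simps)
qed

lemma DERIV_sqrt_one_plus_square:
  "((\<lambda>u. sqrt (1 + u\<^sup>2)) has_real_derivative u / sqrt (1 + u\<^sup>2)) (at u)"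
proof -
  have "0 < 1 + u\<^sup>2" by (simp add: add_pos_nonneg)
  then show ?thesis by (auto intro!: derivative_eq_intros simp: field_simps)
qed

lemma DERIV_sqrt_one_plus_square' [derivative_intros]:
  "(g has_real_derivative D) (at u within s) \<Longrightarrow>
    ((\<lambda>u. sqrt (1 + (g u)\<^sup>2)) has_real_derivative g u / sqrt (1 + (g u)\<^sup>2) * D) (at u within s)"
  by (rule DERIV_chain2[OF DERIV_sqrt_one_plus_square])

lemma std_normal_density_shift:
  "std_normal_density (y + u) = std_normal_density y * exp (- u\<^sup>2 / 2) * exp (- (y * u))"
  by (simp add: std_normal_density_def exp_add[symmetric] power2_eq_square field_simps)

section \<open>Lower bound for the part of the integrand that is even in u\<close>

context
  fixes x :: real
  assumes x: "x > sqrt 3"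
begin

text \<open>By the reflection formula for the distribution function this is the integrand of L_n(x)
  - L_n(-x) at u = X / b_n, in a form that is visibly even in u.\<close>

private definition E where
  "E u = std_normal_cdf (x * sqrt (1 + u\<^sup>2) + u) + std_normal_cdf (x * sqrt (1 + u\<^sup>2) - u)
      - 2 * std_normal_cdf x" for u

text \<open>The derivative of \<open>E\<close> after both densities are factored by
  \<open>std_normal_density_shift\<close>. Its sign is that of the bracket, whose leading term at 0
  is x (x^2 - 3) u^3 / 3.\<close>

private definition E' where
  "E' u = 2 * std_normal_density (x * sqrt (1 + u\<^sup>2)) * exp (- u\<^sup>2 / 2)
     * (x * u * sqrt (1 + u\<^sup>2) / (1 + u\<^sup>2) * cosh (x * u * sqrt (1 + u\<^sup>2))
        - sinh (x * u * sqrt (1 + u\<^sup>2)))" for u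

private lemma x_pos: "0 < x"
  using x by (rule order_le_less_trans[rotated]) simp

private lemma x_sq: "3 < x\<^sup>2"
  using x x_pos by (metis real_less_lsqrt less_eq_real_def not_less real_sqrt_le_iff real_sqrt_unique abs_of_pos real_sqrt_abs real_sqrt_less_iff)

private lemma DERIV_E: "(E has_real_derivative E' u) (at u)"
proof -
  define s where "s = sqrt (1 + u\<^sup>2)"
  have s: "0 < s" "s * s = 1 + u\<^sup>2" by (auto simp: s_def add_pos_nonneg)
  have "(E has_real_derivative std_normal_density (x * s + u) * (x * (u / s) + 1)
           + std_normal_density (x * s - u) * (x * (u / s) - 1)) (at u)"
    unfolding E_def[abs_def] s_def by (auto intro!: derivative_eq_intros simp: mult_ac)
  also have "std_normal_density (x * s + u) * (x * (u / s) + 1)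
           + std_normal_density (x * s - u) * (x * (u / s) - 1) = E' u"
  proof -
    have 1: "x * u * s / (1 + u\<^sup>2) = x * (u / s)"
      using s by (simp add: s(2)[symmetric])
    have 2: "std_normal_density (x * s - u)
        = std_normal_density (x * s) * exp (- u\<^sup>2 / 2) * exp (x * u * s)"
      using std_normal_density_shift[of "x * s" "- u"] by (simp add: mult_ac)
    have 3: "std_normal_density (x * s + u)
        = std_normal_density (x * s) * exp (- u\<^sup>2 / 2) * exp (- (x * u * s))"
      using std_normal_density_shift[of "x * s" "u"] by (simp add: mult_ac)
    show ?thesis
      unfolding E'_def s_def[symmetric] 1 2 3 cosh_def sinh_def by (simp add: algebra_simps)
  qed
  finally show ?thesis .
qed

private lemma E'_nonneg: "0 \<le> E' u" if "0 \<le> u"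
proof -
  have "sinh (x * u * sqrt (1 + u\<^sup>2)) \<le> x * u * sqrt (1 + u\<^sup>2) / (1 + u\<^sup>2) * cosh (x * u * sqrt (1 + u\<^sup>2))"
  proof (rule sinh_le_cosh_div)
    have "3 * (u\<^sup>2 * (1 + u\<^sup>2)) \<le> x\<^sup>2 * (u\<^sup>2 * (1 + u\<^sup>2))"
      using x_sq by (intro mult_right_mono) auto
    then show "3 * u\<^sup>2 * (1 + u\<^sup>2) \<le> (x * u * sqrt (1 + u\<^sup>2))\<^sup>2"
      by (simp add: power_mult_distrib mult_ac)
  qed (use that x_pos in auto)
  then show ?thesis by (simp add: E'_def)
qed

private lemma E'_ge: "\<exists>c>0. \<exists>\<eta>>0. \<eta> \<le> 1 \<and> (\<forall>u. 0 \<le> u \<and> u \<le> \<eta> \<longrightarrow> 4 * c * u ^ 3 \<le> E' u)"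
proof -
  \<comment> \<open>Here \<open>x\<^sup>2 / 3 = 1 + 2 * \<kappa>\<close>. Half of the excess absorbs
    \<open>cosh w \<le> 1 + \<kappa>\<close>, the other half survives in the bound. For
    \<open>u \<le> \<eta> \<le> 1\<close> the argument \<open>w\<close> is at most
    \<open>2 * x * \<eta>\<close>, hence the choice of \<eta> below.\<close>
  define \<kappa> where "\<kappa> = (x\<^sup>2 / 3 - 1) / 2"
  have \<kappa>: "0 < \<kappa>" using x_sq by (simp add: \<kappa>_def)
  have "isCont (\<lambda>\<eta>. cosh (2 * x * \<eta>)) 0" by (intro continuous_intros)
  then have "((\<lambda>\<eta>. cosh (2 * x * \<eta>)) \<longlongrightarrow> 1) (at_right 0)"
    unfolding isCont_def by (auto intro: tendsto_mono[OF at_le])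
  then have "\<forall>\<^sub>F \<eta> in at_right 0. cosh (2 * x * \<eta>) < 1 + \<kappa>"
    using \<kappa> by (intro order_tendstoD) auto
  moreover have "\<forall>\<^sub>F \<eta> in at_right 0. \<eta> < (1::real)"
    by (rule order_tendstoD(2)[OF tendsto_ident_at]) simp
  moreover have "\<forall>\<^sub>F \<eta> in at_right 0. 0 < (\<eta>::real)"
    by (simp add: eventually_at_right_less)
  ultimately obtain \<eta> where \<eta>: "cosh (2 * x * \<eta>) < 1 + \<kappa>" "\<eta> < 1" "0 < \<eta>"
    using eventually_happens[OF eventually_conj[OF eventually_conj]] trivial_limit_at_right_real by (metis (mono_tags, lifting))
  \<comment> \<open>The density at \<open>x * sqrt 2\<close> and \<open>exp (- 1 / 2)\<close> are
    lower bounds of the prefactors for \<open>u \<le> 1\<close>. The divisor 4 anticipates the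
    derivative of \<open>c * u ^ 4\<close>.\<close>
  define c where "c = 2 * std_normal_density (x * sqrt 2) * exp (- 1 / 2) * (x * \<kappa>) / 4"
  have "0 < c" using \<kappa> x_pos by (auto simp: c_def intro!: mult_pos_pos normal_density_pos)
  moreover have "4 * c * u ^ 3 \<le> E' u" if u: "0 \<le> u" "u \<le> \<eta>" for u
  proof -
    define w where "w = x * u * sqrt (1 + u\<^sup>2)"
    have "u \<le> 1" using u \<eta> by simp
    then have u1: "u\<^sup>2 \<le> 1" using u by (simp add: power_le_one)
    have s: "1 \<le> sqrt (1 + u\<^sup>2)" "sqrt (1 + u\<^sup>2) \<le> sqrt 2" using u1 by auto
    have s2: "sqrt (1 + u\<^sup>2) \<le> 2" using u1 by (intro real_le_lsqrt) auto
    have w0: "0 \<le> w" using u x_pos by (simp add: w_def)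
    have wu: "x * u \<le> w" using mult_left_mono[OF s(1), of "x * u"] u x_pos by (simp add: w_def)
    have "w \<le> x * u * 2" unfolding w_def using s2 u x_pos by (intro mult_left_mono) auto
    also have "\<dots> \<le> x * \<eta> * 2" using u x_pos by simp
    finally have "cosh w \<le> cosh (2 * x * \<eta>)" 
      using w0 x_pos \<eta>(3) by (subst cosh_real_nonneg_le_iff) (auto simp: mult_ac)
    then have ch: "cosh w \<le> 1 + \<kappa>" using \<eta> by simp
    have w2: "x\<^sup>2 * u\<^sup>2 \<le> w\<^sup>2" using wu u x_pos power_mono[OF wu, of 2] by (simp add: power_mult_distrib)
    have sp: "0 < 1 + u\<^sup>2" by (simp add: add_pos_nonneg)
    have x2: "x\<^sup>2 / 3 = 1 + 2 * \<kappa>" by (simp add: \<kappa>_def field_simps)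
    have "x * u * u\<^sup>2 * \<kappa> \<le> w * u\<^sup>2 * \<kappa>" using wu \<kappa> by (intro mult_right_mono) auto
    also have "\<dots> \<le> w * u\<^sup>2 * (x\<^sup>2 / 3 - cosh w)"
      unfolding x2 using w0 ch by (intro mult_left_mono) auto
    also have "\<dots> = w * (x\<^sup>2 * u\<^sup>2) / 3 - w * u\<^sup>2 * cosh w" by (simp add: algebra_simps)
    also have "\<dots> \<le> w * w\<^sup>2 / 3 - w * u\<^sup>2 * cosh w" using w0 w2 by (auto intro!: mult_left_mono)
    also have "\<dots> \<le> w * cosh w - sinh w - w * u\<^sup>2 * cosh w"
      using mult_cosh_minus_sinh_ge[OF w0] by (simp add: power3_eq_cube power2_eq_square)
    also have "\<dots> \<le> w * cosh w - sinh w - w * u\<^sup>2 * cosh w / (1 + u\<^sup>2)"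
      using divide_left_mono[of 1 "1 + u\<^sup>2" "w * u\<^sup>2 * cosh w"] w0 sp by simp
    also have "\<dots> = w / (1 + u\<^sup>2) * cosh w - sinh w"
      using sp by (simp add: field_simps)
    finally have main: "x * \<kappa> * u ^ 3 \<le> w / (1 + u\<^sup>2) * cosh w - sinh w"
      by (simp add: power3_eq_cube power2_eq_square mult_ac)
    have "(x * sqrt (1 + u\<^sup>2))\<^sup>2 \<le> (x * sqrt 2)\<^sup>2"
      using s x_pos by (intro power_mono mult_left_mono) auto
    then have dens: "std_normal_density (x * sqrt 2) \<le> std_normal_density (x * sqrt (1 + u\<^sup>2))"
      unfolding std_normal_density_def by (intro mult_left_mono) auto
    have "4 * c * u ^ 3 = 2 * std_normal_density (x * sqrt 2) * exp (- 1 / 2) * (x * \<kappa> * u ^ 3)"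
      by (simp add: c_def)
    also have "\<dots> \<le> 2 * std_normal_density (x * sqrt (1 + u\<^sup>2)) * exp (- u\<^sup>2 / 2) * (w / (1 + u\<^sup>2) * cosh w - sinh w)"
      using dens u1 main u x_pos \<kappa> by (intro mult_mono) auto
    also have "\<dots> = E' u" by (simp add: E'_def w_def)
    finally show ?thesis .
  qed
  ultimately show ?thesis using \<eta> by (intro exI[of _ c] conjI exI[of _ \<eta>]) auto
qed

text \<open>Integrating \<open>E'_ge\<close> yields \<open>c * u ^ 4\<close> up to \<eta>; beyond
  \<eta> the function is nondecreasing and stays above its value there. The factor
  \<open>\<eta> ^ 4\<close> lets one constant serve both ranges, and negative \<open>u\<close>
  follow by evenness.\<close>

lemma cdf_even_part_lower_bound:
  "\<exists>c>0. \<forall>u. c * min (u ^ 4) 1 \<le>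
     std_normal_cdf (x * sqrt (1 + u\<^sup>2) + u) + std_normal_cdf (x * sqrt (1 + u\<^sup>2) - u)
      - 2 * std_normal_cdf x"
proof -
  obtain c \<eta> where c: "0 < c" "0 < \<eta>" "\<eta> \<le> 1"
    and ge: "\<And>u. 0 \<le> u \<Longrightarrow> u \<le> \<eta> \<Longrightarrow> 4 * c * u ^ 3 \<le> E' u"
    using E'_ge by blast
  have small: "c * u ^ 4 \<le> E u" if "0 \<le> u" "u \<le> \<eta>" for u
  proof -
    have "(\<lambda>u. E u - c * u ^ 4) 0 \<le> (\<lambda>u. E u - c * u ^ 4) u"
    proof (rule DERIV_nonneg_imp_nondecreasing[OF that(1)])
      fix t assume "0 \<le> t" "t \<le> u"
      then show "\<exists>y. ((\<lambda>u. E u - c * u ^ 4) has_real_derivative y) (at t) \<and> 0 \<le> y"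
        using ge[of t] that(2)
        by (intro exI[of _ "E' t - 4 * c * t ^ 3"] conjI) (auto intro!: derivative_eq_intros DERIV_E)
    qed
    then show ?thesis by (simp add: E_def)
  qed
  have mono: "E \<eta> \<le> E u" if "\<eta> \<le> u" for u
    by (rule DERIV_nonneg_imp_nondecreasing[OF that]) (use DERIV_E E'_nonneg c in force)
  have pos: "c * \<eta> ^ 4 * min (u ^ 4) 1 \<le> E u" if "0 \<le> u" for u
  proof (cases "u \<le> \<eta>")
    case True
    have "\<eta> ^ 4 \<le> 1" using c by (intro power_le_one) auto
    then have "\<eta> ^ 4 * min (u ^ 4) 1 \<le> 1 * u ^ 4" by (intro mult_mono) auto
    then have "c * (\<eta> ^ 4 * min (u ^ 4) 1) \<le> c * u ^ 4" using c by (intro mult_left_mono) auto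
    then show ?thesis using small[OF that True] by (simp add: mult.assoc)
  next
    case False
    have "c * \<eta> ^ 4 * min (u ^ 4) 1 \<le> c * \<eta> ^ 4 * 1" using c by (intro mult_left_mono) auto
    also have "\<dots> \<le> E \<eta>" using small[of \<eta>] c by simp
    also have "\<dots> \<le> E u" using False by (intro mono) auto
    finally show ?thesis .
  qed
  have "E (- u) = E u" for u by (simp add: E_def)
  then have "c * \<eta> ^ 4 * min (u ^ 4) 1 \<le> E u" for u
    using pos[of u] pos[of "- u"] by (cases "0 \<le> u") auto
  then show ?thesis using c by (intro exI[of _ "c * \<eta> ^ 4"]) (auto simp: E_def)
qed

end

section \<open>Taylor expansion with a remainder uniform in x\<close>

text \<open>With z = |y| + 2, the bound z / k \<le> exp (z / k) turns the power into
  \<open>exp (\<bar>y\<bar> + 2)\<close>, and |y| \<le> y^2 / 2 + 1 / 2 lets the Gaussian factor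
  absorb that up to exp (5 / 2).\<close>

lemma std_normal_density_mult_power_bounded:
  "\<exists>C. \<forall>y. std_normal_density y * (\<bar>y\<bar> + 2) ^ k \<le> C"
proof (cases "k = 0")
  case True
  show ?thesis
    by (rule exI[of _ "1 / sqrt (2 * pi)"]) (auto simp: True std_normal_density_def intro!: divide_right_mono)
next
  case False
  have "std_normal_density y * (\<bar>y\<bar> + 2) ^ k \<le> 1 / sqrt (2 * pi) * (real k ^ k * exp (5 / 2))" for y
  proof -
    have "(\<bar>y\<bar> + 2) / k \<le> exp ((\<bar>y\<bar> + 2) / k)"
      using exp_ge_add_one_self[of "(\<bar>y\<bar> + 2) / k"] by linarith
    then have "((\<bar>y\<bar> + 2) / k) ^ k \<le> exp ((\<bar>y\<bar> + 2) / k) ^ k"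
      by (intro power_mono) auto
    also have "\<dots> = exp (\<bar>y\<bar> + 2)"
      using False by (simp add: exp_of_nat_mult[symmetric])
    finally have 1: "(\<bar>y\<bar> + 2) ^ k \<le> real k ^ k * exp (\<bar>y\<bar> + 2)"
      using False by (simp add: power_divide field_simps)
    have "\<bar>y\<bar> \<le> y\<^sup>2 / 2 + 1 / 2"
      using zero_le_power2[of "\<bar>y\<bar> - 1"] by (simp add: power2_diff)
    then have "exp (- y\<^sup>2 / 2) * exp (\<bar>y\<bar> + 2) \<le> exp (5 / 2)"
      by (simp add: exp_add[symmetric])
    then have 2: "real k ^ k * (exp (- y\<^sup>2 / 2) * exp (\<bar>y\<bar> + 2)) \<le> real k ^ k * exp (5 / 2)"
      by (intro mult_left_mono) auto
    have "exp (- y\<^sup>2 / 2) * (\<bar>y\<bar> + 2) ^ k \<le> exp (- y\<^sup>2 / 2) * (real k ^ k * exp (\<bar>y\<bar> + 2))"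
      by (intro mult_left_mono 1) auto
    also have "\<dots> = real k ^ k * (exp (- y\<^sup>2 / 2) * exp (\<bar>y\<bar> + 2))" by (simp only: mult_ac)
    also note 2
    finally have "exp (- y\<^sup>2 / 2) * (\<bar>y\<bar> + 2) ^ k \<le> real k ^ k * exp (5 / 2)" .
    then have "1 / sqrt (2 * pi) * (exp (- y\<^sup>2 / 2) * (\<bar>y\<bar> + 2) ^ k) \<le> 1 / sqrt (2 * pi) * (real k ^ k * exp (5 / 2))"
      by (intro mult_left_mono) auto
    then show ?thesis by (simp add: std_normal_density_def mult_ac)
  qed
  then show ?thesis by blast
qed

context
  fixes x :: real
begin

text \<open>For m up to 4 this is the m-th derivative in u of the argument
  \<open>x * sqrt (1 + u\<^sup>2) - u\<close>, written with s = sqrt (1 + u^2); the last branch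
  stands for m = 4.\<close>

private definition Y :: "nat \<Rightarrow> real \<Rightarrow> real" where
  "Y m u = (let s = sqrt (1 + u\<^sup>2) in
     if m = 0 then x * s - u
     else if m = 1 then x * u / s - 1
     else if m = 2 then x / s ^ 3
     else if m = 3 then - 3 * x * u / s ^ 5
     else - 3 * x / s ^ 5 + 15 * x * u\<^sup>2 / s ^ 7)"

private lemma DERIV_Y:
  assumes "m < 4"
  shows "(Y m has_real_derivative Y (Suc m) u) (at u)"
proof -
  define s where "s = sqrt (1 + u\<^sup>2)"
  have s: "0 < s" "s * s = 1 + u\<^sup>2" by (auto simp: s_def add_pos_nonneg)
  have D: "((\<lambda>u. sqrt (1 + u\<^sup>2)) has_real_derivative u / s) (at u)"
    unfolding s_def by (rule DERIV_sqrt_one_plus_square)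
  from assms consider "m = 0" | "m = 1" | "m = 2" | "m = 3" by linarith
  then show ?thesis
  proof cases
    case 1
    have "((\<lambda>u. x * sqrt (1 + u\<^sup>2) - u) has_real_derivative x * (u / s) - 1) (at u)"
      by (intro derivative_intros D DERIV_cmult)
    then show ?thesis using 1 by (simp add: Y_def[abs_def] s_def)
  next
    case 2
    have "((\<lambda>u. x * u / sqrt (1 + u\<^sup>2) - 1) has_real_derivative
        (x * 1 * s - x * u * (u / s)) / (s * s) - 0) (at u)"
      unfolding s_def by (rule derivative_intros DERIV_cmult D[unfolded s_def])+ (use s s_def in auto)
    also have "(x * 1 * s - x * u * (u / s)) / (s * s) - 0 = x / s ^ 3"
      using s(1) by (simp add: field_simps power3_eq_cube) (use s(2) in algebra)
    finally show ?thesis using 2 by (simp add: Y_def[abs_def] s_def)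
  next
    case 3
    have "((\<lambda>u. x / sqrt (1 + u\<^sup>2) ^ 3) has_real_derivative
        (0 * s ^ 3 - x * (real 3 * (u / s * s ^ (3 - Suc 0)))) / (s ^ 3 * s ^ 3)) (at u)"
      unfolding s_def by (rule DERIV_divide[OF DERIV_const DERIV_power[OF D[unfolded s_def]]]) (use s s_def in auto)
    also have "(0 * s ^ 3 - x * (real 3 * (u / s * s ^ (3 - Suc 0)))) / (s ^ 3 * s ^ 3) = - 3 * x * u / s ^ 5"
      using s(1) by (simp add: field_simps power_numeral_reduce)
    finally have "((\<lambda>u. x / sqrt (1 + u\<^sup>2) ^ 3) has_real_derivative - 3 * x * u / s ^ 5) (at u)" .
    then show ?thesis using 3 by (simp add: Y_def[abs_def] s_def)
  next
    case 4
    have "((\<lambda>u. - 3 * x * u / sqrt (1 + u\<^sup>2) ^ 5) has_real_derivative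
        (- 3 * x * 1 * s ^ 5 - - 3 * x * u * (real 5 * (u / s * s ^ (5 - Suc 0)))) / (s ^ 5 * s ^ 5)) (at u)"
      unfolding s_def
      by (rule DERIV_divide[OF DERIV_cmult[OF DERIV_ident] DERIV_power[OF D[unfolded s_def]]]) (use s s_def in auto)
    also have "(- 3 * x * 1 * s ^ 5 - - 3 * x * u * (real 5 * (u / s * s ^ (5 - Suc 0)))) / (s ^ 5 * s ^ 5)
        = - 3 * x / s ^ 5 + 15 * x * u\<^sup>2 / s ^ 7"
      using s(1) by (simp add: field_simps power_numeral_reduce)
    finally have "((\<lambda>u. - 3 * x * u / sqrt (1 + u\<^sup>2) ^ 5) has_real_derivative - 3 * x / s ^ 5 + 15 * x * u\<^sup>2 / s ^ 7) (at u)" .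
    then show ?thesis using 4 by (simp add: Y_def[abs_def] s_def Let_def)
  qed
qed

text \<open>The m-th derivative of \<open>std_normal_cdf (Y 0 u)\<close> by the formula of Faa di
  Bruno. The factors -y, y^2 - 1 and 3 y - y^3 are those of the successive derivatives of the
  density.\<close>

private definition F :: "nat \<Rightarrow> real \<Rightarrow> real" where
  "F m u = (let y = Y 0 u; y1 = Y 1 u; y2 = Y 2 u; y3 = Y 3 u; y4 = Y 4 u in
     if m = 0 then std_normal_cdf y
     else if m = 1 then std_normal_density y * y1
     else if m = 2 then std_normal_density y * (y2 - y * y1\<^sup>2)
     else if m = 3 then std_normal_density y * (y3 - 3 * y * y1 * y2 + (y\<^sup>2 - 1) * y1 ^ 3)
     else std_normal_density y * ((3 * y - y ^ 3) * y1 ^ 4 + 6 * (y\<^sup>2 - 1) * y1\<^sup>2 * y2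
        - y * (3 * y2\<^sup>2 + 4 * y1 * y3) + y4))"

private lemma DERIV_F:
  assumes "m < 4"
  shows "(F m has_real_derivative F (Suc m) u) (at u)"
proof -
  have Y: "(Y 0 has_real_derivative Y 1 u) (at u)" "(Y 1 has_real_derivative Y 2 u) (at u)"
    "(Y 2 has_real_derivative Y 3 u) (at u)" "(Y 3 has_real_derivative Y 4 u) (at u)"
    subgoal using DERIV_Y[of 0 u] by simp
    subgoal using DERIV_Y[of 1 u, unfolded Suc_1] by (simp del: One_nat_def)
    subgoal using DERIV_Y[of 2 u] by simp
    subgoal using DERIV_Y[of 3 u] by simp
    done
  from assms consider "m = 0" | "m = 1" | "m = 2" | "m = 3" by linarith
  then show ?thesis
  proof cases
    case 1
    have "((\<lambda>u. std_normal_cdf (Y 0 u)) has_real_derivative std_normal_density (Y 0 u) * Y 1 u) (at u)"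
      by (intro derivative_intros Y)
    then show ?thesis using 1 by (simp add: F_def[abs_def] Let_def)
  next
    case 2
    have "((\<lambda>u. std_normal_density (Y 0 u) * Y 1 u) has_real_derivative
        std_normal_density (Y 0 u) * (Y 2 u - Y 0 u * (Y 1 u)\<^sup>2)) (at u)"
      by (rule derivative_eq_intros Y refl)+ (simp, algebra)
    then show ?thesis using 2 by (simp add: F_def[abs_def] Let_def)
  next
    case 3
    have "((\<lambda>u. std_normal_density (Y 0 u) * (Y 2 u - Y 0 u * (Y 1 u)\<^sup>2)) has_real_derivative
        std_normal_density (Y 0 u) * (Y 3 u - 3 * Y 0 u * Y 1 u * Y 2 u + ((Y 0 u)\<^sup>2 - 1) * (Y 1 u) ^ 3)) (at u)"
      by (rule derivative_eq_intros Y refl)+ (simp, algebra)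
    then show ?thesis using 3 by (simp add: F_def[abs_def] Let_def)
  next
    case 4
    have "((\<lambda>u. std_normal_density (Y 0 u) * (Y 3 u - 3 * Y 0 u * Y 1 u * Y 2 u + ((Y 0 u)\<^sup>2 - 1) * (Y 1 u) ^ 3))
       has_real_derivative
        std_normal_density (Y 0 u) * ((3 * Y 0 u - Y 0 u ^ 3) * Y 1 u ^ 4 + 6 * ((Y 0 u)\<^sup>2 - 1) * (Y 1 u)\<^sup>2 * Y 2 u
        - Y 0 u * (3 * (Y 2 u)\<^sup>2 + 4 * Y 1 u * Y 3 u) + Y 4 u)) (at u)"
      by (rule derivative_eq_intros Y refl)+ (simp, algebra)
    then show ?thesis using 4 by (simp add: F_def[abs_def] Let_def)
  qed
qed

text \<open>For \<open>\<bar>u\<bar> \<le> 1\<close> one has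
  \<open>\<bar>x\<bar> \<le> \<bar>Y 0 u\<bar> + 1\<close>. Measuring everything by
  \<open>Y 0 u\<close>, the point where the density is evaluated, instead of by x is what makes the
  remainder uniform in x.\<close>

private lemma Y_bounds:
  assumes "\<bar>u\<bar> \<le> 1"
  shows "\<bar>Y 1 u\<bar> \<le> \<bar>Y 0 u\<bar> + 2" "\<bar>Y 2 u\<bar> \<le> \<bar>Y 0 u\<bar> + 2" "\<bar>Y 3 u\<bar> \<le> 3 * (\<bar>Y 0 u\<bar> + 2)"
    "\<bar>Y 4 u\<bar> \<le> 18 * (\<bar>Y 0 u\<bar> + 2)"
proof -
  define s where "s = sqrt (1 + u\<^sup>2)"
  have s1: "1 \<le> s" by (simp add: s_def)
  have div: "\<bar>a / s ^ k\<bar> \<le> \<bar>a\<bar>" for a k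
    using s1 divide_left_mono[of 1 "s ^ k" "\<bar>a\<bar>"] by (simp add: abs_mult)
  have "\<bar>x\<bar> * 1 \<le> \<bar>x\<bar> * s" using s1 by (intro mult_left_mono) auto
  also have "\<dots> = \<bar>x * s\<bar>" using s1 by (simp add: abs_mult)
  also have "\<dots> \<le> \<bar>Y 0 u\<bar> + 1"
    using assms by (simp add: Y_def s_def[symmetric])
  finally have xb: "\<bar>x\<bar> \<le> \<bar>Y 0 u\<bar> + 1" by simp
  have xu: "\<bar>x * u\<bar> \<le> \<bar>x\<bar>" using assms mult_left_mono[of "\<bar>u\<bar>" 1 "\<bar>x\<bar>"] by (simp add: abs_mult)
  have "\<bar>u\<^sup>2\<bar> \<le> 1" using assms by (simp add: abs_square_le_1)
  then have xuu: "\<bar>x * u\<^sup>2\<bar> \<le> \<bar>x\<bar>" using mult_left_mono[of "\<bar>u\<^sup>2\<bar>" 1 "\<bar>x\<bar>"] by (simp add: abs_mult)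
  have lin3: "\<bar>a\<bar> \<le> b \<Longrightarrow> \<bar>- 3 * a\<bar> \<le> 3 * b" for a b :: real by linarith
  have lin18: "\<bar>a\<bar> \<le> b \<Longrightarrow> \<bar>c\<bar> \<le> b \<Longrightarrow> \<bar>- 3 * a + 15 * c\<bar> \<le> 18 * b" for a b c :: real by linarith
  have Y: "Y 1 u = x * u / s ^ 1 - 1" "Y 2 u = x / s ^ 3" "Y 3 u = - 3 * (x * u / s ^ 5)"
    "Y 4 u = - 3 * (x / s ^ 5) + 15 * (x * u\<^sup>2 / s ^ 7)"
    by (auto simp: Y_def s_def[symmetric])
  show "\<bar>Y 1 u\<bar> \<le> \<bar>Y 0 u\<bar> + 2"
    unfolding Y using div[of "x * u" 1] xb xu by linarith
  show "\<bar>Y 2 u\<bar> \<le> \<bar>Y 0 u\<bar> + 2"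
    unfolding Y using div[of x 3] xb by linarith
  show "\<bar>Y 3 u\<bar> \<le> 3 * (\<bar>Y 0 u\<bar> + 2)"
    unfolding Y by (rule lin3) (use div[of "x * u" 5] xb xu in linarith)
  show "\<bar>Y 4 u\<bar> \<le> 18 * (\<bar>Y 0 u\<bar> + 2)"
    unfolding Y by (rule lin18) (use div[of x 5] div[of "x * u\<^sup>2" 7] xb xuu in linarith)+
qed

text \<open>Every factor is at most a multiple of Z = |y| + 2. The highest power, 7, comes from
  \<open>y ^ 3 * y1 ^ 4\<close>, and 43 = 4 + 6 + 15 + 18 adds up the coefficients.\<close>

private lemma F4_bound:
  assumes "\<bar>u\<bar> \<le> 1"
  shows "\<bar>F 4 u\<bar> \<le> 43 * (std_normal_density (Y 0 u) * (\<bar>Y 0 u\<bar> + 2) ^ 7)"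
proof -
  define y y1 y2 y3 y4 where "y = Y 0 u" and "y1 = Y 1 u" and "y2 = Y 2 u" and "y3 = Y 3 u" and "y4 = Y 4 u"
  define Z where "Z = \<bar>y\<bar> + 2"
  have Z: "1 \<le> Z" "0 \<le> Z" by (auto simp: Z_def)
  have up: "Z ^ k \<le> Z ^ 7" if "k \<le> 7" for k using Z that by (intro power_increasing) auto
  have b: "\<bar>y1\<bar> \<le> Z" "\<bar>y2\<bar> \<le> Z" "\<bar>y3\<bar> \<le> 3 * Z" "\<bar>y4\<bar> \<le> 18 * Z" "\<bar>y\<bar> \<le> Z"
    using Y_bounds[OF assms] by (auto simp: Z_def y_def y1_def y2_def y3_def y4_def)
  have Zk: "Z \<le> Z ^ 3" using Z power_increasing[of 1 3 Z] by simp
  have c3: "\<bar>3 * y - y ^ 3\<bar> \<le> 4 * Z ^ 3"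
  proof -
    have "\<bar>3 * y\<bar> = 3 * \<bar>y\<bar>" "\<bar>y ^ 3\<bar> \<le> Z ^ 3"
      using power_mono[OF b(5) abs_ge_zero, of 3] by (simp_all add: power_abs)
    then show ?thesis
      using abs_triangle_ineq4[of "3 * y" "y ^ 3"] b(5) Zk by linarith
  qed
  have c2: "\<bar>y\<^sup>2 - 1\<bar> \<le> Z\<^sup>2"
    using abs_triangle_ineq4[of "y\<^sup>2" 1] by (simp add: Z_def power2_sum)
  have t1: "\<bar>(3 * y - y ^ 3) * y1 ^ 4\<bar> \<le> 4 * Z ^ 3 * Z ^ 4"
    unfolding abs_mult power_abs by (intro mult_mono power_mono b c3) (use Z in auto)
  have t2: "\<bar>6 * (y\<^sup>2 - 1) * y1\<^sup>2 * y2\<bar> \<le> 6 * Z\<^sup>2 * Z\<^sup>2 * Z"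
    unfolding abs_mult power_abs using Z c2 by (intro mult_mono power_mono b) auto
  have "\<bar>3 * y2\<^sup>2 + 4 * y1 * y3\<bar> \<le> \<bar>3 * y2\<^sup>2\<bar> + \<bar>4 * y1 * y3\<bar>" by (rule abs_triangle_ineq)
  also have "\<dots> \<le> 3 * Z\<^sup>2 + 4 * Z * (3 * Z)"
    unfolding abs_mult power_abs using Z by (intro add_mono mult_mono power_mono b) auto
  finally have t3: "\<bar>y * (3 * y2\<^sup>2 + 4 * y1 * y3)\<bar> \<le> Z * (3 * Z\<^sup>2 + 4 * Z * (3 * Z))"
    unfolding abs_mult[of y] using Z by (intro mult_mono b) auto
  have "\<bar>(3 * y - y ^ 3) * y1 ^ 4 + 6 * (y\<^sup>2 - 1) * y1\<^sup>2 * y2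
        - y * (3 * y2\<^sup>2 + 4 * y1 * y3) + y4\<bar>
      \<le> 4 * Z ^ 3 * Z ^ 4 + 6 * Z\<^sup>2 * Z\<^sup>2 * Z + Z * (3 * Z\<^sup>2 + 4 * Z * (3 * Z)) + 18 * Z"
    using t1 t2 t3 b(4) by linarith
  also have "\<dots> = 4 * Z ^ 7 + 6 * Z ^ 5 + 15 * Z ^ 3 + 18 * Z ^ 1"
    by (simp add: algebra_simps power_numeral_reduce)
  also have "\<dots> \<le> 43 * Z ^ 7"
    using up[of 5] up[of 3] up[of 1] by simp
  finally have "std_normal_density y * \<bar>(3 * y - y ^ 3) * y1 ^ 4 + 6 * (y\<^sup>2 - 1) * y1\<^sup>2 * y2
        - y * (3 * y2\<^sup>2 + 4 * y1 * y3) + y4\<bar> \<le> std_normal_density y * (43 * Z ^ 7)"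
    by (intro mult_left_mono) auto
  moreover have "\<bar>F 4 u\<bar> = std_normal_density y * \<bar>(3 * y - y ^ 3) * y1 ^ 4 + 6 * (y\<^sup>2 - 1) * y1\<^sup>2 * y2
        - y * (3 * y2\<^sup>2 + 4 * y1 * y3) + y4\<bar>"
    by (simp add: F_def Let_def abs_mult y_def y1_def y2_def y3_def y4_def)
  ultimately show ?thesis
    by (simp add: Z_def y_def)
qed

text \<open>Taylor formula with Lagrange remainder \<open>F 4 t / 24 * u ^ 4\<close>; the constant 2
  exceeds 43 / 24.\<close>

lemma cdf_expansion_bound:
  assumes "\<bar>u\<bar> \<le> 1" and C: "\<And>y. std_normal_density y * (\<bar>y\<bar> + 2) ^ 7 \<le> C"
  shows "\<bar>std_normal_cdf (x * sqrt (1 + u\<^sup>2) - u) - std_normal_cdf x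
      - std_normal_density x * (- u + (2 * x\<^sup>2 + 1) * u ^ 3 / 6)\<bar> \<le> 2 * C * u ^ 4"
proof -
  have "\<exists>t. \<bar>t\<bar> \<le> \<bar>u\<bar> \<and> F 0 u = (\<Sum>m<4. F m 0 / fact m * u ^ m) + F 4 t / fact 4 * u ^ 4"
    by (rule Maclaurin_bi_le) (use DERIV_F in auto)
  then obtain t where t: "\<bar>t\<bar> \<le> \<bar>u\<bar>"
    and eq: "F 0 u = (\<Sum>m<4. F m 0 / fact m * u ^ m) + F 4 t / fact 4 * u ^ 4" by blast
  have Y0: "Y 0 0 = x" "Y 1 0 = -1" "Y 2 0 = x" "Y 3 0 = 0" by (auto simp: Y_def)
  \<comment> \<open>The second derivative vanishes because the curvature x of the square root
    cancels against -y y1^2 = -x.\<close>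
  have F0: "F 0 0 = std_normal_cdf x" "F 1 0 = - std_normal_density x" "F 2 0 = 0"
    "F 3 0 = std_normal_density x * (2 * x\<^sup>2 + 1)"
    using Y0 by (auto simp: F_def Let_def power2_eq_square algebra_simps)
  have Fu: "F 0 u = std_normal_cdf (x * sqrt (1 + u\<^sup>2) - u)" by (simp add: F_def Y_def)
  have sum4: "(\<Sum>m<4. F m 0 / fact m * u ^ m) = F 0 0 + F 1 0 * u + F 2 0 / 2 * u\<^sup>2 + F 3 0 / 6 * u ^ 3"
    by (simp add: eval_nat_numeral fact_numeral)
  have "std_normal_cdf (x * sqrt (1 + u\<^sup>2) - u) - std_normal_cdf x
      - std_normal_density x * (- u + (2 * x\<^sup>2 + 1) * u ^ 3 / 6) = F 4 t / 24 * u ^ 4"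
    unfolding eq[unfolded Fu] sum4 F0 by (simp add: fact_numeral field_simps)
  also have "\<bar>\<dots>\<bar> = \<bar>F 4 t\<bar> / 24 * u ^ 4" by (simp add: abs_mult)
  also have "\<dots> \<le> 2 * C * u ^ 4"
    using F4_bound[of t] t assms(1) C[of "Y 0 t"] C[of 0]
      order_trans[OF F4_bound[of t] mult_left_mono[OF C[of "Y 0 t"], of 43]]
    by (intro mult_right_mono) (auto simp: std_normal_density_def intro: order_trans[of 0 "2^7 / sqrt (2 * pi)" C])
  finally show ?thesis .
qed

end

lemma cdf_uniform_expansion:
  "\<exists>C. \<forall>x u. \<bar>u\<bar> \<le> 1 \<longrightarrow>
    \<bar>std_normal_cdf (x * sqrt (1 + u\<^sup>2) - u) - std_normal_cdf x
      - std_normal_density x * (- u + (2 * x\<^sup>2 + 1) * u ^ 3 / 6)\<bar> \<le> C * u ^ 4"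
  using std_normal_density_mult_power_bounded[of 7] cdf_expansion_bound by metis

section \<open>Tails in the domain of attraction of the normal law\<close>

lemma LIMSEQ_subseqI:
  fixes f :: "nat \<Rightarrow> 'a::metric_space"
  assumes "\<And>r :: nat \<Rightarrow> nat. strict_mono r \<Longrightarrow> \<exists>l. strict_mono l \<and> (\<lambda>k. f (r (l k))) \<longlonglongrightarrow> L"
  shows "f \<longlonglongrightarrow> L"
proof (rule ccontr)
  assume "\<not> f \<longlonglongrightarrow> L"
  then obtain e where e: "0 < e" "\<not> (\<forall>\<^sub>F n in sequentially. dist (f n) L < e)"
    by (auto simp: tendsto_iff)
  then have "infinite {n. \<not> dist (f n) L < e}"
    by (simp add: cofinite_eq_sequentially[symmetric] eventually_cofinite)
  then obtain r :: "nat \<Rightarrow> nat" where r: "strict_mono r" "\<forall>n. \<not> dist (f (r n)) L < e"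
    using infinite_enumerate[of "{n. \<not> dist (f n) L < e}"] by force
  obtain l where l: "strict_mono l" "(\<lambda>k. f (r (l k))) \<longlonglongrightarrow> L"
    using assms[OF r(1)] by blast
  have "\<forall>\<^sub>F k in sequentially. dist (f (r (l k))) L < e"
    using l(2) e(1) by (auto simp: tendsto_iff)
  then have "\<forall>\<^sub>F k in sequentially. False"
    by (rule eventually_mono) (use r(2) in blast)
  then show False by simp
qed

lemma bounded_real_sequence_subseq:
  fixes t :: "nat \<Rightarrow> real"
  assumes "\<And>k. A \<le> t k" "\<And>k. t k \<le> B"
  obtains l t0 where "strict_mono l" "(\<lambda>k. t (l k)) \<longlonglongrightarrow> t0" "A \<le> t0" "t0 \<le> B"
proof -
  have "\<forall>n. t n \<in> {A..B}" using assms by auto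
  then obtain t0 l where "t0 \<in> {A..B}" "strict_mono l" "(t \<circ> l) \<longlonglongrightarrow> t0"
    using seq_compactE[OF compact_imp_seq_compact[OF compact_Icc[of A B]], of t] by blast
  then show ?thesis using that by (auto simp: comp_def)
qed

text \<open>Taking logarithms, N times -ln (r^2) tends to L; since N tends to infinity, r^2 tends to
  1. Then r^2 (-ln (r^2)) \<le> 1 - r^2 \<le> -ln (r^2) squeezes the claim.\<close>

lemma tendsto_exponent_of_power:
  fixes r :: "nat \<Rightarrow> real" and N :: "nat \<Rightarrow> nat"
  assumes r: "\<And>k. 0 \<le> r k" "\<And>k. r k \<le> 1"
    and N: "filterlim N at_top sequentially"
    and lim: "(\<lambda>k. r k ^ N k) \<longlonglongrightarrow> exp (- L / 2)"
  shows "(\<lambda>k. real (N k) * (1 - (r k)\<^sup>2)) \<longlonglongrightarrow> L"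
proof -
  have Npos: "\<forall>\<^sub>F k in sequentially. 0 < N k"
    using eventually_compose_filterlim[OF eventually_gt_at_top[of 0] N] by simp
  have "\<forall>\<^sub>F k in sequentially. 0 < r k ^ N k"
    using lim by (rule order_tendstoD) simp
  with Npos have pos: "\<forall>\<^sub>F k in sequentially. 0 < r k"
  proof eventually_elim
    case (elim k)
    then show ?case using r(1)[of k] by (cases "r k = 0") (auto simp: zero_power)
  qed
  have "(\<lambda>k. - 2 * ln (r k ^ N k)) \<longlonglongrightarrow> - 2 * ln (exp (- L / 2))"
    by (intro tendsto_intros lim) simp
  moreover have "\<forall>\<^sub>F k in sequentially. - 2 * ln (r k ^ N k) = - (real (N k) * ln ((r k)\<^sup>2))"
    using pos by eventually_elim (simp add: ln_realpow)
  ultimately have "(\<lambda>k. - (real (N k) * ln ((r k)\<^sup>2))) \<longlonglongrightarrow> - 2 * ln (exp (- L / 2))"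
    by (rule Lim_transform_eventually)
  then have nl: "(\<lambda>k. - (real (N k) * ln ((r k)\<^sup>2))) \<longlonglongrightarrow> L"
    unfolding ln_exp by simp
  have "(\<lambda>k. - (real (N k) * ln ((r k)\<^sup>2)) * inverse (real (N k))) \<longlonglongrightarrow> L * 0"
    by (intro tendsto_mult nl tendsto_inverse_0_at_top filterlim_compose[OF filterlim_real_sequentially N])
  moreover have "\<forall>\<^sub>F k in sequentially. - (real (N k) * ln ((r k)\<^sup>2)) * inverse (real (N k)) = - ln ((r k)\<^sup>2)"
    using Npos by eventually_elim auto
  ultimately have "(\<lambda>k. - ln ((r k)\<^sup>2)) \<longlonglongrightarrow> L * 0"
    by (rule Lim_transform_eventually)
  then have "(\<lambda>k. - ln ((r k)\<^sup>2)) \<longlonglongrightarrow> 0"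
    by simp
  then have "(\<lambda>k. exp (- (- ln ((r k)\<^sup>2)))) \<longlonglongrightarrow> exp (- 0)"
    by (intro tendsto_intros)
  moreover have "\<forall>\<^sub>F k in sequentially. exp (- (- ln ((r k)\<^sup>2))) = (r k)\<^sup>2"
    using pos by eventually_elim simp
  ultimately have "(\<lambda>k. (r k)\<^sup>2) \<longlonglongrightarrow> exp (- 0)"
    by (rule Lim_transform_eventually)
  then have r2: "(\<lambda>k. (r k)\<^sup>2) \<longlonglongrightarrow> 1"
    by simp
  show ?thesis
  proof (rule real_tendsto_sandwich)
    show "(\<lambda>k. (r k)\<^sup>2 * - (real (N k) * ln ((r k)\<^sup>2))) \<longlonglongrightarrow> L"
      using tendsto_mult[OF r2 nl] by simp
    show "\<forall>\<^sub>F k in sequentially. (r k)\<^sup>2 * - (real (N k) * ln ((r k)\<^sup>2)) \<le> real (N k) * (1 - (r k)\<^sup>2)"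
      using pos
    proof eventually_elim
      case (elim k)
      have "- ln ((r k)\<^sup>2) \<le> inverse ((r k)\<^sup>2) - 1"
        using ln_le_minus_one[of "inverse ((r k)\<^sup>2)"] elim by (simp add: ln_inverse)
      then have "(r k)\<^sup>2 * - ln ((r k)\<^sup>2) \<le> (r k)\<^sup>2 * (inverse ((r k)\<^sup>2) - 1)"
        by (intro mult_left_mono) auto
      also have "\<dots> = 1 - (r k)\<^sup>2" using elim by (simp add: algebra_simps)
      finally have "real (N k) * ((r k)\<^sup>2 * - ln ((r k)\<^sup>2)) \<le> real (N k) * (1 - (r k)\<^sup>2)"
        by (intro mult_left_mono) auto
      then show ?case by (simp add: mult_ac)
    qed
    show "\<forall>\<^sub>F k in sequentially. real (N k) * (1 - (r k)\<^sup>2) \<le> - (real (N k) * ln ((r k)\<^sup>2))"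
      using pos
    proof eventually_elim
      case (elim k)
      have "1 - (r k)\<^sup>2 \<le> - ln ((r k)\<^sup>2)"
        using ln_le_minus_one[of "(r k)\<^sup>2"] elim by simp
      then have "real (N k) * (1 - (r k)\<^sup>2) \<le> real (N k) * - ln ((r k)\<^sup>2)"
        by (intro mult_left_mono) auto
      then show ?case by simp
    qed
  qed (rule nl)
qed

text \<open>Convergence of the characteristic functions at each fixed point would not cover moving
  arguments \<open>t k\<close>. On a Skorohod coupling the integrands converge pointwise together
  with their arguments, and domination by 1 suffices.\<close>

lemma weak_conv_char_moving_argument:
  assumes \<nu>: "\<And>n. real_distribution (\<nu> n)"
    and conv: "weak_conv_m \<nu> std_normal_distribution"
    and N: "filterlim N at_top sequentially" and t: "t \<longlonglongrightarrow> t0"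
  shows "(\<lambda>k. cmod (char (\<nu> (N k)) (t k))) \<longlonglongrightarrow> exp (- t0\<^sup>2 / 2)"
proof -
  have "weak_conv_m (\<lambda>k. \<nu> (N k)) std_normal_distribution"
    using conv N unfolding weak_conv_m_def weak_conv_def
    by (auto intro: filterlim_compose[of _ _ at_top N])
  from Skorohod[OF \<nu> real_dist_normal_dist this]
  obtain \<Omega> :: "real measure" and Y Z where ps: "prob_space \<Omega>"
    and Y [measurable]: "\<And>n. Y n \<in> borel_measurable \<Omega>" and dY: "\<And>n. distr \<Omega> borel (Y n) = \<nu> (N n)"
    and Z [measurable]: "Z \<in> borel_measurable \<Omega>" and dZ: "distr \<Omega> borel Z = std_normal_distribution"
    and YZ: "\<And>x. x \<in> space \<Omega> \<Longrightarrow> (\<lambda>n. Y n x) \<longlonglongrightarrow> Z x"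
    by force
  interpret prob_space \<Omega> by (rule ps)
  have "(\<lambda>k. CLINT x|\<Omega>. iexp (t k * Y k x)) \<longlonglongrightarrow> (CLINT x|\<Omega>. iexp (t0 * Z x))"
  proof (rule integral_dominated_convergence[where w = "\<lambda>_. 1"])
    show "AE x in \<Omega>. (\<lambda>k. iexp (t k * Y k x)) \<longlonglongrightarrow> iexp (t0 * Z x)"
      by (rule AE_I2) (intro tendsto_intros t YZ)
  qed auto
  moreover have "(CLINT x|\<Omega>. iexp (t k * Y k x)) = char (\<nu> (N k)) (t k)" for k
    unfolding dY[symmetric] char_def by (subst integral_distr) auto
  moreover have "(CLINT x|\<Omega>. iexp (t0 * Z x)) = char std_normal_distribution t0"
    unfolding dZ[symmetric] char_def by (subst integral_distr) auto
  ultimately have "(\<lambda>k. cmod (char (\<nu> (N k)) (t k))) \<longlonglongrightarrow> cmod (char std_normal_distribution t0)"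
    by (auto intro: tendsto_norm)
  then show ?thesis
    by (simp add: char_std_normal_distribution)
qed

text \<open>The centering contributes a factor of modulus 1, so passing to moduli eliminates
  \<open>c\<close>.\<close>

lemma cmod_char_normalized_sum:
  fixes \<mu> :: "real measure"
  assumes "real_distribution \<mu>"
  shows "cmod (char (distr (\<Pi>\<^sub>M i\<in>(UNIV :: nat set). \<mu>) borel (\<lambda>\<omega>. ((\<Sum>i<n. \<omega> i) - c) / a)) t)
    = cmod (char \<mu> (t / a)) ^ n"
proof -
  interpret \<mu>: real_distribution \<mu> by fact
  interpret P: product_prob_space "\<lambda>_::nat. \<mu>" UNIV
    by unfold_locales
  let ?P = "\<Pi>\<^sub>M i\<in>(UNIV :: nat set). \<mu>"
  have sets_P: "sets ?P = sets (\<Pi>\<^sub>M i\<in>(UNIV :: nat set). borel)"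
    by (intro sets_PiM_cong) auto
  have comp: "distr ?P borel (\<lambda>\<omega>. \<omega> i) = \<mu>" for i
  proof -
    have "distr ?P borel (\<lambda>\<omega>. \<omega> i) = distr ?P \<mu> (\<lambda>\<omega>. \<omega> i)"
      by (intro distr_cong) auto
    also have "\<dots> = \<mu>" by (rule P.PiM_component) simp
    finally show ?thesis .
  qed
  have meas [measurable]: "(\<lambda>\<omega>. \<omega> i) \<in> borel_measurable ?P" for i :: nat
    using measurable_component_singleton[of i UNIV "\<lambda>_. \<mu>"] by (simp add: measurable_cong_sets[OF refl \<mu>.events_eq_borel])
  have indep: "P.indep_vars (\<lambda>_. borel) (\<lambda>i \<omega>. \<omega> i) (UNIV :: nat set)"
  proof (subst P.indep_vars_iff_distr_eq_PiM)
    show "distr ?P (\<Pi>\<^sub>M i\<in>UNIV. borel) (\<lambda>x. \<lambda>i\<in>UNIV. x i) = (\<Pi>\<^sub>M i\<in>UNIV. distr ?P borel (\<lambda>\<omega>. \<omega> i))"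
      unfolding comp using sets_P by (auto simp: restrict_UNIV intro!: distr_id2)
  qed auto
  have "char (distr ?P borel (\<lambda>\<omega>. \<Sum>i<n. \<omega> i)) (t / a) = (\<Prod>i<n. char (distr ?P borel (\<lambda>\<omega>. \<omega> i)) (t / a))"
    by (intro P.char_distr_sum P.indep_vars_subset[OF indep]) auto
  also have "\<dots> = char \<mu> (t / a) ^ n" by (simp add: comp)
  finally have sum: "char (distr ?P borel (\<lambda>\<omega>. \<Sum>i<n. \<omega> i)) (t / a) = char \<mu> (t / a) ^ n" .
  have "char (distr ?P borel (\<lambda>\<omega>. ((\<Sum>i<n. \<omega> i) - c) / a)) t
      = (CLINT \<omega>|?P. iexp (- (t * c / a)) * iexp (t / a * (\<Sum>i<n. \<omega> i)))"
    unfolding char_def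
    by (subst integral_distr)
       (auto intro!: Bochner_Integration.integral_cong simp: exp_add[symmetric] algebra_simps diff_divide_distrib)
  also have "\<dots> = iexp (- (t * c / a)) * (CLINT \<omega>|?P. iexp (t / a * (\<Sum>i<n. \<omega> i)))"
    by (rule integral_mult_right_zero)
  also have "(CLINT \<omega>|?P. iexp (t / a * (\<Sum>i<n. \<omega> i))) = char (distr ?P borel (\<lambda>\<omega>. \<Sum>i<n. \<omega> i)) (t / a)"
    unfolding char_def by (subst integral_distr) auto
  finally show ?thesis
    by (simp add: sum norm_mult norm_power)
qed

section \<open>The norming sequence and the defect of the characteristic function\<close>

context
  fixes \<mu> :: "real measure" and a c :: "nat \<Rightarrow> real"
  assumes \<mu>: "real_distribution \<mu>"
    and a: "\<And>n. 0 < a n"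
    and conv: "weak_conv_m
         (\<lambda>n. distr (\<Pi>\<^sub>M i\<in>(UNIV :: nat set). \<mu>) borel (\<lambda>\<omega>. ((\<Sum>i<n. \<omega> i) - c n) / a n))
         std_normal_distribution"
begin

interpretation real_distribution \<mu> by (rule \<mu>)

private abbreviation \<rho> where "\<rho> s \<equiv> cmod (char \<mu> s)"

private lemma power_char_tendsto:
  assumes "filterlim N at_top sequentially" "t \<longlonglongrightarrow> t0"
  shows "(\<lambda>k. \<rho> (t k / a (N k)) ^ N k) \<longlonglongrightarrow> exp (- t0\<^sup>2 / 2)"
proof -
  interpret P: product_prob_space "\<lambda>_::nat. \<mu>" UNIV
    by unfold_locales
  let ?P = "\<Pi>\<^sub>M i\<in>(UNIV :: nat set). \<mu>"
  have meas [measurable]: "(\<lambda>\<omega>. \<omega> i) \<in> borel_measurable ?P" for i :: nat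
    using measurable_component_singleton[of i UNIV "\<lambda>_. \<mu>"]
    by (simp add: measurable_cong_sets[OF refl events_eq_borel])
  have "real_distribution (distr ?P borel (\<lambda>\<omega>. ((\<Sum>i<n. \<omega> i) - c n) / a n))" for n
    by (intro P.real_distribution_distr) simp
  from weak_conv_char_moving_argument[OF this conv assms] show ?thesis
    unfolding cmod_char_normalized_sum[OF \<mu>] .
qed

private lemma rho_bounds: "0 \<le> \<rho> s" "\<rho> s \<le> 1"
  using cmod_char_le_1 by auto

private lemma scaled_defect_tendsto:
  assumes "filterlim N at_top sequentially" "t \<longlonglongrightarrow> t0"
  shows "(\<lambda>k. real (N k) * (1 - (\<rho> (t k / a (N k)))\<^sup>2)) \<longlonglongrightarrow> t0\<^sup>2"
  using power_char_tendsto[OF assms] rho_bounds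
  by (intro tendsto_exponent_of_power assms) auto

text \<open>If \<open>a\<close> stays below a bound along a subsequence, then for every s > 0 the
  arguments \<open>s * a n\<close> converge along a further one, and powers of
  \<open>\<rho> s\<close> with growing exponents have a positive limit. This forces
  \<open>\<rho> s = 1\<close> for all s > 0, against the limit exp (-1/2) at t = 1.\<close>

private lemma norming_at_top: "filterlim a at_top sequentially"
proof (rule ccontr)
  assume "\<not> filterlim a at_top sequentially"
  then obtain A where "\<not> (\<forall>\<^sub>F n in sequentially. A \<le> a n)"
    by (auto simp: filterlim_at_top)
  then have "infinite {n. \<not> A \<le> a n}"
    by (simp add: cofinite_eq_sequentially[symmetric] eventually_cofinite)
  then obtain r :: "nat \<Rightarrow> nat" where r: "strict_mono r" "\<forall>n. \<not> A \<le> a (r n)"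
    using infinite_enumerate[of "{n. \<not> A \<le> a n}"] by force
  have "\<rho> s = 1" if s: "0 < s" for s
  proof -
    obtain l t0 where l: "strict_mono l" "(\<lambda>k. s * a (r (l k))) \<longlonglongrightarrow> t0"
      by (rule bounded_real_sequence_subseq[of 0 "\<lambda>k. s * a (r k)" "s * A"])
         (use r(2) a s in \<open>auto simp: not_le less_imp_le\<close>)
    have lim: "filterlim (\<lambda>k. r (l k)) at_top sequentially"
      using filterlim_compose[OF filterlim_subseq[OF r(1)] filterlim_subseq[OF l(1)]] .
    have "(\<lambda>k. \<rho> (s * a (r (l k)) / a (r (l k))) ^ r (l k)) \<longlonglongrightarrow> exp (- t0\<^sup>2 / 2)"
      by (rule power_char_tendsto[OF lim l(2)])
    moreover have "s * a n / a n = s" for n using a[of n] by simp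
    ultimately have lim1: "(\<lambda>k. \<rho> s ^ r (l k)) \<longlonglongrightarrow> exp (- t0\<^sup>2 / 2)" by simp
    show "\<rho> s = 1"
    proof (rule ccontr)
      assume "\<rho> s \<noteq> 1"
      then have "(\<lambda>n. \<rho> s ^ n) \<longlonglongrightarrow> 0" using rho_bounds[of s] by (intro LIMSEQ_realpow_zero) auto
      from filterlim_compose[OF this lim] lim1 have "exp (- t0\<^sup>2 / 2) = (0::real)"
        using LIMSEQ_unique by blast
      then show False by simp
    qed
  qed
  then have "(\<lambda>k. \<rho> (1 / a k) ^ k) = (\<lambda>k. 1)" using a by (auto simp: fun_eq_iff)
  moreover have "(\<lambda>k. \<rho> (1 / a k) ^ k) \<longlonglongrightarrow> exp (- 1\<^sup>2 / 2)"
    by (rule power_char_tendsto) (auto simp: filterlim_ident)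
  ultimately have "exp (- 1\<^sup>2 / 2) = (1::real)" by (metis LIMSEQ_const_iff)
  then show False by simp
qed

text \<open>Were the ratio above 2 infinitely often, a limit point t0 \<le> 1/2 of a_n / a_(n+1)
  would exist. Read through a_n, \<open>\<rho> (1 / a (n + 1)) ^ n\<close> tends to exp (-t0^2 / 2);
  read through a_(n+1), one more factor gives exp (-1/2). That factor tends to 1, so t0^2 = 1, a
  contradiction.\<close>

private lemma norming_ratio: "\<forall>\<^sub>F n in sequentially. a (Suc n) \<le> 2 * a n"
proof (rule ccontr)
  assume "\<not> ?thesis"
  then have "infinite {n. \<not> a (Suc n) \<le> 2 * a n}"
    by (simp add: cofinite_eq_sequentially[symmetric] eventually_cofinite)
  then obtain r :: "nat \<Rightarrow> nat" where r: "strict_mono r" "\<forall>n. \<not> a (Suc (r n)) \<le> 2 * a (r n)"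
    using infinite_enumerate[of "{n. \<not> a (Suc n) \<le> 2 * a n}"] by force
  have "a (r k) / a (Suc (r k)) \<le> 1 / 2" "0 \<le> a (r k) / a (Suc (r k))" for k
    using r(2)[rule_format, of k] a[of "Suc (r k)"] a[of "r k"] by (auto simp: field_simps)
  then obtain l t0 where l: "strict_mono l" "(\<lambda>k. a (r (l k)) / a (Suc (r (l k)))) \<longlonglongrightarrow> t0"
    and t0: "0 \<le> t0" "t0 \<le> 1 / 2"
    using bounded_real_sequence_subseq[of 0 "\<lambda>k. a (r k) / a (Suc (r k))" "1 / 2"] by metis
  define m where "m k = r (l k)" for k
  have m: "filterlim m at_top sequentially"
    unfolding m_def using filterlim_compose[OF filterlim_subseq[OF r(1)] filterlim_subseq[OF l(1)]] .
  then have Sm: "filterlim (\<lambda>k. Suc (m k)) at_top sequentially"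
    by (rule filterlim_compose[OF filterlim_Suc])
  have "(\<lambda>k. \<rho> (a (m k) / a (Suc (m k)) / a (m k)) ^ m k) \<longlonglongrightarrow> exp (- t0\<^sup>2 / 2)"
    using l(2) unfolding m_def[symmetric] by (rule power_char_tendsto[OF m])
  moreover have "a (m k) / a (Suc (m k)) / a (m k) = 1 / a (Suc (m k))" for k
    using a[of "m k"] by simp
  ultimately have 1: "(\<lambda>k. \<rho> (1 / a (Suc (m k))) ^ m k) \<longlonglongrightarrow> exp (- t0\<^sup>2 / 2)" by simp
  have 2: "(\<lambda>k. \<rho> (1 / a (Suc (m k))) ^ Suc (m k)) \<longlonglongrightarrow> exp (- 1\<^sup>2 / 2)"
    by (rule power_char_tendsto[OF Sm]) auto
  have "(\<lambda>k. 1 / a (Suc (m k))) \<longlonglongrightarrow> 0"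
    using filterlim_compose[OF tendsto_inverse_0_at_top[OF norming_at_top] Sm] by (simp add: divide_inverse)
  then have "(\<lambda>k. \<rho> (1 / a (Suc (m k)))) \<longlonglongrightarrow> cmod (char \<mu> 0)"
    by (intro tendsto_norm isCont_tendsto_compose[OF isCont_char])
  then have "(\<lambda>k. \<rho> (1 / a (Suc (m k))) * \<rho> (1 / a (Suc (m k))) ^ m k) \<longlonglongrightarrow> 1 * exp (- t0\<^sup>2 / 2)"
    by (intro tendsto_mult 1) (simp add: char_zero)
  with 2 have "exp (- t0\<^sup>2 / 2) = exp (- 1\<^sup>2 / (2::real))"
    using LIMSEQ_unique by fastforce
  then have "t0\<^sup>2 = 1" by simp
  then show False using t0 power_mono[of t0 "1 / 2" 2] by (simp add: power2_eq_square)
qed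

text \<open>Bounded ratios \<open>a (n + 1) / a n\<close> suffice to pass from the norming sequence to all small arguments.\<close>

lemma norming_sequence_hits:
  fixes s :: "nat \<Rightarrow> real"
  assumes s: "\<And>k. 0 < s k" "s \<longlonglongrightarrow> 0"
  shows "\<exists>N. filterlim N at_top sequentially \<and> (\<forall>\<^sub>F k in sequentially. 1 \<le> s k * a (N k) \<and> s k * a (N k) \<le> 2)"
proof -
  obtain n0 where n0: "\<And>n. n0 \<le> n \<Longrightarrow> a (Suc n) \<le> 2 * a n"
    using norming_ratio by (auto simp: eventually_sequentially)
  define N where "N k = (LEAST n. n0 \<le> n \<and> 1 / s k < a n)" for k
  have ex: "\<exists>n. n0 \<le> n \<and> 1 / s k < a n" for k
  proof -
    have "\<forall>\<^sub>F n in sequentially. 1 / s k < a n"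
      using norming_at_top by (simp add: filterlim_at_top_dense)
    then have "\<forall>\<^sub>F n in sequentially. n0 \<le> n \<and> 1 / s k < a n"
      by (intro eventually_conj eventually_ge_at_top)
    then show ?thesis by (auto simp: eventually_sequentially)
  qed
  have N: "n0 \<le> N k" "1 / s k < a (N k)" for k
    using LeastI_ex[OF ex[of k]] by (auto simp: N_def)
  have Nmin: "a n \<le> 1 / s k" if "n0 \<le> n" "n < N k" for n k
    using not_less_Least[of n "\<lambda>n. n0 \<le> n \<and> 1 / s k < a n"] that by (auto simp: N_def not_less)
  have inv: "filterlim (\<lambda>k. 1 / s k) at_top sequentially"
    using filterlim_inverse_at_top[OF s(2)] s(1) by (simp add: divide_inverse)
  have large: "\<forall>\<^sub>F k in sequentially. B < N k" for B
  proof -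
    have "\<forall>\<^sub>F k in sequentially. Max (a ` {..B}) < 1 / s k"
      using inv unfolding filterlim_at_top_dense by blast
    then show ?thesis
    proof eventually_elim
      case (elim k)
      then have "Max (a ` {..B}) < a (N k)" using N(2)[of k] by (rule order_less_trans)
      then have "a (N k) \<notin> a ` {..B}"
        using Max_ge[of "a ` {..B}" "a (N k)"] by fastforce
      then show ?case by (metis atMost_iff imageI not_le)
    qed
  qed
  have "\<forall>\<^sub>F k in sequentially. 1 \<le> s k * a (N k) \<and> s k * a (N k) \<le> 2"
    using large[of n0]
  proof eventually_elim
    case (elim k)
    \<comment> \<open>The predecessor of \<open>N k\<close> is still at least \<open>n0\<close>, so
      minimality bounds \<open>a n\<close> by \<open>1 / s k\<close> and the ratio bound doubles
      this at most.\<close>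
    then obtain n where n: "N k = Suc n" "n0 \<le> n" by (cases "N k") auto
    have "a (N k) \<le> 2 * (1 / s k)" using n0[OF n(2)] Nmin[of n k] n by simp
    then show ?case using N(2)[of k] s(1)[of k] by (simp add: field_simps)
  qed
  moreover have "filterlim N at_top sequentially"
    unfolding filterlim_at_top
  proof
    show "\<forall>\<^sub>F k in sequentially. B \<le> N k" for B
      using large[of B] by (rule eventually_mono) simp
  qed
  ultimately show ?thesis by blast
qed

text \<open>Scaled by \<open>N k\<close>, the two defects converge along subsequences to t0^2 and (2
  t0)^2 with t0 in [1, 2]. Their quotient 4 is free of t0, so all subsequences agree.\<close>

lemma char_defect_doubling:
  "((\<lambda>s. (1 - (\<rho> (2 * s))\<^sup>2) / (1 - (\<rho> s)\<^sup>2)) \<longlongrightarrow> 4) (at_right 0)"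
  unfolding tendsto_at_iff_sequentially comp_def
proof (intro allI impI)
  fix s :: "nat \<Rightarrow> real"
  assume "\<forall>i. s i \<in> {0<..} - {0}" and s0: "s \<longlonglongrightarrow> 0"
  then have s: "0 < s k" for k by auto
  obtain N where N: "filterlim N at_top sequentially"
    and sN: "\<forall>\<^sub>F k in sequentially. 1 \<le> s k * a (N k) \<and> s k * a (N k) \<le> 2"
    using norming_sequence_hits[OF s s0] by blast
  obtain k0 where k0: "\<And>k. k0 \<le> k \<Longrightarrow> 1 \<le> s k * a (N k) \<and> s k * a (N k) \<le> 2"
    using sN by (auto simp: eventually_sequentially)
  show "(\<lambda>k. (1 - (\<rho> (2 * s k))\<^sup>2) / (1 - (\<rho> (s k))\<^sup>2)) \<longlonglongrightarrow> 4"
  proof (rule LIMSEQ_subseqI)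
    fix r :: "nat \<Rightarrow> nat" assume r: "strict_mono r"
    \<comment> \<open>Dropping the first \<open>k0\<close> indices makes the bounds 1 and 2 hold at
      every index, as the compactness lemma requires.\<close>
    define r' where "r' k = r (k + k0)" for k
    have "k0 \<le> r' k" for k using seq_suble[OF r, of "k + k0"] by (simp add: r'_def)
    then obtain l t0 where l: "strict_mono l" "(\<lambda>k. s (r' (l k)) * a (N (r' (l k)))) \<longlonglongrightarrow> t0"
      and t0: "1 \<le> t0" "t0 \<le> 2"
      using bounded_real_sequence_subseq[of 1 "\<lambda>k. s (r' k) * a (N (r' k))" 2] k0 by metis
    define m where "m k = r' (l k)" for k
    have mono: "strict_mono (\<lambda>k. l k + k0)" using l(1) by (auto simp: strict_mono_def)
    have mt: "filterlim m at_top sequentially"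
      unfolding m_def r'_def
      using filterlim_compose[OF filterlim_subseq[OF r] filterlim_subseq[OF mono]] .
    have Nm: "filterlim (\<lambda>k. N (m k)) at_top sequentially"
      by (rule filterlim_compose[OF N mt])
    have lim: "(\<lambda>k. s (m k) * a (N (m k))) \<longlonglongrightarrow> t0" using l(2) by (simp add: m_def)
    have cancel: "s (m k) * a (N (m k)) / a (N (m k)) = s (m k)"
      "2 * (s (m k) * a (N (m k))) / a (N (m k)) = 2 * s (m k)" for k
      using a[of "N (m k)"] by simp_all
    have 1: "(\<lambda>k. real (N (m k)) * (1 - (\<rho> (s (m k)))\<^sup>2)) \<longlonglongrightarrow> t0\<^sup>2"
      using scaled_defect_tendsto[OF Nm lim] unfolding cancel .
    have 2: "(\<lambda>k. real (N (m k)) * (1 - (\<rho> (2 * s (m k)))\<^sup>2)) \<longlonglongrightarrow> (2 * t0)\<^sup>2"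
      using scaled_defect_tendsto[OF Nm tendsto_mult[OF tendsto_const[of 2] lim]] unfolding cancel .
    have "(\<lambda>k. real (N (m k)) * (1 - (\<rho> (2 * s (m k)))\<^sup>2) / (real (N (m k)) * (1 - (\<rho> (s (m k)))\<^sup>2))) \<longlonglongrightarrow> (2 * t0)\<^sup>2 / t0\<^sup>2"
      using t0 by (intro tendsto_divide 1 2) auto
    then have "(\<lambda>k. real (N (m k)) * (1 - (\<rho> (2 * s (m k)))\<^sup>2) / (real (N (m k)) * (1 - (\<rho> (s (m k)))\<^sup>2))) \<longlonglongrightarrow> 4"
      using t0 by (simp add: power_mult_distrib)
    moreover have "\<forall>\<^sub>F k in sequentially. 0 < N (m k)"
      using eventually_compose_filterlim[OF eventually_gt_at_top[of 0] Nm] by simp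
    then have "\<forall>\<^sub>F k in sequentially. real (N (m k)) * (1 - (\<rho> (2 * s (m k)))\<^sup>2) / (real (N (m k)) * (1 - (\<rho> (s (m k)))\<^sup>2))
        = (1 - (\<rho> (2 * s (m k)))\<^sup>2) / (1 - (\<rho> (s (m k)))\<^sup>2)"
      by eventually_elim simp
    ultimately have "(\<lambda>k. (1 - (\<rho> (2 * s (m k)))\<^sup>2) / (1 - (\<rho> (s (m k)))\<^sup>2)) \<longlonglongrightarrow> 4"
      by (rule Lim_transform_eventually)
    then show "\<exists>l. strict_mono l \<and> (\<lambda>k. (1 - (\<rho> (2 * s (r (l k))))\<^sup>2) / (1 - (\<rho> (s (r (l k))))\<^sup>2)) \<longlonglongrightarrow> 4"
      using mono by (intro exI[of _ "\<lambda>k. l k + k0"]) (simp add: m_def r'_def)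
  qed
qed

text \<open>Excludes a degenerate law; needed later for a positive truncated second moment.\<close>

lemma char_defect_pos: "\<exists>s>0. \<rho> s \<noteq> 1"
proof (rule ccontr)
  assume "\<not> ?thesis"
  then have "(\<lambda>k. \<rho> (1 / a k) ^ k) = (\<lambda>k. 1)" using a by (auto simp: fun_eq_iff)
  moreover have "(\<lambda>k. \<rho> (1 / a k) ^ k) \<longlonglongrightarrow> exp (- 1\<^sup>2 / 2)"
    by (rule power_char_tendsto) (auto simp: filterlim_ident)
  ultimately have "exp (- 1\<^sup>2 / 2) = (1::real)" by (metis LIMSEQ_const_iff)
  then show False by simp
qed

end

section \<open>Tails through symmetrization\<close>

lemma sin4_interval_integral_ge:
  fixes S y :: real
  assumes S: "0 < S" and y: "4 / S \<le> \<bar>y\<bar>"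
  shows "3 / 32 * S \<le> (LBINT s:{S..2 * S}. sin (s * y / 2) ^ 4)"
proof -
  have y0: "y \<noteq> 0" using S y by auto
  define G where "G s = 3 / 8 * s - sin (s * y) / (2 * y) + sin (2 * (s * y)) / (16 * y)" for s
  have id: "sin \<theta> ^ 4 = 3 / 8 - cos (2 * \<theta>) / 2 + cos (2 * (2 * \<theta>)) / 8" for \<theta> :: real
  proof -
    have "sin \<theta> ^ 4 = (1 - (cos \<theta>)\<^sup>2)\<^sup>2"
      by (simp add: sin_squared_eq[symmetric] flip: power_mult)
    moreover have c2: "cos (2 * \<theta>) = 2 * (cos \<theta>)\<^sup>2 - 1" by (rule cos_double_cos)
    moreover have "cos (2 * (2 * \<theta>)) = 2 * (2 * (cos \<theta>)\<^sup>2 - 1)\<^sup>2 - 1"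
      by (subst cos_double_cos) (simp only: c2)
    ultimately show ?thesis
      by (simp only:) (simp add: power2_eq_square field_simps)
  qed
  have D: "(G has_real_derivative sin (s * y / 2) ^ 4) (at s)" for s
  proof -
    have "(G has_real_derivative 3 / 8 - cos (s * y) / 2 + cos (2 * (s * y)) / 8) (at s)"
      unfolding G_def[abs_def] using y0 by (auto intro!: derivative_eq_intros simp: field_simps)
    also have "3 / 8 - cos (s * y) / 2 + cos (2 * (s * y)) / 8 = sin (s * y / 2) ^ 4"
      using id[of "s * y / 2"] by simp
    finally show ?thesis .
  qed
  have "(LBINT s:{S..2 * S}. sin (s * y / 2) ^ 4) = G (2 * S) - G S"
  proof -
    have "(LBINT s:{S..2 * S}. sin (s * y / 2) ^ 4) = (\<integral>s. sin (s * y / 2) ^ 4 * indicator {S..2 * S} s \<partial>lborel)"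
      by (simp add: set_lebesgue_integral_def mult.commute)
    also have "\<dots> = G (2 * S) - G S"
      using S by (intro integral_FTC_Icc_real D) (auto intro!: continuous_intros)
    finally show ?thesis .
  qed
  moreover have b: "\<bar>sin t / (k * y)\<bar> \<le> S / (4 * k)" if "0 < k" for t k :: real
  proof -
    have "\<bar>sin t / (k * y)\<bar> \<le> 1 / (k * \<bar>y\<bar>)"
      using that y0 by (auto simp: abs_mult intro!: divide_right_mono)
    also have "\<dots> \<le> 1 / (k * (4 / S))"
      using that S y by (intro divide_left_mono mult_left_mono mult_pos_pos) auto
    finally show ?thesis by (simp add: mult.commute)
  qed
  \<comment> \<open>The mean 3/8 of the fourth power of the sine contributes 3/8 S. The four
    oscillating terms cost at most 2 (S / 8) + 2 (S / 64) = 9/32 S.\<close>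
  have "S * (3 / 32) \<le> G (2 * S) - G S"
    using b[of 2 "2 * S * y"] b[of 2 "S * y"] b[of 16 "2 * (2 * S * y)"] b[of 16 "2 * (S * y)"]
    unfolding G_def by linarith
  ultimately show ?thesis by simp
qed

context
  fixes \<mu> :: "real measure"
  assumes \<mu>: "real_distribution \<mu>"
begin

interpretation real_distribution \<mu> by (rule \<mu>)
interpretation P: pair_prob_space \<mu> \<mu> by unfold_locales

private abbreviation "PP \<equiv> \<mu> \<Otimes>\<^sub>M \<mu>"
private abbreviation "\<psi> s \<equiv> cmod (char \<mu> s)"

text \<open>The symmetrized variable is \<open>fst z - snd z\<close> on the product space. The half
  angle makes \<open>H 2\<close> half of the defect of the squared modulus.\<close>

private definition H :: "nat \<Rightarrow> real \<Rightarrow> real" where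
  "H k s = (\<integral>z. sin (s * (fst z - snd z) / 2) ^ k \<partial>PP)"

private lemma meas_diff [measurable]: "(\<lambda>z. fst z - snd z) \<in> borel_measurable PP"
  by measurable

private lemma sin_power_bounds: "(sin t)\<^sup>2 \<le> 1" "(sin t)\<^sup>2 \<le> 4" "sin t ^ 4 \<le> 1" for t :: real
proof -
  show *: "(sin t)\<^sup>2 \<le> 1" by (simp add: abs_square_le_1)
  then show "(sin t)\<^sup>2 \<le> 4" by simp
  show "sin t ^ 4 \<le> 1"
    using power_le_one[OF _ *, of 2] by (simp flip: power_mult)
qed

private lemma integrable_bdd:
  fixes f :: "real \<times> real \<Rightarrow> real"
  assumes "f \<in> borel_measurable PP" "\<And>z. \<bar>f z\<bar> \<le> B"
  shows "integrable PP f"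
  by (rule P.P.integrable_const_bound[of _ B]) (use assms in auto)

private lemma integral_PP_mult:
  fixes f g :: "real \<Rightarrow> real"
  assumes [measurable]: "f \<in> borel_measurable \<mu>" "g \<in> borel_measurable \<mu>"
    and "\<And>z. \<bar>f z\<bar> \<le> 1" "\<And>z. \<bar>g z\<bar> \<le> 1"
  shows "(\<integral>z. f (fst z) * g (snd z) \<partial>PP) = (\<integral>x. f x \<partial>\<mu>) * (\<integral>y. g y \<partial>\<mu>)"
proof -
  have "integrable PP (\<lambda>z. f (fst z) * g (snd z))"
    by (rule integrable_bdd[of _ 1]) (use assms in \<open>auto simp: abs_mult intro!: mult_le_one\<close>)
  from P.integral_fst'[OF this] show ?thesis
    by simp
qed

private lemma cos_expectation: "(\<integral>z. cos (s * (fst z - snd z)) \<partial>PP) = (\<psi> s)\<^sup>2"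
proof -
  have int: "integrable \<mu> (\<lambda>x. iexp (s * x))" by (intro integrable_iexp) auto
  have "Re (char \<mu> s) = (\<integral>x. cos (s * x) \<partial>\<mu>)" "Im (char \<mu> s) = (\<integral>x. sin (s * x) \<partial>\<mu>)"
    unfolding char_def using int by (auto simp flip: integral_Re integral_Im simp: Re_exp Im_exp)
  then have "(\<psi> s)\<^sup>2 = (\<integral>x. cos (s * x) \<partial>\<mu>) * (\<integral>x. cos (s * x) \<partial>\<mu>) + (\<integral>x. sin (s * x) \<partial>\<mu>) * (\<integral>x. sin (s * x) \<partial>\<mu>)"
    unfolding cmod_power2 by (simp add: power2_eq_square)
  also have "\<dots> = (\<integral>z. cos (s * fst z) * cos (s * snd z) \<partial>PP) + (\<integral>z. sin (s * fst z) * sin (s * snd z) \<partial>PP)"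
    by (subst (1 2) integral_PP_mult) auto
  also have "\<dots> = (\<integral>z. cos (s * fst z) * cos (s * snd z) + sin (s * fst z) * sin (s * snd z) \<partial>PP)"
    by (subst Bochner_Integration.integral_add)
       (auto intro!: integrable_bdd[of _ 1] simp: abs_mult intro!: mult_le_one)
  also have "\<dots> = (\<integral>z. cos (s * (fst z - snd z)) \<partial>PP)"
    by (simp add: cos_diff right_diff_distrib)
  finally show ?thesis by simp
qed

private lemma H2_eq: "H 2 s = (1 - (\<psi> s)\<^sup>2) / 2"
proof -
  have "H 2 s = (\<integral>z. (1 - cos (s * (fst z - snd z))) / 2 \<partial>PP)"
    unfolding H_def
  proof (rule Bochner_Integration.integral_cong[OF refl])
    fix z :: "real \<times> real"
    have "cos (2 * (s * (fst z - snd z) / 2)) = 1 - 2 * sin (s * (fst z - snd z) / 2) ^ 2"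
      by (rule cos_double_sin)
    then show "(sin (s * (fst z - snd z) / 2))\<^sup>2 = (1 - cos (s * (fst z - snd z))) / 2" by simp
  qed
  also have "\<dots> = (1 - (\<integral>z. cos (s * (fst z - snd z)) \<partial>PP)) / 2"
    by (subst integral_divide_zero, subst Bochner_Integration.integral_diff)
       (auto intro!: integrable_bdd[of _ 1] simp: P.P.prob_space)
  finally show ?thesis by (simp add: cos_expectation)
qed

text \<open>From sin (2 \<theta>) = 2 sin \<theta> cos \<theta>. It makes \<open>H 4\<close> the
  deviation of the doubling ratio from 4, so that the limit in \<open>char_defect_doubling\<close>
  says \<open>H 4\<close> is negligible against \<open>H 2\<close>.\<close>

private lemma H4_eq: "H 4 s = H 2 s - H 2 (2 * s) / 4"
proof -
  have "H 2 s - H 2 (2 * s) / 4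
      = (\<integral>z. sin (s * (fst z - snd z) / 2) ^ 2 - sin (2 * s * (fst z - snd z) / 2) ^ 2 / 4 \<partial>PP)"
    unfolding H_def
    by (subst Bochner_Integration.integral_diff)
       (auto intro!: integrable_bdd[of _ 1] simp: sin_power_bounds)
  also have "\<dots> = H 4 s"
    unfolding H_def
  proof (rule Bochner_Integration.integral_cong[OF refl])
    fix z :: "real \<times> real"
    define \<theta> where "\<theta> = s * (fst z - snd z) / 2"
    have "sin (2 * s * (fst z - snd z) / 2) = 2 * sin \<theta> * cos \<theta>"
      using sin_double[of \<theta>] by (simp add: \<theta>_def)
    then have "(sin \<theta>)\<^sup>2 - sin (2 * s * (fst z - snd z) / 2) ^ 2 / 4 = (sin \<theta>)\<^sup>2 * (1 - (cos \<theta>)\<^sup>2)"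
      by (simp add: power_mult_distrib algebra_simps)
    also have "\<dots> = (sin \<theta>)\<^sup>2 * (sin \<theta>)\<^sup>2" by (simp add: sin_squared_eq)
    also have "\<dots> = sin \<theta> ^ 4" by (simp flip: power_add)
    finally show "(sin (s * (fst z - snd z) / 2))\<^sup>2 - (sin (2 * s * (fst z - snd z) / 2))\<^sup>2 / 4 = sin (s * (fst z - snd z) / 2) ^ 4"
      by (simp add: \<theta>_def)
  qed
  finally show ?thesis by simp
qed

text \<open>Tonelli: integrating over s first gives at least 3/32 S wherever |Y| is at least 4 / S;
  integrating over the product space first gives at most \<open>B * S\<close>.\<close>

private lemma tail_le_average_H4:
  assumes S: "0 < S" and B: "\<And>s. S \<le> s \<Longrightarrow> s \<le> 2 * S \<Longrightarrow> H 4 s \<le> B"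
  shows "3 / 32 * measure PP {z \<in> space PP. 4 / S \<le> \<bar>fst z - snd z\<bar>} \<le> B"
proof -
  let ?A = "{z \<in> space PP. 4 / S \<le> \<bar>fst z - snd z\<bar>}"
  define f where "f z s = indicator {S..2 * S} s * sin (s * (fst z - snd z) / 2) ^ 4" for z :: "real \<times> real" and s :: real
  have [measurable]: "(\<lambda>(z, s). f z s) \<in> borel_measurable (PP \<Otimes>\<^sub>M lborel)"
    unfolding f_def by measurable
  have f0: "0 \<le> f z s" for z s by (simp add: f_def)
  have f1: "f z s \<le> 1" for z s
    by (auto simp: f_def indicator_def sin_power_bounds)
  have A: "?A \<in> sets PP" by measurable
  interpret Q: pair_sigma_finite PP lborel ..
  have B0: "0 \<le> B"
    using B[of S] S by (intro order_trans[OF _ B[of S]]) (auto simp: H_def intro!: Bochner_Integration.integral_nonneg)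
  have "ennreal (3 / 32 * S) * emeasure PP ?A = (\<integral>\<^sup>+z. ennreal (3 / 32 * S) * indicator ?A z \<partial>PP)"
    by (rule nn_integral_cmult_indicator[OF A, symmetric])
  also have "\<dots> \<le> (\<integral>\<^sup>+z. \<integral>\<^sup>+s. ennreal (f z s) \<partial>lborel \<partial>PP)"
  proof (rule nn_integral_mono)
    fix z
    show "ennreal (3 / 32 * S) * indicator ?A z \<le> (\<integral>\<^sup>+s. ennreal (f z s) \<partial>lborel)"
    proof (cases "z \<in> ?A")
      case True
      have "continuous_on {S..2 * S} (\<lambda>s. sin (s * (fst z - snd z) / 2) ^ 4)"
        by (intro continuous_intros) auto
      from borel_integrable_atLeastAtMost'[OF this] have "integrable lborel (f z)"
        by (simp add: set_integrable_def f_def[abs_def])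
      then have "(\<integral>\<^sup>+s. ennreal (f z s) \<partial>lborel) = ennreal (\<integral>s. f z s \<partial>lborel)"
        by (intro nn_integral_eq_integral) (auto simp: f0)
      moreover have "3 / 32 * S \<le> (\<integral>s. f z s \<partial>lborel)"
        using sin4_interval_integral_ge[OF S, of "fst z - snd z"] True by (simp add: f_def set_lebesgue_integral_def)
      ultimately show ?thesis using True by (auto intro!: ennreal_leI)
    qed auto
  qed
  also have "\<dots> = (\<integral>\<^sup>+s. \<integral>\<^sup>+z. ennreal (f z s) \<partial>PP \<partial>lborel)"
    by (rule Q.Fubini'[symmetric]) measurable
  also have "\<dots> \<le> (\<integral>\<^sup>+s. ennreal B * indicator {S..2 * S} s \<partial>lborel)"
  proof (rule nn_integral_mono)
    fix s :: real
    have "(\<integral>\<^sup>+z. ennreal (f z s) \<partial>PP) = ennreal (\<integral>z. f z s \<partial>PP)"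
      by (intro nn_integral_eq_integral integrable_bdd[of _ 1]) (use f0 f1 in \<open>auto simp: f_def\<close>)
    also have "(\<integral>z. f z s \<partial>PP) = indicator {S..2 * S} s * H 4 s"
      by (simp add: f_def H_def)
    also have "ennreal \<dots> \<le> ennreal B * indicator {S..2 * S} s"
      using B by (auto simp: indicator_def intro!: ennreal_leI)
    finally show "(\<integral>\<^sup>+z. ennreal (f z s) \<partial>PP) \<le> ennreal B * indicator {S..2 * S} s" .
  qed
  also have "\<dots> = ennreal B * ennreal S"
    using S by (simp add: nn_integral_cmult_indicator)
  finally have "ennreal (3 / 32 * S) * emeasure PP ?A \<le> ennreal B * ennreal S" .
  moreover have "ennreal (3 / 32 * S) * emeasure PP ?A = ennreal (3 / 32 * S * measure PP ?A)"
    unfolding P.P.emeasure_eq_measure by (rule ennreal_mult[symmetric]) (use S in auto)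
  moreover have "ennreal B * ennreal S = ennreal (B * S)"
    by (rule ennreal_mult[symmetric]) (use S B0 in auto)
  ultimately have "ennreal (3 / 32 * S * measure PP ?A) \<le> ennreal (B * S)"
    by simp
  then have "3 / 32 * S * measure PP ?A \<le> B * S"
    using B0 S by (subst (asm) ennreal_le_iff) auto
  then show ?thesis using S by (simp add: field_simps)
qed

private lemma integral_fst_PP:
  fixes g :: "real \<Rightarrow> real"
  assumes [measurable]: "g \<in> borel_measurable \<mu>" and "\<And>z. \<bar>g z\<bar> \<le> 1"
  shows "(\<integral>z. g (fst z) \<partial>PP) = (\<integral>x. g x \<partial>\<mu>)" "(\<integral>z. g (snd z) \<partial>PP) = (\<integral>x. g x \<partial>\<mu>)"
  using integral_PP_mult[of g "\<lambda>_. 1"] integral_PP_mult[of "\<lambda>_. 1" g] assms prob_space by simp_all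

private lemma symmetrized_second_moment_le:
  "(\<integral>z. min 1 (S\<^sup>2 * (fst z - snd z)\<^sup>2) \<partial>PP) \<le> 4 * (\<integral>x. min 1 (S\<^sup>2 * x\<^sup>2) \<partial>\<mu>)"
proof -
  have min1: "min 1 a \<le> 2 * min 1 b + 2 * min 1 c" if "a \<le> 2 * b + 2 * c" "0 \<le> b" "0 \<le> c" for a b c :: real
    using that by linarith
  let ?g = "\<lambda>x. min 1 (S\<^sup>2 * x\<^sup>2)"
  have "(\<integral>z. ?g (fst z - snd z) \<partial>PP) \<le> (\<integral>z. 2 * ?g (fst z) + 2 * ?g (snd z) \<partial>PP)"
  proof (rule integral_mono)
    show "integrable PP (\<lambda>z. ?g (fst z - snd z))" by (rule integrable_bdd[of _ 1]) auto
    show "integrable PP (\<lambda>z. 2 * ?g (fst z) + 2 * ?g (snd z))"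
      by (intro Bochner_Integration.integrable_add integrable_mult_right integrable_bdd[of _ 1]) auto
    fix z :: "real \<times> real"
    have "(fst z - snd z)\<^sup>2 \<le> 2 * (fst z)\<^sup>2 + 2 * (snd z)\<^sup>2"
      using zero_le_power2[of "fst z + snd z"] by (simp add: power2_sum power2_diff)
    then have "S\<^sup>2 * (fst z - snd z)\<^sup>2 \<le> S\<^sup>2 * (2 * (fst z)\<^sup>2 + 2 * (snd z)\<^sup>2)"
      by (intro mult_left_mono) auto
    also have "\<dots> = 2 * (S\<^sup>2 * (fst z)\<^sup>2) + 2 * (S\<^sup>2 * (snd z)\<^sup>2)"
      by (simp add: algebra_simps)
    finally show "?g (fst z - snd z) \<le> 2 * ?g (fst z) + 2 * ?g (snd z)"
      by (rule min1) auto
  qed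
  also have "\<dots> = 2 * (\<integral>z. ?g (fst z) \<partial>PP) + 2 * (\<integral>z. ?g (snd z) \<partial>PP)"
    by (subst Bochner_Integration.integral_add) (auto intro!: integrable_mult_right integrable_bdd[of _ 1])
  also have "\<dots> = 4 * (\<integral>x. ?g x \<partial>\<mu>)"
    using integral_fst_PP[of ?g] by simp
  finally show ?thesis .
qed

private lemma H2_le:
  assumes "0 < s" "s \<le> 2 * S"
  shows "H 2 s \<le> 4 * (\<integral>x. min 1 (S\<^sup>2 * x\<^sup>2) \<partial>\<mu>)"
proof -
  have "H 2 s \<le> (\<integral>z. min 1 (S\<^sup>2 * (fst z - snd z)\<^sup>2) \<partial>PP)"
    unfolding H_def
  proof (rule integral_mono)
    fix z :: "real \<times> real"
    have "\<bar>sin (s * (fst z - snd z) / 2)\<bar> \<le> \<bar>s * (fst z - snd z) / 2\<bar>"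
      by (rule abs_sin_x_le_abs_x)
    also have "\<dots> = s / 2 * \<bar>fst z - snd z\<bar>" using assms by (simp add: abs_mult)
    also have "\<dots> \<le> S * \<bar>fst z - snd z\<bar>" using assms by (intro mult_right_mono) auto
    finally have "\<bar>sin (s * (fst z - snd z) / 2)\<bar>\<^sup>2 \<le> (S * \<bar>fst z - snd z\<bar>)\<^sup>2"
      by (intro power_mono) auto
    then show "(sin (s * (fst z - snd z) / 2))\<^sup>2 \<le> min 1 (S\<^sup>2 * (fst z - snd z)\<^sup>2)"
      by (simp add: power_mult_distrib sin_power_bounds)
  qed (auto intro!: integrable_bdd[of _ 1] simp: sin_power_bounds)
  also note symmetrized_second_moment_le
  finally show ?thesis .
qed

text \<open>Weak symmetrization: one coordinate beyond 2 t and an independent one within t differ by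
  at least t, and the latter event has probability at least 1/2.\<close>

private lemma symmetrization_tail:
  assumes "1 / 2 \<le> measure \<mu> {x. \<bar>x\<bar> \<le> t}"
  shows "measure \<mu> {x. 2 * t < \<bar>x\<bar>} \<le> 2 * measure PP {z \<in> space PP. t \<le> \<bar>fst z - snd z\<bar>}"
proof -
  let ?A = "{x. 2 * t < \<bar>x\<bar>}" and ?B = "{x. \<bar>x\<bar> \<le> t}" and ?C = "{z \<in> space PP. t \<le> \<bar>fst z - snd z\<bar>}"
  have C: "?C \<in> sets PP" by measurable
  have [measurable]: "?A \<in> sets borel" "?B \<in> sets borel" by measurable
  have "measure \<mu> ?A * (1 / 2) \<le> measure \<mu> ?A * measure \<mu> ?B"
    using assms by (intro mult_left_mono) auto
  also have "\<dots> = (\<integral>z. indicator ?A (fst z) * indicator ?B (snd z) \<partial>PP)"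
    by (subst integral_PP_mult) auto
  also have "\<dots> \<le> (\<integral>z. indicator ?C z \<partial>PP)"
  proof (rule integral_mono)
    show "integrable PP (\<lambda>z. indicator ?A (fst z) * indicator ?B (snd z) :: real)"
      by (rule integrable_bdd[of _ 1]) (auto simp: indicator_def)
    show "integrable PP (\<lambda>z. indicator ?C z :: real)"
      using C by (intro integrable_bdd[of _ 1] borel_measurable_indicator) (auto simp: indicator_def)
    show "indicator ?A (fst z) * indicator ?B (snd z) \<le> (indicator ?C z :: real)" if "z \<in> space PP" for z
      using that by (auto simp: indicator_def)
  qed
  also have "\<dots> = measure PP ?C" using C by simp
  finally show ?thesis by simp
qed

lemma tail_le_truncated_second_moment:
  assumes dbl: "((\<lambda>s. (1 - (\<psi> (2 * s))\<^sup>2) / (1 - (\<psi> s)\<^sup>2)) \<longlongrightarrow> 4) (at_right 0)"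
    and "0 < \<epsilon>"
  shows "\<forall>\<^sub>F t in at_top. measure \<mu> {x. t < \<bar>x\<bar>} \<le> \<epsilon> * (\<integral>x. min 1 (x\<^sup>2 / t\<^sup>2) \<partial>\<mu>)"
proof -
  \<comment> \<open>The accumulated constant is 2 (128 / 3) 64 = 16384 / 3 < 6000: a factor 2 from
    symmetrization, 4 (32 / 3) from averaging and the second moment bound, 64 from S = 8 /
    t.\<close>
  define \<delta> where "\<delta> = min (1 / 2) (\<epsilon> / 6000)"
  have \<delta>: "0 < \<delta>" "\<delta> < 1" "\<delta> \<le> \<epsilon> / 6000" using assms by (auto simp: \<delta>_def)
  have "\<forall>\<^sub>F s in at_right 0. 4 - 4 * \<delta> < (1 - (\<psi> (2 * s))\<^sup>2) / (1 - (\<psi> s)\<^sup>2)"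
    by (rule order_tendstoD[OF dbl]) (use \<delta> in auto)
  then obtain s0 where s0: "0 < s0"
    and rat: "\<And>s. 0 < s \<Longrightarrow> s < s0 \<Longrightarrow> 4 - 4 * \<delta> < (1 - (\<psi> (2 * s))\<^sup>2) / (1 - (\<psi> s)\<^sup>2)"
    by (auto simp: eventually_at_right_field)
  have H4: "H 4 s \<le> \<delta> * H 2 s" if "0 < s" "s < s0" for s
  proof -
    have "0 \<le> 1 - (\<psi> s)\<^sup>2" using cmod_char_le_1[of s] by (simp add: power_le_one)
    \<comment> \<open>A zero denominator would make the quotient 0 by convention, which is below
      \<open>4 - 4 * \<delta>\<close>.\<close>
    moreover have "1 - (\<psi> s)\<^sup>2 \<noteq> 0" using rat[OF that] \<delta> by auto
    ultimately have "0 < 1 - (\<psi> s)\<^sup>2" by simp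
    then have "(4 - 4 * \<delta>) * (1 - (\<psi> s)\<^sup>2) \<le> 1 - (\<psi> (2 * s))\<^sup>2"
      using rat[OF that] by (simp add: pos_less_divide_eq less_imp_le)
    then show ?thesis unfolding H4_eq H2_eq by (simp add: field_simps)
  qed
  have "\<forall>\<^sub>F t in at_top. 3 / 4 < cdf \<mu> t"
    by (rule order_tendstoD[OF cdf_lim_at_top_prob]) simp
  then obtain T where T: "\<And>t. T \<le> t \<Longrightarrow> 3 / 4 < cdf \<mu> t"
    by (auto simp: eventually_at_top_linorder)
  have "\<forall>\<^sub>F t in at_bot. cdf \<mu> t < 1 / 4" by (rule order_tendstoD[OF cdf_lim_at_bot]) simp
  then obtain B where B: "\<And>t. t \<le> B \<Longrightarrow> cdf \<mu> t < 1 / 4"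
    by (auto simp: eventually_at_bot_linorder)
  show ?thesis
    using eventually_ge_at_top[of "2 * T"] eventually_gt_at_top[of "16 / s0"] eventually_gt_at_top[of "2 * (\<bar>B\<bar> + 1)"] eventually_gt_at_top[of 0]
  proof eventually_elim
    case (elim t)
    \<comment> \<open>Then 4 / S = t / 2, the level for the symmetrized variable from which the tail
      of the original one at t is recovered.\<close>
    define S where "S = 8 / t"
    have S: "0 < S" "2 * S < s0" "4 / S = t / 2"
      using elim s0 by (auto simp: S_def field_simps)
    \<comment> \<open>Since -t / 2 < B, the interval from B to t / 2 lies in |x| \<le> t / 2 and
      carries mass at least 3/4 - 1/4.\<close>
    have "measure \<mu> {x. \<bar>x\<bar> \<le> t / 2} \<ge> measure \<mu> ({..t / 2} - {.. B})"
      using elim by (intro finite_measure_mono) auto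
    also have "measure \<mu> ({..t / 2} - {.. B}) = measure \<mu> {..t / 2} - measure \<mu> {.. B}"
      using elim by (intro finite_measure_Diff) auto
    finally have half: "1 / 2 \<le> measure \<mu> {x. \<bar>x\<bar> \<le> t / 2}"
      using T[of "t / 2"] elim(1) B[of B] by (simp add: cdf_def)
    let ?E = "\<integral>x. min 1 (S\<^sup>2 * x\<^sup>2) \<partial>\<mu>"
    have "3 / 32 * measure PP {z \<in> space PP. 4 / S \<le> \<bar>fst z - snd z\<bar>} \<le> \<delta> * (4 * ?E)"
    proof (rule tail_le_average_H4[OF S(1)])
      fix s assume s: "S \<le> s" "s \<le> 2 * S"
      have "H 4 s \<le> \<delta> * H 2 s" using s S by (intro H4) auto
      also have "\<dots> \<le> \<delta> * (4 * ?E)" using s S \<delta> by (intro mult_left_mono H2_le) auto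
      finally show "H 4 s \<le> \<delta> * (4 * ?E)" .
    qed
    then have PPt: "measure PP {z \<in> space PP. t / 2 \<le> \<bar>fst z - snd z\<bar>} \<le> 128 / 3 * \<delta> * ?E"
      unfolding S(3) by simp
    have E64: "?E \<le> 64 * (\<integral>x. min 1 (x\<^sup>2 / t\<^sup>2) \<partial>\<mu>)"
    proof -
      have "?E \<le> (\<integral>x. 64 * min 1 (x\<^sup>2 / t\<^sup>2) \<partial>\<mu>)"
      proof (rule integral_mono)
        show "integrable \<mu> (\<lambda>x. min 1 (S\<^sup>2 * x\<^sup>2))"
          by (rule integrable_const_bound[of _ 1]) auto
        show "integrable \<mu> (\<lambda>x. 64 * min 1 (x\<^sup>2 / t\<^sup>2))"
          by (intro integrable_mult_right integrable_const_bound[of _ 1]) auto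
        fix x :: real
        have "S\<^sup>2 * x\<^sup>2 = 64 * (x\<^sup>2 / t\<^sup>2)" by (simp add: S_def power_divide)
        moreover have "0 \<le> x\<^sup>2 / t\<^sup>2" by simp
        ultimately show "min 1 (S\<^sup>2 * x\<^sup>2) \<le> 64 * min 1 (x\<^sup>2 / t\<^sup>2)"
          by linarith
      qed
      then show ?thesis by simp
    qed
    have Epos: "0 \<le> (\<integral>x. min 1 (x\<^sup>2 / t\<^sup>2) \<partial>\<mu>)" by (intro Bochner_Integration.integral_nonneg) auto
    have "measure \<mu> {x. t < \<bar>x\<bar>} \<le> 2 * (128 / 3 * \<delta> * ?E)"
      using symmetrization_tail[OF half] PPt by simp
    also have "\<dots> \<le> 2 * (128 / 3 * \<delta> * (64 * (\<integral>x. min 1 (x\<^sup>2 / t\<^sup>2) \<partial>\<mu>)))"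
      using E64 \<delta> by (intro mult_left_mono) auto
    also have "\<dots> = 16384 / 3 * \<delta> * (\<integral>x. min 1 (x\<^sup>2 / t\<^sup>2) \<partial>\<mu>)" by simp
    also have "\<dots> \<le> \<epsilon> * (\<integral>x. min 1 (x\<^sup>2 / t\<^sup>2) \<partial>\<mu>)"
      using \<delta> assms Epos by (intro mult_right_mono) auto
    finally show ?case .
  qed
qed

end

section \<open>The classical tail condition\<close>

text \<open>The expectation of min (1, x^2 / t^2) is the tail at t plus l(t) / t^2, so the bound
  obtained above has the tail on both sides. With a factor \<eta> \<le> 1/2 the tail on the right is
  absorbed on the left.\<close>

lemma normal_attraction_tail_real:
  fixes \<mu> :: "real measure"
  assumes \<mu>: "real_distribution \<mu>" and a: "\<And>n. 0 < a n"
    and conv: "weak_conv_m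
         (\<lambda>n. distr (\<Pi>\<^sub>M i\<in>(UNIV :: nat set). \<mu>) borel (\<lambda>\<omega>. ((\<Sum>i<n. \<omega> i) - c n) / a n))
         std_normal_distribution"
    and "0 < \<epsilon>"
  shows "\<forall>\<^sub>F t in at_top. 0 < (\<integral>x. x\<^sup>2 * indicator {x. \<bar>x\<bar> \<le> t} x \<partial>\<mu>)
      \<and> t\<^sup>2 * measure \<mu> {x. t < \<bar>x\<bar>} \<le> \<epsilon> * (\<integral>x. x\<^sup>2 * indicator {x. \<bar>x\<bar> \<le> t} x \<partial>\<mu>)"
proof -
  interpret real_distribution \<mu> by fact
  define l where "l t = (\<integral>x. x\<^sup>2 * indicator {x. \<bar>x\<bar> \<le> t} x \<partial>\<mu>)" for t
  have int: "integrable \<mu> (\<lambda>x. x\<^sup>2 * indicator {x. \<bar>x\<bar> \<le> t} x)" for t :: real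
  proof (rule integrable_const_bound[of _ "t\<^sup>2"])
    show "AE x in \<mu>. norm (x\<^sup>2 * indicator {x. \<bar>x\<bar> \<le> t} x) \<le> t\<^sup>2"
      by (rule AE_I2) (auto simp: indicator_def abs_le_square_iff[symmetric])
  qed simp
  have l0: "0 \<le> l t" for t unfolding l_def by (intro Bochner_Integration.integral_nonneg) auto
  have lmono: "l s \<le> l t" if "s \<le> t" for s t
    unfolding l_def by (intro integral_mono int) (use that in \<open>auto simp: indicator_def\<close>)
  have bound: "\<forall>\<^sub>F t in at_top. t\<^sup>2 * measure \<mu> {x. t < \<bar>x\<bar>} \<le> \<delta> * l t" if \<delta>: "0 < \<delta>" for \<delta>
  proof -
    define \<eta> where "\<eta> = min (1 / 2) (\<delta> / 2)"
    have \<eta>: "0 < \<eta>" "\<eta> \<le> 1 / 2" "2 * \<eta> \<le> \<delta>" using \<delta> by (auto simp: \<eta>_def)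
    show ?thesis
      using tail_le_truncated_second_moment[OF \<mu> char_defect_doubling[OF \<mu> a conv] \<eta>(1)] eventually_gt_at_top[of 0]
    proof eventually_elim
      case (elim t)
      let ?p = "measure \<mu> {x. t < \<bar>x\<bar>}"
      have "(\<integral>x. min 1 (x\<^sup>2 / t\<^sup>2) \<partial>\<mu>) = (\<integral>x. indicator {x. t < \<bar>x\<bar>} x + x\<^sup>2 * indicator {x. \<bar>x\<bar> \<le> t} x / t\<^sup>2 \<partial>\<mu>)"
      proof (rule Bochner_Integration.integral_cong[OF refl])
        fix x :: real
        show "min 1 (x\<^sup>2 / t\<^sup>2) = indicator {x. t < \<bar>x\<bar>} x + x\<^sup>2 * indicator {x. \<bar>x\<bar> \<le> t} x / t\<^sup>2"
        proof (cases "t < \<bar>x\<bar>")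
          case True
          then have "t\<^sup>2 \<le> x\<^sup>2" using elim abs_le_square_iff[of t x] by simp
          then show ?thesis using True elim by simp
        next
          case False
          then have "x\<^sup>2 \<le> t\<^sup>2" using elim abs_le_square_iff[of x t] by simp
          then show ?thesis using False elim by simp
        qed
      qed
      also have "\<dots> = ?p + l t / t\<^sup>2"
      proof -
        have "integrable \<mu> (\<lambda>x. indicator {x. t < \<bar>x\<bar>} x :: real)"
          by (rule integrable_const_bound[of _ 1]) (auto simp: indicator_def)
        then show ?thesis
          unfolding l_def by (subst Bochner_Integration.integral_add) (auto intro!: int integrable_divide_zero)
      qed
      finally have "?p \<le> \<eta> * (?p + l t / t\<^sup>2)" using elim by simp
      also have "\<dots> = \<eta> * ?p + \<eta> * (l t / t\<^sup>2)" by (simp add: algebra_simps)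
      also have "\<dots> \<le> 1 / 2 * ?p + \<eta> * (l t / t\<^sup>2)" using \<eta> l0[of t] by (intro add_mono mult_right_mono) auto
      finally have "?p \<le> 2 * \<eta> * (l t / t\<^sup>2)" by simp
      also have "\<dots> \<le> \<delta> * (l t / t\<^sup>2)" using \<eta> l0[of t] by (intro mult_right_mono) auto
      finally show ?case using elim by (simp add: field_simps)
    qed
  qed
  \<comment> \<open>If l vanished identically, the bound would make the tail vanish at some t > 0 as
    well. The law would be the point mass at 0, whose characteristic function has no defect.\<close>
  have "\<exists>t. 0 < l t"
  proof (rule ccontr)
    assume "\<nexists>t. 0 < l t"
    then have lz: "l t = 0" for t using l0[of t] by (metis less_eq_real_def)
    have "\<forall>\<^sub>F t in at_top. t\<^sup>2 * measure \<mu> {x. t < \<bar>x\<bar>} \<le> 1 * l t" by (rule bound) simp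
    then have "\<forall>\<^sub>F t in at_top. 0 < t \<and> t\<^sup>2 * measure \<mu> {x. t < \<bar>x\<bar>} \<le> 0"
      using eventually_gt_at_top[of 0] by eventually_elim (simp add: lz)
    then obtain t where t: "0 < t" "t\<^sup>2 * measure \<mu> {x. t < \<bar>x\<bar>} \<le> 0"
      by (metis (no_types, lifting) eventually_happens' trivial_limit_at_top_linorder)
    have "measure \<mu> {x. t < \<bar>x\<bar>} = 0"
      using t by (metis less_eq_real_def measure_nonneg mult_pos_pos not_less zero_less_power)
    then have "AE x in \<mu>. x \<notin> {x. t < \<bar>x\<bar>}"
      by (intro AE_not_in) (auto simp: null_sets_def emeasure_eq_measure)
    moreover have "AE x in \<mu>. x\<^sup>2 * indicator {x. \<bar>x\<bar> \<le> t} x = 0"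
      using lz[of t] unfolding l_def by (subst (asm) integral_nonneg_eq_0_iff_AE[OF int]) auto
    ultimately have "AE x in \<mu>. x = 0"
      by eventually_elim (auto simp: indicator_def split: if_splits)
    then have "char \<mu> s = (CLINT x|\<mu>. 1)" for s
      unfolding char_def by (intro integral_cong_AE) auto
    then have "char \<mu> s = 1" for s using prob_space by simp
    then show False using char_defect_pos[OF \<mu> a conv] by simp
  qed
  then obtain T where "0 < l T" by blast
  then have "\<forall>\<^sub>F t in at_top. 0 < l t"
    using lmono by (intro eventually_at_top_linorderI[of T]) (meson less_le_trans)
  then show ?thesis
    using bound[OF assms(4)] unfolding l_def by eventually_elim blast
qed

lemma normal_domain_of_attraction_tail:
  assumes "prob_space M" and X [measurable]: "X \<in> borel_measurable M"
    and "normal_domain_of_attraction M X" and "0 < \<epsilon>"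
  shows "\<forall>\<^sub>F t in at_top. 0 < trunc_moment M X 2 t
      \<and> t\<^sup>2 * measure M {\<omega> \<in> space M. t < \<bar>X \<omega>\<bar>} \<le> \<epsilon> * trunc_moment M X 2 t"
proof -
  interpret prob_space M by fact
  let ?\<mu> = "distr M borel X"
  obtain a c where a: "\<And>n. 0 < a n"
    and conv: "weak_conv_m
         (\<lambda>n. distr (\<Pi>\<^sub>M i\<in>(UNIV :: nat set). ?\<mu>) borel (\<lambda>\<omega>. ((\<Sum>i<n. \<omega> i) - c n) / a n))
         std_normal_distribution"
    using assms(3) unfolding normal_domain_of_attraction_def by blast
  have "real_distribution ?\<mu>" by (rule real_distribution_distr) simp
  from normal_attraction_tail_real[OF this a conv assms(4)] show ?thesis
  proof eventually_elim
    case (elim t)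
    have "(\<integral>x. x\<^sup>2 * indicator {x. \<bar>x\<bar> \<le> t} x \<partial>?\<mu>) = trunc_moment M X 2 t"
      unfolding trunc_moment_def by (subst integral_distr) (auto simp: indicator_def)
    moreover have "measure ?\<mu> {x. t < \<bar>x\<bar>} = measure M {\<omega> \<in> space M. t < \<bar>X \<omega>\<bar>}"
      by (subst measure_distr) (auto intro!: arg_cong[where f = "measure M"])
    ultimately show ?case using elim by simp
  qed
qed

section \<open>Truncated moments and the truncation scale\<close>

text \<open>\<open>tail_small\<close> is the classical analytic form of attraction to the normal
  law; the remaining argument draws on the limit law only through it.\<close>

locale normal_tail = prob_space M for M :: "'a measure" +
  fixes X :: "'a \<Rightarrow> real"
  assumes X [measurable]: "X \<in> borel_measurable M"
    and tail_small: "\<And>\<epsilon>. 0 < \<epsilon> \<Longrightarrow> \<forall>\<^sub>F t in at_top. 0 < trunc_moment M X 2 t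
      \<and> t\<^sup>2 * measure M {\<omega> \<in> space M. t < \<bar>X \<omega>\<bar>} \<le> \<epsilon> * trunc_moment M X 2 t"
    and integrable_X: "integrable M X"
    and mean_zero: "(\<integral>\<omega>. X \<omega> \<partial>M) = 0"
begin

abbreviation tail :: "real \<Rightarrow> real" where
  "tail t \<equiv> measure M {\<omega> \<in> space M. t < \<bar>X \<omega>\<bar>}"

abbreviation mom :: "nat \<Rightarrow> real \<Rightarrow> real" where
  "mom k t \<equiv> trunc_moment M X k t"

abbreviation b :: "nat \<Rightarrow> real" where
  "b n \<equiv> trunc_scale M X n"

definition abs_mom :: "nat \<Rightarrow> real \<Rightarrow> real" where
  "abs_mom k t = (\<integral>\<omega>. \<bar>X \<omega>\<bar> ^ k * indicator {\<omega>. \<bar>X \<omega>\<bar> \<le> t} \<omega> \<partial>M)"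

lemma trunc_measurable [measurable]:
  "(\<lambda>\<omega>. indicator {\<omega>. \<bar>X \<omega>\<bar> \<le> t} \<omega> :: real) \<in> borel_measurable M"
  "(\<lambda>\<omega>. indicator {\<omega>. t < \<bar>X \<omega>\<bar>} \<omega> :: real) \<in> borel_measurable M"
proof -
  have "(\<lambda>\<omega>. indicator {x. \<bar>x\<bar> \<le> t} (X \<omega>) :: real) \<in> borel_measurable M"
    "(\<lambda>\<omega>. indicator {x. t < \<bar>x\<bar>} (X \<omega>) :: real) \<in> borel_measurable M" by measurable
  then show "(\<lambda>\<omega>. indicator {\<omega>. \<bar>X \<omega>\<bar> \<le> t} \<omega> :: real) \<in> borel_measurable M"
    "(\<lambda>\<omega>. indicator {\<omega>. t < \<bar>X \<omega>\<bar>} \<omega> :: real) \<in> borel_measurable M"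
    by (simp_all add: indicator_def)
qed

lemma integrable_trunc:
  "integrable M (\<lambda>\<omega>. X \<omega> ^ k * indicator {\<omega>. \<bar>X \<omega>\<bar> \<le> t} \<omega>)"
  "integrable M (\<lambda>\<omega>. \<bar>X \<omega>\<bar> ^ k * indicator {\<omega>. \<bar>X \<omega>\<bar> \<le> t} \<omega>)"
  by (rule integrable_const_bound[of _ "\<bar>t\<bar> ^ k"],
      auto simp: indicator_def abs_mult power_abs intro!: power_mono)+

lemma integrable_tail: "integrable M (\<lambda>\<omega>. indicator {\<omega>. t < \<bar>X \<omega>\<bar>} \<omega> :: real)"
  by (rule integrable_const_bound[of _ 1]) (auto simp: indicator_def)

lemma integral_tail: "(\<integral>\<omega>. indicator {\<omega>. t < \<bar>X \<omega>\<bar>} \<omega> \<partial>M) = tail t"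
proof -
  have "(\<integral>\<omega>. indicator {\<omega>. t < \<bar>X \<omega>\<bar>} \<omega> \<partial>M) = (\<integral>\<omega>. indicator {\<omega> \<in> space M. t < \<bar>X \<omega>\<bar>} \<omega> \<partial>M)"
    by (intro Bochner_Integration.integral_cong) (auto simp: indicator_def)
  also have "\<dots> = tail t" by simp
  finally show ?thesis .
qed

lemma mom2_nonneg: "0 \<le> mom 2 t"
  unfolding trunc_moment_def by (intro Bochner_Integration.integral_nonneg) auto

lemma mom2_mono: "s \<le> t \<Longrightarrow> mom 2 s \<le> mom 2 t"
  unfolding trunc_moment_def by (intro integral_mono integrable_trunc) (auto simp: indicator_def)

lemma mom4_nonneg: "0 \<le> mom 4 t"
  unfolding trunc_moment_def by (intro Bochner_Integration.integral_nonneg) auto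

lemma mom2_le_mean_abs: "0 \<le> t \<Longrightarrow> mom 2 t \<le> t * (\<integral>\<omega>. \<bar>X \<omega>\<bar> \<partial>M)"
proof -
  assume "0 \<le> t"
  have "mom 2 t \<le> (\<integral>\<omega>. t * \<bar>X \<omega>\<bar> \<partial>M)"
    unfolding trunc_moment_def
  proof (intro integral_mono integrable_trunc integrable_mult_right integrable_abs integrable_X)
    fix \<omega>
    have "(X \<omega>)\<^sup>2 \<le> t * \<bar>X \<omega>\<bar>" if "\<bar>X \<omega>\<bar> \<le> t"
      using mult_right_mono[OF that, of "\<bar>X \<omega>\<bar>"] by (simp add: power2_eq_square)
    then show "X \<omega> ^ 2 * indicator {\<omega>. \<bar>X \<omega>\<bar> \<le> t} \<omega> \<le> t * \<bar>X \<omega>\<bar>"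
      using \<open>0 \<le> t\<close> by (auto simp: indicator_def)
  qed
  then show ?thesis by simp
qed

text \<open>The truncation |X| \<le> t is closed, so its indicator is right-continuous in t. This
  serves to evaluate the moment at the supremum \<open>b n\<close> itself.\<close>

lemma mom2_right_continuous: "(\<lambda>k. mom 2 (t + 1 / real (Suc k))) \<longlonglongrightarrow> mom 2 t"
  unfolding trunc_moment_def
proof (rule integral_dominated_convergence[where w = "\<lambda>\<omega>. X \<omega> ^ 2 * indicator {\<omega>. \<bar>X \<omega>\<bar> \<le> t + 1} \<omega>"])
  show "AE \<omega> in M. (\<lambda>k. X \<omega> ^ 2 * indicator {\<omega>. \<bar>X \<omega>\<bar> \<le> t + 1 / real (Suc k)} \<omega>) \<longlonglongrightarrow> X \<omega> ^ 2 * indicator {\<omega>. \<bar>X \<omega>\<bar> \<le> t} \<omega>"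
  proof (rule AE_I2)
    fix \<omega>
    have "\<forall>\<^sub>F k in sequentially. (\<bar>X \<omega>\<bar> \<le> t + 1 / real (Suc k)) = (\<bar>X \<omega>\<bar> \<le> t)"
    proof (cases "\<bar>X \<omega>\<bar> \<le> t")
      case True
      then have "\<bar>X \<omega>\<bar> \<le> t + 1 / real (Suc k)" for k by (rule order_trans) simp
      then show ?thesis using True by simp
    next
      case False
      have "(\<lambda>k. t + 1 / real (Suc k)) \<longlonglongrightarrow> t + 0"
        by (intro tendsto_intros LIMSEQ_Suc lim_1_over_n)
      then have "\<forall>\<^sub>F k in sequentially. t + 1 / real (Suc k) < \<bar>X \<omega>\<bar>"
        using False by (intro order_tendstoD) auto
      then show ?thesis using False by (auto elim!: eventually_mono)
    qed
    then have "\<forall>\<^sub>F k in sequentially. X \<omega> ^ 2 * indicator {\<omega>. \<bar>X \<omega>\<bar> \<le> t} \<omega> = X \<omega> ^ 2 * (indicator {\<omega>. \<bar>X \<omega>\<bar> \<le> t + 1 / real (Suc k)} \<omega> :: real)"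
      by (rule eventually_mono) (auto simp: indicator_def)
    then show "(\<lambda>k. X \<omega> ^ 2 * indicator {\<omega>. \<bar>X \<omega>\<bar> \<le> t + 1 / real (Suc k)} \<omega>) \<longlonglongrightarrow> X \<omega> ^ 2 * (indicator {\<omega>. \<bar>X \<omega>\<bar> \<le> t} \<omega> :: real)"
      by (rule Lim_transform_eventually[OF tendsto_const])
  qed
  show "AE \<omega> in M. norm (X \<omega> ^ 2 * indicator {\<omega>. \<bar>X \<omega>\<bar> \<le> t + 1 / real (Suc k)} \<omega>) \<le> X \<omega> ^ 2 * indicator {\<omega>. \<bar>X \<omega>\<bar> \<le> t + 1} \<omega>" for k
  proof (rule AE_I2)
    fix \<omega>
    have "\<bar>X \<omega>\<bar> \<le> t + 1" if "\<bar>X \<omega>\<bar> \<le> t + 1 / real (Suc k)"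
    proof -
      have "1 / real (Suc k) \<le> 1" by simp
      then show ?thesis using that by linarith
    qed
    then show "norm (X \<omega> ^ 2 * indicator {\<omega>. \<bar>X \<omega>\<bar> \<le> t + 1 / real (Suc k)} \<omega>) \<le> X \<omega> ^ 2 * indicator {\<omega>. \<bar>X \<omega>\<bar> \<le> t + 1} \<omega>"
      by (auto simp: indicator_def simp del: of_nat_Suc)
  qed
qed (use integrable_trunc in auto)

lemma mom2_double: "0 \<le> t \<Longrightarrow> mom 2 (2 * t) \<le> mom 2 t + 4 * t\<^sup>2 * tail t"
proof -
  assume t: "0 \<le> t"
  have "mom 2 (2 * t) \<le> (\<integral>\<omega>. X \<omega> ^ 2 * indicator {\<omega>. \<bar>X \<omega>\<bar> \<le> t} \<omega> + 4 * t\<^sup>2 * indicator {\<omega>. t < \<bar>X \<omega>\<bar>} \<omega> \<partial>M)"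
    unfolding trunc_moment_def
  proof (intro integral_mono integrable_trunc Bochner_Integration.integrable_add integrable_mult_right integrable_tail)
    fix \<omega>
    have "(X \<omega>)\<^sup>2 \<le> 4 * t\<^sup>2" if "\<bar>X \<omega>\<bar> \<le> 2 * t"
      using power_mono[OF that abs_ge_zero, of 2] by (simp add: power_mult_distrib)
    then show "X \<omega> ^ 2 * indicator {\<omega>. \<bar>X \<omega>\<bar> \<le> 2 * t} \<omega> \<le> X \<omega> ^ 2 * indicator {\<omega>. \<bar>X \<omega>\<bar> \<le> t} \<omega> + 4 * t\<^sup>2 * indicator {\<omega>. t < \<bar>X \<omega>\<bar>} \<omega>"
      by (auto simp: indicator_def)
  qed
  also have "\<dots> = mom 2 t + 4 * t\<^sup>2 * tail t"
    unfolding trunc_moment_def integral_tail[symmetric]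
    by (subst Bochner_Integration.integral_add) (auto intro!: integrable_trunc integrable_tail)
  finally show ?thesis .
qed

lemma mom_abs_le: "\<bar>mom k t\<bar> \<le> abs_mom k t"
  unfolding trunc_moment_def abs_mom_def
  by (rule order_trans[OF integral_abs_bound]) (simp add: abs_mult power_abs)

text \<open>Split the range at \<eta> t: below it the cube is at most \<eta> t X^2; above it the
  cube is at most t^3 on an event whose probability the tail condition at \<eta> t controls.\<close>

lemma abs_mom3_small:
  assumes "0 < \<epsilon>"
  shows "\<forall>\<^sub>F t in at_top. abs_mom 3 t \<le> \<epsilon> * (t * mom 2 t)"
proof -
  define \<eta> where "\<eta> = min 1 (\<epsilon> / 2)"
  have \<eta>: "0 < \<eta>" "\<eta> \<le> 1" "2 * \<eta> \<le> \<epsilon>" using assms by (auto simp: \<eta>_def)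
  \<comment> \<open>The third power: passing from level \<eta> t to level t costs two factors of
    \<eta>, and one has to remain.\<close>
  have "\<forall>\<^sub>F t in at_top. 0 < mom 2 t \<and> t\<^sup>2 * tail t \<le> \<eta> ^ 3 * mom 2 t"
    using \<eta> by (intro tail_small) simp
  then obtain T where T: "\<And>t. T \<le> t \<Longrightarrow> t\<^sup>2 * tail t \<le> \<eta> ^ 3 * mom 2 t"
    by (auto simp: eventually_at_top_linorder)
  show ?thesis
    using eventually_ge_at_top[of "T / \<eta>"] eventually_gt_at_top[of 0]
  proof eventually_elim
    case (elim t)
    have "T \<le> \<eta> * t" using elim \<eta> by (simp add: field_simps)
    then have "(\<eta> * t)\<^sup>2 * tail (\<eta> * t) \<le> \<eta> ^ 3 * mom 2 (\<eta> * t)" by (rule T)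
    also have "\<dots> \<le> \<eta> ^ 3 * mom 2 t"
      using \<eta> elim mult_right_mono[of \<eta> 1 t] by (intro mult_left_mono mom2_mono) auto
    finally have "\<eta>\<^sup>2 * (t\<^sup>2 * tail (\<eta> * t)) \<le> \<eta>\<^sup>2 * (\<eta> * mom 2 t)"
      by (simp add: power_mult_distrib power2_eq_square power3_eq_cube mult_ac)
    then have tl: "t\<^sup>2 * tail (\<eta> * t) \<le> \<eta> * mom 2 t" using \<eta> by simp
    have "abs_mom 3 t \<le> (\<integral>\<omega>. \<eta> * t * (X \<omega> ^ 2 * indicator {\<omega>. \<bar>X \<omega>\<bar> \<le> t} \<omega>) + t ^ 3 * indicator {\<omega>. \<eta> * t < \<bar>X \<omega>\<bar>} \<omega> \<partial>M)"
      unfolding abs_mom_def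
    proof (intro integral_mono integrable_trunc Bochner_Integration.integrable_add integrable_mult_right integrable_tail)
      fix \<omega>
      show "\<bar>X \<omega>\<bar> ^ 3 * indicator {\<omega>. \<bar>X \<omega>\<bar> \<le> t} \<omega> \<le> \<eta> * t * (X \<omega> ^ 2 * indicator {\<omega>. \<bar>X \<omega>\<bar> \<le> t} \<omega>) + t ^ 3 * indicator {\<omega>. \<eta> * t < \<bar>X \<omega>\<bar>} \<omega>"
      proof (cases "\<bar>X \<omega>\<bar> \<le> t")
        case True
        have nn: "0 \<le> \<eta> * t * (X \<omega>)\<^sup>2" using \<eta> elim by simp
        show ?thesis
        proof (cases "\<eta> * t < \<bar>X \<omega>\<bar>")
          case tr: True
          have "\<bar>X \<omega>\<bar> ^ 3 \<le> t ^ 3" using True by (intro power_mono) auto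
          from add_mono[OF nn this] show ?thesis using True tr by simp
        next
          case False
          have "\<bar>X \<omega>\<bar> * \<bar>X \<omega>\<bar>\<^sup>2 \<le> \<eta> * t * \<bar>X \<omega>\<bar>\<^sup>2" using False by (intro mult_right_mono) auto
          then show ?thesis using True False by (simp add: power3_eq_cube power2_eq_square mult.assoc)
        qed
      qed (use elim in \<open>auto simp: indicator_def\<close>)
    qed
    also have "\<dots> = \<eta> * t * mom 2 t + t ^ 3 * tail (\<eta> * t)"
      unfolding trunc_moment_def integral_tail[symmetric]
      by (subst Bochner_Integration.integral_add) (auto intro!: integrable_trunc integrable_tail)
    also have "t ^ 3 * tail (\<eta> * t) = t * (t\<^sup>2 * tail (\<eta> * t))"
      by (simp add: power3_eq_cube power2_eq_square)
    also have "\<eta> * t * mom 2 t + \<dots> \<le> \<eta> * t * mom 2 t + t * (\<eta> * mom 2 t)"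
      using tl elim by (intro add_left_mono mult_left_mono) auto
    also have "\<dots> = 2 * \<eta> * (t * mom 2 t)" by simp
    also have "\<dots> \<le> \<epsilon> * (t * mom 2 t)"
      using \<eta> elim mom2_nonneg[of t] by (intro mult_right_mono) auto
    finally show ?case .
  qed
qed

lemma mom4_le: "0 \<le> t \<Longrightarrow> mom 4 t \<le> t * abs_mom 3 t"
proof -
  assume t: "0 \<le> t"
  have "mom 4 t \<le> (\<integral>\<omega>. t * (\<bar>X \<omega>\<bar> ^ 3 * indicator {\<omega>. \<bar>X \<omega>\<bar> \<le> t} \<omega>) \<partial>M)"
    unfolding trunc_moment_def
  proof (intro integral_mono integrable_trunc integrable_mult_right)
    fix \<omega>
    have "\<bar>X \<omega>\<bar> * \<bar>X \<omega>\<bar> ^ 3 \<le> t * \<bar>X \<omega>\<bar> ^ 3" if "\<bar>X \<omega>\<bar> \<le> t"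
      using that by (intro mult_right_mono) auto
    moreover have "X \<omega> ^ 4 = \<bar>X \<omega>\<bar> * \<bar>X \<omega>\<bar> ^ 3" by (simp flip: power_Suc)
    ultimately show "X \<omega> ^ 4 * indicator {\<omega>. \<bar>X \<omega>\<bar> \<le> t} \<omega> \<le> t * (\<bar>X \<omega>\<bar> ^ 3 * indicator {\<omega>. \<bar>X \<omega>\<bar> \<le> t} \<omega>)"
      by (auto simp: indicator_def)
  qed
  then show ?thesis by (simp add: abs_mom_def)
qed

lemma integrable_X_tail: "integrable M (\<lambda>\<omega>. \<bar>X \<omega>\<bar> * indicator {\<omega>. t < \<bar>X \<omega>\<bar>} \<omega>)"
  by (rule Bochner_Integration.integrable_bound[OF integrable_X]) (auto simp: indicator_def)

text \<open>The pieces \<open>t < |X| \<le> 2\<^sup>K t\<close> satisfy a recursion that contracts, because doubling \<open>t\<close> multiplies the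
  truncated second moment by at most \<open>3/2\<close>.\<close>

lemma first_moment_tail:
  assumes "0 < \<epsilon>"
  shows "\<forall>\<^sub>F t in at_top. t * (\<integral>\<omega>. \<bar>X \<omega>\<bar> * indicator {\<omega>. t < \<bar>X \<omega>\<bar>} \<omega> \<partial>M) \<le> \<epsilon> * mom 2 t"
proof -
  define \<eta> where "\<eta> = min (1 / 8) (\<epsilon> / 8)"
  have \<eta>: "0 < \<eta>" "\<eta> \<le> 1 / 8" "8 * \<eta> \<le> \<epsilon>" using assms by (auto simp: \<eta>_def)
  obtain T where T: "\<And>t. T \<le> t \<Longrightarrow> t\<^sup>2 * tail t \<le> \<eta> * mom 2 t"
    using tail_small[OF \<eta>(1)] by (auto simp: eventually_at_top_linorder)
  define u where "u K t = (\<integral>\<omega>. \<bar>X \<omega>\<bar> * indicator {\<omega>. t < \<bar>X \<omega>\<bar> \<and> \<bar>X \<omega>\<bar> \<le> 2 ^ K * t} \<omega> \<partial>M)" for K t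
  have [measurable]: "(\<lambda>\<omega>. indicator {\<omega>. t < \<bar>X \<omega>\<bar> \<and> \<bar>X \<omega>\<bar> \<le> s} \<omega> :: real) \<in> borel_measurable M" for s t
  proof -
    have "(\<lambda>\<omega>. indicator {\<omega>. t < \<bar>X \<omega>\<bar>} \<omega> * indicator {\<omega>. \<bar>X \<omega>\<bar> \<le> s} \<omega> :: real) \<in> borel_measurable M" by measurable
    then show ?thesis by (simp add: indicator_def if_distrib cong: if_cong)
  qed
  have int_u: "integrable M (\<lambda>\<omega>. \<bar>X \<omega>\<bar> * indicator {\<omega>. t < \<bar>X \<omega>\<bar> \<and> \<bar>X \<omega>\<bar> \<le> s} \<omega>)" for s t
    by (rule Bochner_Integration.integrable_bound[OF integrable_X]) (auto simp: indicator_def)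
  \<comment> \<open>The constant 8 is the fixed point of the recursion, 2 + (8 / 2) (3 / 2) = 8, and
    \<eta> \<le> 1/8 is what bounds the doubling factor by 1 + 4/8 = 3/2.\<close>
  have uK: "t * u K t \<le> 8 * \<eta> * mom 2 t" if "T \<le> t" "0 < t" for K t
    using that
  proof (induction K arbitrary: t)
    case 0
    have "{\<omega>. t < \<bar>X \<omega>\<bar> \<and> \<bar>X \<omega>\<bar> \<le> 2 ^ 0 * t} = {}" by auto
    then have "u 0 t = 0" unfolding u_def by simp
    then show ?case using \<eta> mom2_nonneg[of t] by simp
  next
    case (Suc K)
    have "u (Suc K) t \<le> (\<integral>\<omega>. 2 * t * indicator {\<omega>. t < \<bar>X \<omega>\<bar>} \<omega> + \<bar>X \<omega>\<bar> * indicator {\<omega>. 2 * t < \<bar>X \<omega>\<bar> \<and> \<bar>X \<omega>\<bar> \<le> 2 ^ K * (2 * t)} \<omega> \<partial>M)"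
      unfolding u_def
      by (intro integral_mono Bochner_Integration.integrable_add integrable_mult_right int_u integrable_tail)
         (use Suc.prems in \<open>auto simp: indicator_def\<close>)
    also have "\<dots> = 2 * t * tail t + u K (2 * t)"
      unfolding u_def integral_tail[symmetric]
      by (subst Bochner_Integration.integral_add) (auto intro!: int_u integrable_tail)
    finally have "t * u (Suc K) t \<le> t * (2 * t * tail t + u K (2 * t))"
      using Suc.prems by (intro mult_left_mono) auto
    also have "\<dots> = 2 * (t\<^sup>2 * tail t) + (2 * t * u K (2 * t)) / 2"
      by (simp add: algebra_simps power2_eq_square)
    also have "\<dots> \<le> 2 * (\<eta> * mom 2 t) + (8 * \<eta> * mom 2 (2 * t)) / 2"
      using T[of t] Suc.IH[of "2 * t"] Suc.prems by (intro add_mono mult_left_mono divide_right_mono) auto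
    also have "mom 2 (2 * t) \<le> 3 / 2 * mom 2 t"
    proof -
      have "mom 2 (2 * t) \<le> mom 2 t + 4 * (t\<^sup>2 * tail t)" using mom2_double[of t] Suc.prems by simp
      also have "\<dots> \<le> mom 2 t + 4 * (\<eta> * mom 2 t)" using T[of t] Suc.prems by simp
      also have "\<eta> * mom 2 t \<le> 1 / 8 * mom 2 t" using \<eta> mom2_nonneg by (intro mult_right_mono) auto
      finally show ?thesis by simp
    qed
    then have "2 * (\<eta> * mom 2 t) + (8 * \<eta> * mom 2 (2 * t)) / 2 \<le> 2 * (\<eta> * mom 2 t) + (8 * \<eta> * (3 / 2 * mom 2 t)) / 2"
      using \<eta> by (intro add_left_mono divide_right_mono mult_left_mono) auto
    finally show ?case by simp
  qed
  show ?thesis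
    using eventually_ge_at_top[of T] eventually_gt_at_top[of 0]
  proof eventually_elim
    case (elim t)
    \<comment> \<open>The bound on \<open>u K t\<close> is free of \<open>K\<close>, so it passes to
      the full tail moment by dominated convergence with majorant |X|.\<close>
    have "(\<lambda>K. u K t) \<longlonglongrightarrow> (\<integral>\<omega>. \<bar>X \<omega>\<bar> * indicator {\<omega>. t < \<bar>X \<omega>\<bar>} \<omega> \<partial>M)"
      unfolding u_def
    proof (rule integral_dominated_convergence[where w = "\<lambda>\<omega>. \<bar>X \<omega>\<bar>"])
      show "AE \<omega> in M. (\<lambda>K. \<bar>X \<omega>\<bar> * indicator {\<omega>. t < \<bar>X \<omega>\<bar> \<and> \<bar>X \<omega>\<bar> \<le> 2 ^ K * t} \<omega>) \<longlonglongrightarrow> \<bar>X \<omega>\<bar> * indicator {\<omega>. t < \<bar>X \<omega>\<bar>} \<omega>"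
      proof (rule AE_I2)
        fix \<omega>
        obtain K0 where "\<bar>X \<omega>\<bar> / t < 2 ^ K0" using real_arch_pow[of 2 "\<bar>X \<omega>\<bar> / t"] by auto
        moreover have "(2::real) ^ K0 \<le> 2 ^ K" if "K0 \<le> K" for K
          using that by simp
        ultimately have "\<bar>X \<omega>\<bar> / t \<le> 2 ^ K" if "K0 \<le> K" for K
          using that by (meson less_imp_le order_trans)
        then have "\<forall>\<^sub>F K in sequentially. \<bar>X \<omega>\<bar> / t \<le> 2 ^ K"
          by (rule eventually_sequentiallyI)
        then have "\<forall>\<^sub>F K in sequentially. \<bar>X \<omega>\<bar> * indicator {\<omega>. t < \<bar>X \<omega>\<bar>} \<omega> = \<bar>X \<omega>\<bar> * (indicator {\<omega>. t < \<bar>X \<omega>\<bar> \<and> \<bar>X \<omega>\<bar> \<le> 2 ^ K * t} \<omega> :: real)"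
          by eventually_elim (use elim in \<open>auto simp: indicator_def field_simps\<close>)
        then show "(\<lambda>K. \<bar>X \<omega>\<bar> * indicator {\<omega>. t < \<bar>X \<omega>\<bar> \<and> \<bar>X \<omega>\<bar> \<le> 2 ^ K * t} \<omega>) \<longlonglongrightarrow> \<bar>X \<omega>\<bar> * (indicator {\<omega>. t < \<bar>X \<omega>\<bar>} \<omega> :: real)"
          by (rule Lim_transform_eventually[OF tendsto_const])
      qed
    qed (auto simp: indicator_def intro!: integrable_abs integrable_X)
    then have "(\<lambda>K. t * u K t) \<longlonglongrightarrow> t * (\<integral>\<omega>. \<bar>X \<omega>\<bar> * indicator {\<omega>. t < \<bar>X \<omega>\<bar>} \<omega> \<partial>M)"
      by (intro tendsto_mult tendsto_const)
    then have "t * (\<integral>\<omega>. \<bar>X \<omega>\<bar> * indicator {\<omega>. t < \<bar>X \<omega>\<bar>} \<omega> \<partial>M) \<le> 8 * \<eta> * mom 2 t"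
      by (rule LIMSEQ_le_const2) (use uK[OF elim] in blast)
    also have "\<dots> \<le> \<epsilon> * mom 2 t" using \<eta> mom2_nonneg by (intro mult_right_mono) auto
    finally show ?case .
  qed
qed

text \<open>Since X has mean zero, its truncated mean is minus the mean over the complementary
  event.\<close>

lemma mom1_le: "\<bar>mom 1 t\<bar> \<le> (\<integral>\<omega>. \<bar>X \<omega>\<bar> * indicator {\<omega>. t < \<bar>X \<omega>\<bar>} \<omega> \<partial>M)"
proof -
  have "mom 1 t = (\<integral>\<omega>. X \<omega> - X \<omega> * indicator {\<omega>. t < \<bar>X \<omega>\<bar>} \<omega> \<partial>M)"
    unfolding trunc_moment_def by (intro Bochner_Integration.integral_cong) (auto simp: indicator_def)
  also have "\<dots> = - (\<integral>\<omega>. X \<omega> * indicator {\<omega>. t < \<bar>X \<omega>\<bar>} \<omega> \<partial>M)"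
    by (subst Bochner_Integration.integral_diff)
       (auto intro!: integrable_X Bochner_Integration.integrable_bound[OF integrable_X] simp: mean_zero indicator_def)
  finally have "\<bar>mom 1 t\<bar> \<le> (\<integral>\<omega>. \<bar>X \<omega> * indicator {\<omega>. t < \<bar>X \<omega>\<bar>} \<omega>\<bar> \<partial>M)"
    using integral_abs_bound[of M "\<lambda>\<omega>. X \<omega> * indicator {\<omega>. t < \<bar>X \<omega>\<bar>} \<omega>"] by simp
  then show ?thesis by (simp add: abs_mult)
qed

text \<open>This bound is what makes the supremum defining \<open>trunc_scale\<close> meaningful.\<close>

lemma scale_set_bounded: "x > 0 \<and> real n / x ^ 2 * mom 2 x \<ge> 1 \<Longrightarrow> x \<le> real n * (\<integral>\<omega>. \<bar>X \<omega>\<bar> \<partial>M)"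
proof -
  assume x: "x > 0 \<and> real n / x ^ 2 * mom 2 x \<ge> 1"
  then have "x ^ 2 \<le> real n * mom 2 x" by (auto simp: le_divide_eq split: if_splits)
  also have "\<dots> \<le> real n * (x * (\<integral>\<omega>. \<bar>X \<omega>\<bar> \<partial>M))"
    using x by (intro mult_left_mono mom2_le_mean_abs) auto
  finally have "x * x \<le> x * (real n * (\<integral>\<omega>. \<bar>X \<omega>\<bar> \<partial>M))" by (simp add: power2_eq_square mult_ac)
  then show ?thesis using x by simp
qed

lemma scale_ge:
  assumes "x > 0" "real n / x ^ 2 * mom 2 x \<ge> 1"
  shows "x \<le> b n"
  unfolding trunc_scale_def using assms
  by (intro cSup_upper bdd_aboveI[of _ "real n * (\<integral>\<omega>. \<bar>X \<omega>\<bar> \<partial>M)"] scale_set_bounded) auto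

text \<open>A fixed t with positive truncated second moment enters the set defining
  \<open>b n\<close> as soon as n is at least \<open>t\<^sup>2 / mom 2 t\<close>.\<close>

lemma scale_at_top: "filterlim b at_top sequentially"
  unfolding filterlim_at_top
proof
  fix Z :: real
  have "\<forall>\<^sub>F t in at_top. 0 < mom 2 t \<and> 0 < t \<and> Z \<le> t"
    using tail_small[OF zero_less_one] eventually_gt_at_top[of 0] eventually_ge_at_top[of Z] by eventually_elim auto
  then obtain t where t: "0 < mom 2 t" "0 < t" "Z \<le> t"
    by (metis (no_types, lifting) eventually_happens' trivial_limit_at_top_linorder)
  have "\<forall>\<^sub>F n in sequentially. t\<^sup>2 / mom 2 t \<le> real n"
    using filterlim_real_sequentially unfolding filterlim_at_top by blast
  then show "\<forall>\<^sub>F n in sequentially. Z \<le> b n"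
  proof eventually_elim
    case (elim n)
    have "real n / t ^ 2 * mom 2 t \<ge> 1" using elim t by (simp add: field_simps)
    then show ?case using scale_ge[of t n] t by simp
  qed
qed

lemma scale_pos: "\<forall>\<^sub>F n in sequentially. 0 < b n"
  using scale_at_top unfolding filterlim_at_top_dense by blast

lemma scale_equation:
  assumes "0 < b n" and ne: "\<exists>x>0. real n / x ^ 2 * mom 2 x \<ge> 1"
  shows "real n * mom 2 (b n) = (b n)\<^sup>2"
proof (rule antisym)
  show "real n * mom 2 (b n) \<le> (b n)\<^sup>2"
  proof (rule LIMSEQ_le)
    show "(\<lambda>k. real n * mom 2 (b n + 1 / real (Suc k))) \<longlonglongrightarrow> real n * mom 2 (b n)"
      by (intro tendsto_intros mom2_right_continuous)
    have "(\<lambda>k. (b n + 1 / real (Suc k))\<^sup>2) \<longlonglongrightarrow> (b n + 0)\<^sup>2"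
      by (intro tendsto_intros LIMSEQ_Suc lim_1_over_n)
    then show "(\<lambda>k. (b n + 1 / real (Suc k))\<^sup>2) \<longlonglongrightarrow> (b n)\<^sup>2" by simp
    have "real n * mom 2 (b n + 1 / real (Suc k)) \<le> (b n + 1 / real (Suc k))\<^sup>2" for k
    proof (rule ccontr)
      let ?x = "b n + 1 / real (Suc k)"
      have xp: "0 < ?x" using assms(1) by (simp add: add_pos_pos)
      assume "\<not> real n * mom 2 ?x \<le> ?x\<^sup>2"
      then have "real n / ?x ^ 2 * mom 2 ?x \<ge> 1" using xp by (simp add: le_divide_eq)
      then have "?x \<le> b n" using xp by (intro scale_ge)
      then show False by (simp add: field_simps)
    qed
    then show "\<exists>N. \<forall>k\<ge>N. real n * mom 2 (b n + 1 / real (Suc k)) \<le> (b n + 1 / real (Suc k))\<^sup>2" by blast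
  qed
  show "(b n)\<^sup>2 \<le> real n * mom 2 (b n)"
  proof (rule ccontr)
    assume "\<not> ?thesis"
    then have "sqrt (real n * mom 2 (b n)) < b n"
      using assms(1) by (intro real_less_lsqrt) (auto simp: mom2_nonneg)
    then obtain x where x: "x > 0 \<and> real n / x ^ 2 * mom 2 x \<ge> 1" "sqrt (real n * mom 2 (b n)) < x"
      unfolding trunc_scale_def using ne by (auto elim!: less_cSupE)
    have "x\<^sup>2 \<le> real n * mom 2 x" using x(1) by (auto simp: le_divide_eq split: if_splits)
    also have "\<dots> \<le> real n * mom 2 (b n)" using x(1) by (intro mult_left_mono mom2_mono scale_ge) auto
    finally have "x \<le> sqrt (real n * mom 2 (b n))" by (rule real_le_rsqrt)
    then show False using x(2) by simp
  qed
qed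

lemma scale_equation_eventually: "\<forall>\<^sub>F n in sequentially. real n * mom 2 (b n) = (b n)\<^sup>2 \<and> 0 < mom 2 (b n) \<and> 0 < b n"
proof -
  have "\<forall>\<^sub>F t in at_top. 0 < mom 2 t \<and> 0 < t"
    using tail_small[OF zero_less_one] eventually_gt_at_top[of 0] by eventually_elim auto
  then obtain t where t: "0 < mom 2 t" "0 < t"
    by (metis (no_types, lifting) eventually_happens' trivial_limit_at_top_linorder)
  have "\<forall>\<^sub>F n in sequentially. t\<^sup>2 / mom 2 t \<le> real n"
    using filterlim_real_sequentially unfolding filterlim_at_top by blast
  moreover have "\<forall>\<^sub>F n in sequentially. t \<le> b n"
    using scale_at_top unfolding filterlim_at_top by blast
  ultimately show ?thesis
  proof eventually_elim
    case (elim n)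
    have "real n / t ^ 2 * mom 2 t \<ge> 1" using elim t by (simp add: field_simps)
    then have "real n * mom 2 (b n) = (b n)\<^sup>2"
      using t elim by (intro scale_equation) auto
    moreover have "mom 2 t \<le> mom 2 (b n)" using elim by (intro mom2_mono)
    ultimately show ?case using t elim by auto
  qed
qed

end

section \<open>The order of the leading term\<close>

lemma asymp_same_orderI:
  assumes "0 < c" and ev: "\<forall>\<^sub>F n in sequentially. 0 < d n \<and> c * d n \<le> a n \<and> a n \<le> K * d n"
  shows "asymp_same_order a d"
proof -
  have lo: "\<forall>\<^sub>F n in sequentially. ereal c \<le> ereal (a n / d n)"
    using ev by eventually_elim (simp add: pos_le_divide_eq)
  have up: "\<forall>\<^sub>F n in sequentially. ereal (a n / d n) \<le> ereal K"
    using ev by eventually_elim (simp add: pos_divide_le_eq)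
  have "0 < ereal c" using assms(1) by simp
  also have "ereal c \<le> liminf (\<lambda>n. ereal (a n / d n))" by (rule Liminf_bounded[OF lo])
  finally have "0 < liminf (\<lambda>n. ereal (a n / d n))" .
  moreover have "limsup (\<lambda>n. ereal (a n / d n)) < \<infinity>"
    using Limsup_bounded[OF up] by (rule le_less_trans) simp
  moreover have "liminf (\<lambda>n. ereal (a n / d n)) \<le> limsup (\<lambda>n. ereal (a n / d n))"
    by (rule Liminf_le_Limsup) simp
  ultimately show ?thesis unfolding asymp_same_order_def by blast
qed

context normal_tail
begin

text \<open>Substituting n = t^2 / \<open>mom 2 t\<close> at t = \<open>b n\<close> turns the four
  summands into ratios to the truncated second moment, each of which is small as t grows.\<close>

lemma rate_le_eventually:
  assumes "0 < \<epsilon>"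
  shows "\<forall>\<^sub>F n in sequentially. rate M X n \<le> \<epsilon>"
proof -
  have sum4: "w + x + y + z \<le> \<epsilon>" if "w \<le> \<epsilon> / 4" "x \<le> \<epsilon> / 4" "y \<le> \<epsilon> / 4" "z \<le> \<epsilon> / 4" for w x y z :: real
    using that by linarith
  have e4: "0 < \<epsilon> / 4" using assms by simp
  have "\<forall>\<^sub>F t in at_top. t\<^sup>2 * tail t \<le> \<epsilon> / 4 * mom 2 t \<and> t * \<bar>mom 1 t\<bar> \<le> \<epsilon> / 4 * mom 2 t
      \<and> \<bar>mom 3 t\<bar> \<le> \<epsilon> / 4 * (t * mom 2 t) \<and> mom 4 t \<le> \<epsilon> / 4 * (t\<^sup>2 * mom 2 t)"
    using tail_small[OF e4] first_moment_tail[OF e4] abs_mom3_small[OF e4] eventually_gt_at_top[of 0]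
  proof eventually_elim
    case (elim t)
    have "t * \<bar>mom 1 t\<bar> \<le> t * (\<integral>\<omega>. \<bar>X \<omega>\<bar> * indicator {\<omega>. t < \<bar>X \<omega>\<bar>} \<omega> \<partial>M)"
      using elim by (intro mult_left_mono mom1_le) auto
    then have "t * \<bar>mom 1 t\<bar> \<le> \<epsilon> / 4 * mom 2 t" using elim(2) by (rule order_trans)
    moreover have "\<bar>mom 3 t\<bar> \<le> \<epsilon> / 4 * (t * mom 2 t)"
      using mom_abs_le elim(3) by (rule order_trans)
    moreover have "mom 4 t \<le> t * (\<epsilon> / 4 * (t * mom 2 t))"
      using elim by (intro order_trans[OF mom4_le] mult_left_mono) auto
    then have "mom 4 t \<le> \<epsilon> / 4 * (t\<^sup>2 * mom 2 t)" by (simp add: power2_eq_square mult_ac)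
    ultimately show ?case using elim(1) by blast
  qed
  from eventually_compose_filterlim[OF this scale_at_top] scale_equation_eventually
  show ?thesis
  proof eventually_elim
    case (elim n)
    define t where "t = b n"
    have t: "0 < t" "0 < mom 2 t" "real n = t\<^sup>2 / mom 2 t" using elim by (auto simp: t_def field_simps)
    have "real n * tail t \<le> \<epsilon> / 4" "real n / t * \<bar>mom 1 t\<bar> \<le> \<epsilon> / 4"
      "real n / t ^ 3 * \<bar>mom 3 t\<bar> \<le> \<epsilon> / 4" "real n / t ^ 4 * mom 4 t \<le> \<epsilon> / 4"
      using elim(1) t(1,2) unfolding t(3) t_def[symmetric]
      by (simp_all add: field_simps power2_eq_square power3_eq_cube power4_eq_xxxx)
    then show ?case unfolding rate_def t_def[symmetric] by (rule sum4)
  qed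
qed

lemma rate_nonneg: "0 < b n \<Longrightarrow> 0 \<le> rate M X n"
  unfolding rate_def using mom4_nonneg[of "b n"] by (intro add_nonneg_nonneg mult_nonneg_nonneg divide_nonneg_nonneg) auto

lemma rate_tendsto_zero: "rate M X \<longlonglongrightarrow> 0"
proof (rule order_tendstoI)
  fix a :: real assume "a < 0"
  show "\<forall>\<^sub>F n in sequentially. a < rate M X n"
    using scale_pos by eventually_elim (use rate_nonneg \<open>a < 0\<close> in force)
next
  fix a :: real assume "0 < a"
  then have "\<forall>\<^sub>F n in sequentially. rate M X n \<le> a / 2" by (intro rate_le_eventually) simp
  then show "\<forall>\<^sub>F n in sequentially. rate M X n < a"
    by eventually_elim (use \<open>0 < a\<close> in simp)
qed

text \<open>If the truncated fourth moment vanished, X would be 0 almost surely on the truncation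
  event and the truncated second moment would vanish too. Positivity legitimizes the quotients in
  \<open>asymp_same_order\<close>.\<close>

lemma rate_pos: "\<forall>\<^sub>F n in sequentially. 0 < rate M X n"
  using scale_equation_eventually
proof eventually_elim
  case (elim n)
  have "mom 4 (b n) \<noteq> 0"
  proof
    assume "mom 4 (b n) = 0"
    then have "AE \<omega> in M. X \<omega> ^ 4 * indicator {\<omega>. \<bar>X \<omega>\<bar> \<le> b n} \<omega> = 0"
      unfolding trunc_moment_def by (subst (asm) integral_nonneg_eq_0_iff_AE[OF integrable_trunc(1)]) auto
    then have "AE \<omega> in M. X \<omega> ^ 2 * indicator {\<omega>. \<bar>X \<omega>\<bar> \<le> b n} \<omega> = 0"
      by eventually_elim auto
    then have "mom 2 (b n) = (\<integral>\<omega>. 0 \<partial>M)"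
      unfolding trunc_moment_def by (intro integral_cong_AE) auto
    then show False using elim by simp
  qed
  then have "0 < mom 4 (b n)" using mom4_nonneg[of "b n"] by simp
  moreover have "0 < real n" using elim by (cases n) auto
  ultimately have "0 < real n / b n ^ 4 * mom 4 (b n)" using elim by simp
  moreover have "0 \<le> real n * tail (b n) + real n / b n * \<bar>mom 1 (b n)\<bar> + real n / b n ^ 3 * \<bar>mom 3 (b n)\<bar>"
    using elim by (intro add_nonneg_nonneg mult_nonneg_nonneg divide_nonneg_nonneg) auto
  ultimately show ?case unfolding rate_def by (rule add_nonneg_pos[rotated])
qed

section \<open>Expansion of the leading term\<close>

abbreviation shifted :: "nat \<Rightarrow> real \<Rightarrow> 'a \<Rightarrow> real" where
  "shifted n x \<omega> \<equiv> std_normal_cdf (x * sqrt (1 + (X \<omega> / b n)\<^sup>2) - X \<omega> / b n) - std_normal_cdf x"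

lemma integrable_shifted: "integrable M (shifted n x)"
proof (rule integrable_const_bound[of _ 1])
  show "AE \<omega> in M. norm (shifted n x \<omega>) \<le> 1"
  proof (rule AE_I2)
    fix \<omega>
    show "norm (shifted n x \<omega>) \<le> 1"
      using std_normal_cdf_bounds[of x] std_normal_cdf_bounds[of "x * sqrt (1 + (X \<omega> / b n)\<^sup>2) - X \<omega> / b n"]
      by (simp add: abs_le_iff)
  qed
qed simp

abbreviation linear_part :: "nat \<Rightarrow> real \<Rightarrow> real" where
  "linear_part n x \<equiv> - (real n / b n * mom 1 (b n)) + (2 * x\<^sup>2 + 1) * (real n / b n ^ 3 * mom 3 (b n)) / 6"

text \<open>For \<open>b n > 0\<close> this is n E min ((X / b_n)^4, 1), the quantity that both
  bounds the Taylor remainder and is bounded by the difference at x and -x.\<close>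

abbreviation quartic_part :: "nat \<Rightarrow> real" where
  "quartic_part n \<equiv> real n / b n ^ 4 * mom 4 (b n) + real n * tail (b n)"

lemma quartic_part_eq:
  assumes "0 < b n"
  shows "quartic_part n = real n * (\<integral>\<omega>. (X \<omega> / b n) ^ 4 * indicator {\<omega>. \<bar>X \<omega>\<bar> \<le> b n} \<omega> + indicator {\<omega>. b n < \<bar>X \<omega>\<bar>} \<omega> \<partial>M)"
proof -
  have "(\<integral>\<omega>. (X \<omega> / b n) ^ 4 * indicator {\<omega>. \<bar>X \<omega>\<bar> \<le> b n} \<omega> + indicator {\<omega>. b n < \<bar>X \<omega>\<bar>} \<omega> \<partial>M)
      = (\<integral>\<omega>. X \<omega> ^ 4 * indicator {\<omega>. \<bar>X \<omega>\<bar> \<le> b n} \<omega> / b n ^ 4 + indicator {\<omega>. b n < \<bar>X \<omega>\<bar>} \<omega> \<partial>M)"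
    by (simp add: power_divide)
  also have "\<dots> = mom 4 (b n) / b n ^ 4 + tail (b n)"
    unfolding trunc_moment_def integral_tail[symmetric]
    by (subst Bochner_Integration.integral_add) (auto intro!: integrable_trunc integrable_tail integrable_divide_zero)
  finally show ?thesis by (simp add: algebra_simps)
qed

lemma integrable_quartic:
  "integrable M (\<lambda>\<omega>. (X \<omega> / b n) ^ 4 * indicator {\<omega>. \<bar>X \<omega>\<bar> \<le> b n} \<omega> + indicator {\<omega>. b n < \<bar>X \<omega>\<bar>} \<omega>)"
proof -
  have "integrable M (\<lambda>\<omega>. X \<omega> ^ 4 * indicator {\<omega>. \<bar>X \<omega>\<bar> \<le> b n} \<omega> / b n ^ 4 + indicator {\<omega>. b n < \<bar>X \<omega>\<bar>} \<omega>)"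
    by (intro Bochner_Integration.integrable_add integrable_divide_zero integrable_trunc integrable_tail)
  then show ?thesis by (simp add: power_divide)
qed

text \<open>On |X| \<le> b_n the uniform expansion applies. Outside, the polynomial is cut off and
  the integrand is at most 1, a cost charged to the tail; the maximum of 1 and the Taylor constant
  covers both.\<close>

lemma leading_term_expansion:
  "\<exists>C\<ge>0. \<forall>n x. 0 < b n \<longrightarrow> \<bar>leading_term M X n x - std_normal_density x * linear_part n x\<bar> \<le> C * quartic_part n"
proof -
  obtain C0 where C0: "\<And>x u. \<bar>u\<bar> \<le> 1 \<Longrightarrow>
    \<bar>std_normal_cdf (x * sqrt (1 + u\<^sup>2) - u) - std_normal_cdf x
      - std_normal_density x * (- u + (2 * x\<^sup>2 + 1) * u ^ 3 / 6)\<bar> \<le> C0 * u ^ 4"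
    using cdf_uniform_expansion by blast
  define C where "C = max 1 C0"
  have "\<bar>leading_term M X n x - std_normal_density x * linear_part n x\<bar> \<le> C * quartic_part n" if bn: "0 < b n" for n x
  proof -
    let ?\<phi> = "std_normal_density x"
    let ?I = "\<lambda>\<omega>. indicator {\<omega>. \<bar>X \<omega>\<bar> \<le> b n} \<omega> :: real"
    let ?J = "\<lambda>\<omega>. indicator {\<omega>. b n < \<bar>X \<omega>\<bar>} \<omega> :: real"
    let ?L = "\<lambda>\<omega>. ?\<phi> * (- (X \<omega> ^ 1 * ?I \<omega> / b n) + (2 * x\<^sup>2 + 1) * (X \<omega> ^ 3 * ?I \<omega> / b n ^ 3) / 6)"
    have intL: "integrable M ?L"
      by (intro integrable_mult_right Bochner_Integration.integrable_add Bochner_Integration.integrable_minus integrable_divide_zero integrable_trunc)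
    have E: "(\<integral>\<omega>. ?L \<omega> \<partial>M) = ?\<phi> * (- (mom 1 (b n) / b n) + (2 * x\<^sup>2 + 1) * (mom 3 (b n) / b n ^ 3) / 6)"
    proof -
      have "integrable M (\<lambda>\<omega>. - (X \<omega> ^ 1 * ?I \<omega> / b n))" "integrable M (\<lambda>\<omega>. (2 * x\<^sup>2 + 1) * (X \<omega> ^ 3 * ?I \<omega> / b n ^ 3) / 6)"
        by (intro integrable_mult_right Bochner_Integration.integrable_minus integrable_divide_zero integrable_trunc)+
      then show ?thesis unfolding trunc_moment_def
        by (subst integral_mult_right_zero, subst Bochner_Integration.integral_add) simp_all
    qed
    have "leading_term M X n x - ?\<phi> * linear_part n x = real n * (\<integral>\<omega>. shifted n x \<omega> - ?L \<omega> \<partial>M)"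
      unfolding leading_term_def Bochner_Integration.integral_diff[OF integrable_shifted intL] E
      by (simp add: algebra_simps)
    then have "\<bar>leading_term M X n x - ?\<phi> * linear_part n x\<bar> \<le> real n * (\<integral>\<omega>. \<bar>shifted n x \<omega> - ?L \<omega>\<bar> \<partial>M)"
      by (simp add: abs_mult mult_left_mono)
    also have "(\<integral>\<omega>. \<bar>shifted n x \<omega> - ?L \<omega>\<bar> \<partial>M) \<le> (\<integral>\<omega>. C * ((X \<omega> / b n) ^ 4 * ?I \<omega> + ?J \<omega>) \<partial>M)"
    proof (rule integral_mono)
      show "integrable M (\<lambda>\<omega>. \<bar>shifted n x \<omega> - ?L \<omega>\<bar>)"
        by (intro integrable_abs Bochner_Integration.integrable_diff integrable_shifted intL)
      show "integrable M (\<lambda>\<omega>. C * ((X \<omega> / b n) ^ 4 * ?I \<omega> + ?J \<omega>))"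
        by (intro integrable_mult_right integrable_quartic)
      fix \<omega>
      show "\<bar>shifted n x \<omega> - ?L \<omega>\<bar> \<le> C * ((X \<omega> / b n) ^ 4 * ?I \<omega> + ?J \<omega>)"
      proof (cases "\<bar>X \<omega>\<bar> \<le> b n")
        case True
        define u where "u = X \<omega> / b n"
        have "\<bar>u\<bar> \<le> 1" using True bn by (simp add: u_def)
        from C0[OF this, of x] have "\<bar>shifted n x \<omega> - ?\<phi> * (- u + (2 * x\<^sup>2 + 1) * u ^ 3 / 6)\<bar> \<le> C0 * u ^ 4"
          by (simp add: u_def)
        also have "\<dots> \<le> C * u ^ 4" by (intro mult_right_mono) (auto simp: C_def)
        finally show ?thesis using True by (simp add: u_def power_divide)
      next
        case False
        have "\<bar>shifted n x \<omega>\<bar> \<le> 1"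
          using std_normal_cdf_bounds[of x] std_normal_cdf_bounds[of "x * sqrt (1 + (X \<omega> / b n)\<^sup>2) - X \<omega> / b n"]
          by (simp add: abs_le_iff)
        also have "1 \<le> C" by (simp add: C_def)
        finally show ?thesis using False by simp
      qed
    qed
    then have "real n * (\<integral>\<omega>. \<bar>shifted n x \<omega> - ?L \<omega>\<bar> \<partial>M) \<le> real n * (C * (\<integral>\<omega>. (X \<omega> / b n) ^ 4 * ?I \<omega> + ?J \<omega> \<partial>M))"
      by (intro mult_left_mono) auto
    also have "\<dots> = C * quartic_part n" unfolding quartic_part_eq[OF bn] by simp
    finally show ?thesis .
  qed
  then show ?thesis by (intro exI[of _ C]) (auto simp: C_def)
qed

lemma leading_term_diff_ge:
  assumes "x > sqrt 3"
  shows "\<exists>c>0. \<forall>n. 0 < b n \<longrightarrow> c * quartic_part n \<le> leading_term M X n x - leading_term M X n (- x)"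
proof -
  obtain c where c: "0 < c" and low: "\<And>u. c * min (u ^ 4) 1 \<le>
     std_normal_cdf (x * sqrt (1 + u\<^sup>2) + u) + std_normal_cdf (x * sqrt (1 + u\<^sup>2) - u)
      - 2 * std_normal_cdf x"
    using cdf_even_part_lower_bound[OF assms] by blast
  have "c * quartic_part n \<le> leading_term M X n x - leading_term M X n (- x)" if bn: "0 < b n" for n
  proof -
    let ?Q = "\<lambda>\<omega>. (X \<omega> / b n) ^ 4 * indicator {\<omega>. \<bar>X \<omega>\<bar> \<le> b n} \<omega> + indicator {\<omega>. b n < \<bar>X \<omega>\<bar>} \<omega> :: real"
    have "(\<integral>\<omega>. c * ?Q \<omega> \<partial>M) \<le> (\<integral>\<omega>. shifted n x \<omega> - shifted n (- x) \<omega> \<partial>M)"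
    proof (rule integral_mono)
      show "integrable M (\<lambda>\<omega>. c * ?Q \<omega>)"
        by (intro integrable_mult_right integrable_quartic)
      show "integrable M (\<lambda>\<omega>. shifted n x \<omega> - shifted n (- x) \<omega>)"
        by (rule Bochner_Integration.integrable_diff[OF integrable_shifted integrable_shifted])
      fix \<omega>
      define u where "u = X \<omega> / b n"
      have "?Q \<omega> = min (u ^ 4) 1"
      proof (cases "\<bar>X \<omega>\<bar> \<le> b n")
        case True
        then have "\<bar>u\<bar> \<le> 1" using bn by (simp add: u_def)
        then have "\<bar>u\<bar> ^ 4 \<le> 1" by (intro power_le_one) auto
        then have "u ^ 4 \<le> 1" by simp
        then show ?thesis using True by (simp add: u_def[symmetric])
      next
        case False
        then have "1 \<le> \<bar>u\<bar>" using bn by (simp add: u_def)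
        then have "1 \<le> \<bar>u\<bar> ^ 4" by (rule one_le_power)
        then have "1 \<le> u ^ 4" by simp
        then show ?thesis using False by (simp add: u_def[symmetric])
      qed
      moreover have "shifted n x \<omega> - shifted n (- x) \<omega>
          = std_normal_cdf (x * sqrt (1 + u\<^sup>2) + u) + std_normal_cdf (x * sqrt (1 + u\<^sup>2) - u) - 2 * std_normal_cdf x"
        using std_normal_cdf_minus[of "x * sqrt (1 + u\<^sup>2) + u"] std_normal_cdf_minus[of x]
        by (simp add: u_def)
      ultimately show "c * ?Q \<omega> \<le> shifted n x \<omega> - shifted n (- x) \<omega>" using low[of u] by simp
    qed
    then have "real n * (c * (\<integral>\<omega>. ?Q \<omega> \<partial>M)) \<le> real n * (\<integral>\<omega>. shifted n x \<omega> - shifted n (- x) \<omega> \<partial>M)"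
      by (intro mult_left_mono) auto
    also have "\<dots> = leading_term M X n x - leading_term M X n (- x)"
      unfolding leading_term_def
      by (subst Bochner_Integration.integral_diff[OF integrable_shifted integrable_shifted]) (simp add: algebra_simps)
    finally show ?thesis unfolding quartic_part_eq[OF bn] by (simp add: mult_ac)
  qed
  then show ?thesis using c by blast
qed

section \<open>Two-sided bounds\<close>

text \<open>The pair of points x0, -x0 bounds the quartic part. With the remainder thus controlled,
  dividing by the densities bounds the linear parts at x0 and x1; subtracting them leaves (x0^2 -
  x1^2) / 3 times the normalized third moment, and the value at x0 then returns the first.\<close>

lemma rate_le_three_points:
  assumes x0: "x0 > sqrt 3" and x1: "x1 \<noteq> x0" "x1 \<noteq> - x0"
  shows "\<exists>K>0. \<forall>n. 0 < b n \<longrightarrow> (\<forall>s. (\<forall>x\<in>{- x0, x0, x1}. \<bar>leading_term M X n x\<bar> \<le> s) \<longrightarrow> rate M X n \<le> K * s)"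
proof -
  obtain C where C: "0 \<le> C" and exp: "\<And>n x. 0 < b n \<Longrightarrow> \<bar>leading_term M X n x - std_normal_density x * linear_part n x\<bar> \<le> C * quartic_part n"
    using leading_term_expansion by blast
  obtain c where c: "0 < c" and ev: "\<And>n. 0 < b n \<Longrightarrow> c * quartic_part n \<le> leading_term M X n x0 - leading_term M X n (- x0)"
    using leading_term_diff_ge[OF x0] by blast
  define d where "d = min (std_normal_density x0) (std_normal_density x1)"
  have d: "0 < d" by (auto simp: d_def normal_density_pos)
  define D where "D = (1 + C * (2 / c)) / d"
  have D: "0 \<le> D" using C c d by (simp add: D_def)
  define \<Delta> where "\<Delta> = \<bar>x0\<^sup>2 - x1\<^sup>2\<bar>"
  have \<Delta>: "0 < \<Delta>" using x1 by (auto simp: \<Delta>_def power2_eq_iff)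
  define K3 where "K3 = 6 * D / \<Delta>"
  define K where "K = 2 / c + (D + (2 * x0\<^sup>2 + 1) * K3) + K3 + 1"
  have K3: "0 \<le> K3" using D \<Delta> by (simp add: K3_def)
  have K: "0 < K" using c D K3 by (auto simp: K_def intro!: add_nonneg_pos)
  have "rate M X n \<le> K * s" if bn: "0 < b n" and s: "\<forall>x\<in>{- x0, x0, x1}. \<bar>leading_term M X n x\<bar> \<le> s" for n s
  proof -
    define m1 m3 q where "m1 = real n / b n * mom 1 (b n)" and "m3 = real n / b n ^ 3 * mom 3 (b n)"
      and "q = quartic_part n"
    have s0: "0 \<le> s" using s by force
    have "c * q \<le> 2 * s" using ev[OF bn] s by (auto simp: q_def abs_le_iff)
    then have q: "q \<le> 2 / c * s" using c by (simp add: field_simps)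
    have lin: "\<bar>- m1 + (2 * x\<^sup>2 + 1) * m3 / 6\<bar> \<le> D * s" if "x \<in> {x0, x1}" for x
    proof -
      have "\<bar>std_normal_density x * linear_part n x\<bar> \<le> s + C * q"
        using exp[OF bn, of x] s that unfolding q_def[symmetric] by auto
      also have "\<dots> \<le> s + C * (2 / c * s)" using q C by (intro add_left_mono mult_left_mono) auto
      also have "\<dots> = (1 + C * (2 / c)) * s" by (simp add: algebra_simps)
      finally have 1: "std_normal_density x * \<bar>linear_part n x\<bar> \<le> (1 + C * (2 / c)) * s"
        by (simp add: abs_mult)
      have "d * \<bar>linear_part n x\<bar> \<le> std_normal_density x * \<bar>linear_part n x\<bar>"
        using that by (intro mult_right_mono) (auto simp: d_def)
      with 1 have "d * \<bar>linear_part n x\<bar> \<le> (1 + C * (2 / c)) * s" by simp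
      then show ?thesis using d by (simp add: D_def m1_def m3_def field_simps)
    qed
    have diff: "(x0\<^sup>2 - x1\<^sup>2) * m3 / 3 = (- m1 + (2 * x0\<^sup>2 + 1) * m3 / 6) - (- m1 + (2 * x1\<^sup>2 + 1) * m3 / 6)"
      by (simp add: field_simps)
    have tri: "\<bar>y - z\<bar> \<le> 2 * (D * s)" if "\<bar>y\<bar> \<le> D * s" "\<bar>z\<bar> \<le> D * s" for y z
      using that by linarith
    have "\<bar>(x0\<^sup>2 - x1\<^sup>2) * m3 / 3\<bar> \<le> 2 * (D * s)"
      unfolding diff by (intro tri lin) auto
    then have "\<Delta> * \<bar>m3\<bar> \<le> 6 * D * s" by (simp add: abs_mult \<Delta>_def)
    then have m3: "\<bar>m3\<bar> \<le> K3 * s" using \<Delta> by (simp add: K3_def field_simps)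
    have "\<bar>m1\<bar> \<le> D * s + \<bar>(2 * x0\<^sup>2 + 1) * m3 / 6\<bar>" using lin[of x0] by simp
    also have "\<bar>(2 * x0\<^sup>2 + 1) * m3 / 6\<bar> = (2 * x0\<^sup>2 + 1) * \<bar>m3\<bar> / 6" by (simp add: abs_mult)
    also have "\<dots> \<le> (2 * x0\<^sup>2 + 1) * \<bar>m3\<bar>" by simp
    also have "\<dots> \<le> (2 * x0\<^sup>2 + 1) * (K3 * s)" using m3 by (intro mult_left_mono) auto
    finally have m1: "\<bar>m1\<bar> \<le> (D + (2 * x0\<^sup>2 + 1) * K3) * s" by (simp add: algebra_simps)
    have "rate M X n = q + \<bar>m1\<bar> + \<bar>m3\<bar>"
      using bn by (simp add: rate_def q_def m1_def m3_def abs_mult)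
    also have "\<dots> \<le> 2 / c * s + (D + (2 * x0\<^sup>2 + 1) * K3) * s + K3 * s"
      using q m1 m3 by (intro add_mono)
    also have "\<dots> = K * s - s" by (simp add: K_def algebra_simps)
    finally show ?thesis using s0 by simp
  qed
  then show ?thesis using K by blast
qed

text \<open>Uniform in x because the density stays bounded when multiplied by the coefficient 2 x^2
  + 1 of the third moment.\<close>

lemma leading_term_le_rate:
  "\<exists>K\<ge>0. \<forall>n x. 0 < b n \<longrightarrow> \<bar>leading_term M X n x\<bar> \<le> K * rate M X n"
proof -
  obtain C where C: "0 \<le> C" and exp: "\<And>n x. 0 < b n \<Longrightarrow> \<bar>leading_term M X n x - std_normal_density x * linear_part n x\<bar> \<le> C * quartic_part n"
    using leading_term_expansion by blast
  obtain P where P: "\<And>x. std_normal_density x * (\<bar>x\<bar> + 2)\<^sup>2 \<le> P"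
    using std_normal_density_mult_power_bounded[of 2] by blast
  have tri: "\<bar>y\<bar> \<le> p + q" if "\<bar>y - l\<bar> \<le> q" "\<bar>l\<bar> \<le> p" for y l p q :: real
    using that by linarith
  have P0: "0 \<le> P" by (rule order_trans[OF _ P[of 0]]) simp
  have "\<bar>leading_term M X n x\<bar> \<le> (2 * P + C) * rate M X n" if bn: "0 < b n" for n x
  proof -
    define m1 m3 where "m1 = real n / b n * mom 1 (b n)" and "m3 = real n / b n ^ 3 * mom 3 (b n)"
    have q0: "0 \<le> quartic_part n" using bn mom4_nonneg[of "b n"] by simp
    have r: "rate M X n = quartic_part n + \<bar>m1\<bar> + \<bar>m3\<bar>"
      using bn by (simp add: rate_def m1_def m3_def abs_mult)
    have "1 \<le> (\<bar>x\<bar> + 2)\<^sup>2" "2 * x\<^sup>2 + 1 \<le> 2 * (\<bar>x\<bar> + 2)\<^sup>2" by (auto simp: power2_sum)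
    then have p: "std_normal_density x \<le> P" "std_normal_density x * (2 * x\<^sup>2 + 1) \<le> 2 * P"
      using P[of x] mult_left_mono[of 1 "(\<bar>x\<bar> + 2)\<^sup>2" "std_normal_density x"]
        mult_left_mono[of "2 * x\<^sup>2 + 1" "2 * (\<bar>x\<bar> + 2)\<^sup>2" "std_normal_density x"] by auto
    have "\<bar>std_normal_density x * linear_part n x\<bar> = \<bar>- (std_normal_density x * m1) + std_normal_density x * (2 * x\<^sup>2 + 1) * m3 / 6\<bar>"
      by (simp add: m1_def m3_def algebra_simps)
    also have "\<dots> \<le> std_normal_density x * \<bar>m1\<bar> + std_normal_density x * (2 * x\<^sup>2 + 1) * \<bar>m3\<bar> / 6"
      by (rule order_trans[OF abs_triangle_ineq]) (simp add: abs_mult)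
    also have "\<dots> \<le> P * \<bar>m1\<bar> + 2 * P * \<bar>m3\<bar> / 6"
      using p by (intro add_mono mult_right_mono divide_right_mono) auto
    also have "\<dots> \<le> 2 * P * (\<bar>m1\<bar> + \<bar>m3\<bar>)"
      using mult_nonneg_nonneg[OF P0 abs_ge_zero[of m1]] mult_nonneg_nonneg[OF P0 abs_ge_zero[of m3]] by (simp add: algebra_simps)
    finally have "\<bar>leading_term M X n x\<bar> \<le> 2 * P * (\<bar>m1\<bar> + \<bar>m3\<bar>) + C * quartic_part n"
      by (rule tri[OF exp[OF bn]])
    also have "\<dots> \<le> (2 * P + C) * rate M X n"
    proof -
      define q where "q = quartic_part n"
      have "0 \<le> 2 * P * q + C * (\<bar>m1\<bar> + \<bar>m3\<bar>)"
        using P0 C q0 unfolding q_def[symmetric] by (intro add_nonneg_nonneg mult_nonneg_nonneg) auto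
      then show ?thesis unfolding r q_def[symmetric] by (simp add: algebra_simps)
    qed
    finally show ?thesis .
  qed
  then show ?thesis using P0 C by (intro exI[of _ "2 * P + C"]) auto
qed

text \<open>Stated for any superset of the three points so that both suprema are instances: the
  lower bound uses only those points, while the upper bound is uniform in x.\<close>

lemma same_order_three_points:
  assumes x0: "x0 > sqrt 3" and x1: "x1 \<noteq> x0" "x1 \<noteq> - x0" and A: "{- x0, x0, x1} \<subseteq> A"
  shows "asymp_same_order (\<lambda>n. SUP x\<in>A. \<bar>leading_term M X n x\<bar>) (rate M X)"
proof -
  obtain K where K: "0 < K" and lo: "\<And>n s. 0 < b n \<Longrightarrow> (\<forall>x\<in>{- x0, x0, x1}. \<bar>leading_term M X n x\<bar> \<le> s) \<Longrightarrow> rate M X n \<le> K * s"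
    using rate_le_three_points[OF x0 x1] by blast
  obtain K' where up: "\<And>n x. 0 < b n \<Longrightarrow> \<bar>leading_term M X n x\<bar> \<le> K' * rate M X n"
    using leading_term_le_rate by blast
  show ?thesis
  proof (rule asymp_same_orderI[of "1 / K" _ _ K'])
    show "0 < 1 / K" using K by simp
    show "\<forall>\<^sub>F n in sequentially. 0 < rate M X n \<and> 1 / K * rate M X n \<le> (SUP x\<in>A. \<bar>leading_term M X n x\<bar>)
        \<and> (SUP x\<in>A. \<bar>leading_term M X n x\<bar>) \<le> K' * rate M X n"
      using rate_pos scale_pos
    proof eventually_elim
      case (elim n)
      have bdd: "bdd_above ((\<lambda>x. \<bar>leading_term M X n x\<bar>) ` A)"
        using up[OF elim(2)] by (intro bdd_aboveI[of _ "K' * rate M X n"]) auto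
      have "rate M X n \<le> K * (SUP x\<in>A. \<bar>leading_term M X n x\<bar>)"
        using A by (intro lo[OF elim(2)] ballI cSUP_upper bdd) auto
      moreover have "(SUP x\<in>A. \<bar>leading_term M X n x\<bar>) \<le> K' * rate M X n"
        using A up[OF elim(2)] by (intro cSUP_least) auto
      ultimately show ?case using elim(1) K by (simp add: field_simps)
    qed
  qed
qed

end

section \<open>The limit under a finite third moment\<close>

context normal_tail
begin

lemma truncation_eventually:
  "\<forall>\<^sub>F n in sequentially. \<bar>X \<omega>\<bar> \<le> b n \<and> 0 < b n"
  using scale_at_top scale_pos unfolding filterlim_at_top by (auto intro: eventually_conj)

lemma mom_scale_tendsto:
  assumes "integrable M (\<lambda>\<omega>. \<bar>X \<omega>\<bar> ^ k)"
  shows "(\<lambda>n. mom k (b n)) \<longlonglongrightarrow> (\<integral>\<omega>. X \<omega> ^ k \<partial>M)"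
  unfolding trunc_moment_def
proof (rule integral_dominated_convergence[where w = "\<lambda>\<omega>. \<bar>X \<omega>\<bar> ^ k"])
  show "AE \<omega> in M. (\<lambda>n. X \<omega> ^ k * indicator {\<omega>. \<bar>X \<omega>\<bar> \<le> b n} \<omega>) \<longlonglongrightarrow> X \<omega> ^ k"
  proof (rule AE_I2)
    fix \<omega>
    have "\<forall>\<^sub>F n in sequentially. X \<omega> ^ k = X \<omega> ^ k * indicator {\<omega>. \<bar>X \<omega>\<bar> \<le> b n} \<omega>"
      using truncation_eventually[of \<omega>] by eventually_elim simp
    then show "(\<lambda>n. X \<omega> ^ k * indicator {\<omega>. \<bar>X \<omega>\<bar> \<le> b n} \<omega>) \<longlonglongrightarrow> X \<omega> ^ k"
      by (rule Lim_transform_eventually[OF tendsto_const])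
  qed
qed (use assms in \<open>auto simp: indicator_def power_abs\<close>)

context
  fixes \<gamma> :: real
  assumes int3: "integrable M (\<lambda>\<omega>. \<bar>X \<omega>\<bar> ^ 3)"
    and var1: "(\<integral>\<omega>. X \<omega> ^ 2 \<partial>M) = 1" and third: "(\<integral>\<omega>. X \<omega> ^ 3 \<partial>M) = \<gamma>"
begin

text \<open>The third absolute moment beyond t. On |X| > t it dominates t^2 times the first moment
  and t^3 times the probability.\<close>

private definition "w t = (\<integral>\<omega>. \<bar>X \<omega>\<bar> ^ 3 * indicator {\<omega>. t < \<bar>X \<omega>\<bar>} \<omega> \<partial>M)"

private lemma integrable_w: "integrable M (\<lambda>\<omega>. \<bar>X \<omega>\<bar> ^ 3 * indicator {\<omega>. t < \<bar>X \<omega>\<bar>} \<omega>)"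
  by (rule Bochner_Integration.integrable_bound[OF int3]) (auto simp: indicator_def)

private lemma w_tendsto: "(\<lambda>n. w (b n)) \<longlonglongrightarrow> 0"
proof -
  have "(\<lambda>n. w (b n)) \<longlonglongrightarrow> (\<integral>\<omega>. 0 \<partial>M)"
    unfolding w_def
  proof (rule integral_dominated_convergence[where w = "\<lambda>\<omega>. \<bar>X \<omega>\<bar> ^ 3"])
    show "AE \<omega> in M. (\<lambda>n. \<bar>X \<omega>\<bar> ^ 3 * indicator {\<omega>. b n < \<bar>X \<omega>\<bar>} \<omega>) \<longlonglongrightarrow> 0"
    proof (rule AE_I2)
      fix \<omega>
      have "\<forall>\<^sub>F n in sequentially. 0 = \<bar>X \<omega>\<bar> ^ 3 * (indicator {\<omega>. b n < \<bar>X \<omega>\<bar>} \<omega> :: real)"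
        using truncation_eventually[of \<omega>] by eventually_elim simp
      then show "(\<lambda>n. \<bar>X \<omega>\<bar> ^ 3 * indicator {\<omega>. b n < \<bar>X \<omega>\<bar>} \<omega> :: real) \<longlonglongrightarrow> 0"
        by (rule Lim_transform_eventually[OF tendsto_const])
    qed
  qed (use int3 in \<open>auto simp: indicator_def\<close>)
  then show ?thesis by simp
qed

text \<open>On the truncation event X^4 / b_n is at most |X|^3, an integrable majorant, while for
  fixed X it tends to 0.\<close>

private lemma mom4_div_tendsto: "(\<lambda>n. mom 4 (b n) / b n) \<longlonglongrightarrow> 0"
proof -
  have "(\<lambda>n. \<integral>\<omega>. X \<omega> ^ 4 * indicator {\<omega>. \<bar>X \<omega>\<bar> \<le> b n} \<omega> / b n \<partial>M) \<longlonglongrightarrow> (\<integral>\<omega>. 0 \<partial>M)"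
  proof (rule integral_dominated_convergence[where w = "\<lambda>\<omega>. \<bar>X \<omega>\<bar> ^ 3"])
    show "AE \<omega> in M. (\<lambda>n. X \<omega> ^ 4 * indicator {\<omega>. \<bar>X \<omega>\<bar> \<le> b n} \<omega> / b n) \<longlonglongrightarrow> 0"
    proof (rule AE_I2)
      fix \<omega>
      have "(\<lambda>n. X \<omega> ^ 4 * inverse (b n)) \<longlonglongrightarrow> X \<omega> ^ 4 * 0"
        by (intro tendsto_mult tendsto_const tendsto_inverse_0_at_top scale_at_top)
      moreover have "\<forall>\<^sub>F n in sequentially. X \<omega> ^ 4 * inverse (b n) = X \<omega> ^ 4 * indicator {\<omega>. \<bar>X \<omega>\<bar> \<le> b n} \<omega> / b n"
        using truncation_eventually[of \<omega>] by eventually_elim (simp add: divide_inverse)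
      ultimately have "(\<lambda>n. X \<omega> ^ 4 * indicator {\<omega>. \<bar>X \<omega>\<bar> \<le> b n} \<omega> / b n) \<longlonglongrightarrow> X \<omega> ^ 4 * 0"
        by (rule Lim_transform_eventually)
      then show "(\<lambda>n. X \<omega> ^ 4 * indicator {\<omega>. \<bar>X \<omega>\<bar> \<le> b n} \<omega> / b n) \<longlonglongrightarrow> 0" by simp
    qed
    show "AE \<omega> in M. norm (X \<omega> ^ 4 * indicator {\<omega>. \<bar>X \<omega>\<bar> \<le> b n} \<omega> / b n) \<le> \<bar>X \<omega>\<bar> ^ 3" for n
    proof (rule AE_I2)
      fix \<omega>
      show "norm (X \<omega> ^ 4 * indicator {\<omega>. \<bar>X \<omega>\<bar> \<le> b n} \<omega> / b n) \<le> \<bar>X \<omega>\<bar> ^ 3"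
      proof (cases "\<bar>X \<omega>\<bar> \<le> b n \<and> 0 < b n")
        case True
        have "\<bar>X \<omega>\<bar> * \<bar>X \<omega>\<bar> ^ 3 \<le> b n * \<bar>X \<omega>\<bar> ^ 3" using True by (intro mult_right_mono) auto
        moreover have "X \<omega> ^ 4 = \<bar>X \<omega>\<bar> * \<bar>X \<omega>\<bar> ^ 3" by (simp flip: power_Suc)
        ultimately show ?thesis using True by (simp add: abs_mult pos_divide_le_eq mult.commute)
      next
        case False
        \<comment> \<open>For b_n < 0 the truncation event is empty, and for b_n = 0 division by
          zero yields 0; so the majorant works for every n, not only eventually.\<close>
        then have "\<not> \<bar>X \<omega>\<bar> \<le> b n \<or> b n = 0" by linarith
        then show ?thesis by auto
      qed
    qed
  qed (use int3 in auto)
  then show ?thesis by (simp add: trunc_moment_def)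
qed

private lemma v_tendsto: "(\<lambda>n. sqrt (real n) / b n) \<longlonglongrightarrow> 1"
proof -
  \<comment> \<open>A function that is not integrable has integral 0 by convention, so the value 1
    entails integrability.\<close>
  have "integrable M (\<lambda>\<omega>. X \<omega> ^ 2)"
    using var1 not_integrable_integral_eq by fastforce
  then have "(\<lambda>n. mom 2 (b n)) \<longlonglongrightarrow> 1"
    using mom_scale_tendsto[of 2] var1 by simp
  then have "(\<lambda>n. sqrt (1 / mom 2 (b n))) \<longlonglongrightarrow> sqrt (1 / 1)"
    by (intro tendsto_intros) auto
  moreover have "\<forall>\<^sub>F n in sequentially. sqrt (1 / mom 2 (b n)) = sqrt (real n) / b n"
    using scale_equation_eventually
  proof eventually_elim
    case (elim n)
    have "1 / mom 2 (b n) = real n / (b n)\<^sup>2" using elim by (simp add: field_simps)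
    then show ?case using elim by (simp add: real_sqrt_divide)
  qed
  ultimately have "(\<lambda>n. sqrt (real n) / b n) \<longlonglongrightarrow> sqrt (1 / 1)" by (rule Lim_transform_eventually)
  then show ?thesis by simp
qed

private definition "v n = sqrt (real n) / b n"

text \<open>Every term of n^(1/2) L_n(x) carries the factor n^(3/2). This form leaves a factor that
  tends to 1 and powers of b_n matching those of the truncated moments.\<close>

private lemma v3: "sqrt (real n) * real n = v n ^ 3 * b n ^ 3" if "0 < b n"
  using that by (simp add: v_def power_divide power3_eq_cube)

private lemma linear_error: "(\<lambda>n. sqrt (real n) * \<bar>real n / b n * mom 1 (b n)\<bar>) \<longlonglongrightarrow> 0"
proof (rule tendsto_sandwich[of "\<lambda>_. 0"])
  show "(\<lambda>n. v n ^ 3 * w (b n)) \<longlonglongrightarrow> 0"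
    using tendsto_mult[OF tendsto_power[OF v_tendsto[folded v_def], of 3] w_tendsto] by simp
  show "\<forall>\<^sub>F n in sequentially. sqrt (real n) * \<bar>real n / b n * mom 1 (b n)\<bar> \<le> v n ^ 3 * w (b n)"
    using scale_pos
  proof eventually_elim
    case (elim n)
    have "\<bar>mom 1 (b n)\<bar> \<le> (\<integral>\<omega>. \<bar>X \<omega>\<bar> * indicator {\<omega>. b n < \<bar>X \<omega>\<bar>} \<omega> \<partial>M)" by (rule mom1_le)
    also have "\<dots> \<le> (\<integral>\<omega>. \<bar>X \<omega>\<bar> ^ 3 * indicator {\<omega>. b n < \<bar>X \<omega>\<bar>} \<omega> / (b n)\<^sup>2 \<partial>M)"
    proof (intro integral_mono integrable_X_tail integrable_divide_zero integrable_w)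
      fix \<omega>
      have "\<bar>X \<omega>\<bar> * (b n)\<^sup>2 \<le> \<bar>X \<omega>\<bar> * \<bar>X \<omega>\<bar>\<^sup>2" if "b n < \<bar>X \<omega>\<bar>"
        using that elim by (intro mult_left_mono power_mono) auto
      then have "\<bar>X \<omega>\<bar> \<le> \<bar>X \<omega>\<bar> ^ 3 / (b n)\<^sup>2" if "b n < \<bar>X \<omega>\<bar>"
        using that elim by (simp add: pos_le_divide_eq power3_eq_cube power2_eq_square mult.assoc)
      then show "\<bar>X \<omega>\<bar> * indicator {\<omega>. b n < \<bar>X \<omega>\<bar>} \<omega> \<le> \<bar>X \<omega>\<bar> ^ 3 * indicator {\<omega>. b n < \<bar>X \<omega>\<bar>} \<omega> / (b n)\<^sup>2"
        by (auto simp: indicator_def)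
    qed
    also have "\<dots> = w (b n) / (b n)\<^sup>2" by (simp add: w_def)
    finally have m: "\<bar>mom 1 (b n)\<bar> \<le> w (b n) / (b n)\<^sup>2" .
    have "sqrt (real n) * \<bar>real n / b n * mom 1 (b n)\<bar> = sqrt (real n) * real n / b n * \<bar>mom 1 (b n)\<bar>"
      using elim by (simp add: abs_mult)
    also have "\<dots> \<le> sqrt (real n) * real n / b n * (w (b n) / (b n)\<^sup>2)"
      using m elim by (intro mult_left_mono) auto
    also have "\<dots> = v n ^ 3 * w (b n)"
      unfolding v3[OF elim] using elim by (simp add: power3_eq_cube power2_eq_square)
    finally show ?case .
  qed
qed auto

private lemma quartic_error: "(\<lambda>n. sqrt (real n) * quartic_part n) \<longlonglongrightarrow> 0"
proof (rule tendsto_sandwich[of "\<lambda>_. 0"])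
  show "(\<lambda>n. v n ^ 3 * (mom 4 (b n) / b n + w (b n))) \<longlonglongrightarrow> 0"
    using tendsto_mult[OF tendsto_power[OF v_tendsto[folded v_def], of 3] tendsto_add[OF mom4_div_tendsto w_tendsto]] by simp
  show "\<forall>\<^sub>F n in sequentially. 0 \<le> sqrt (real n) * quartic_part n"
    using scale_pos by eventually_elim (use mom4_nonneg in auto)
  show "\<forall>\<^sub>F n in sequentially. sqrt (real n) * quartic_part n \<le> v n ^ 3 * (mom 4 (b n) / b n + w (b n))"
    using scale_pos
  proof eventually_elim
    case (elim n)
    have "tail (b n) \<le> (\<integral>\<omega>. \<bar>X \<omega>\<bar> ^ 3 * indicator {\<omega>. b n < \<bar>X \<omega>\<bar>} \<omega> / b n ^ 3 \<partial>M)"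
      unfolding integral_tail[symmetric]
    proof (intro integral_mono integrable_tail integrable_divide_zero integrable_w)
      fix \<omega>
      have "b n ^ 3 \<le> \<bar>X \<omega>\<bar> ^ 3" if "b n < \<bar>X \<omega>\<bar>"
        using that elim by (intro power_mono) auto
      then have "1 \<le> \<bar>X \<omega>\<bar> ^ 3 / b n ^ 3" if "b n < \<bar>X \<omega>\<bar>"
        using that elim by (simp add: pos_le_divide_eq)
      then show "indicator {\<omega>. b n < \<bar>X \<omega>\<bar>} \<omega> \<le> \<bar>X \<omega>\<bar> ^ 3 * indicator {\<omega>. b n < \<bar>X \<omega>\<bar>} \<omega> / b n ^ 3"
        by (auto simp: indicator_def)
    qed
    also have "\<dots> = w (b n) / b n ^ 3" by (simp add: w_def)
    finally have t: "tail (b n) \<le> w (b n) / b n ^ 3" .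
    have "sqrt (real n) * quartic_part n = sqrt (real n) * real n * (mom 4 (b n) / b n ^ 4 + tail (b n))"
      by (simp add: algebra_simps)
    also have "\<dots> \<le> sqrt (real n) * real n * (mom 4 (b n) / b n ^ 4 + w (b n) / b n ^ 3)"
      using t by (intro mult_left_mono add_left_mono) auto
    also have "\<dots> = v n ^ 3 * (mom 4 (b n) / b n + w (b n))"
      unfolding v3[OF elim] using elim by (simp add: field_simps power3_eq_cube power4_eq_xxxx)
    finally show ?case .
  qed
qed auto

private lemma cubic_limit: "(\<lambda>n. sqrt (real n) * (real n / b n ^ 3 * mom 3 (b n))) \<longlonglongrightarrow> \<gamma>"
proof -
  have "(\<lambda>n. v n ^ 3 * mom 3 (b n)) \<longlonglongrightarrow> 1 ^ 3 * \<gamma>"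
    using mom_scale_tendsto[OF int3] unfolding third
    by (intro tendsto_mult tendsto_power v_tendsto[folded v_def])
  moreover have "\<forall>\<^sub>F n in sequentially. v n ^ 3 * mom 3 (b n) = sqrt (real n) * (real n / b n ^ 3 * mom 3 (b n))"
    using scale_pos
  proof eventually_elim
    case (elim n)
    have "sqrt (real n) * (real n / b n ^ 3 * mom 3 (b n)) = sqrt (real n) * real n / b n ^ 3 * mom 3 (b n)" by simp
    also have "\<dots> = v n ^ 3 * mom 3 (b n)" unfolding v3[OF elim] using elim by simp
    finally show ?case by simp
  qed
  ultimately have "(\<lambda>n. sqrt (real n) * (real n / b n ^ 3 * mom 3 (b n))) \<longlonglongrightarrow> 1 ^ 3 * \<gamma>"
    by (rule Lim_transform_eventually)
  then show ?thesis by simp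
qed

text \<open>All dependence on x sits in the density and in its product with 2 x^2 + 1, bounded by
  \<open>P\<close> and \<open>2 * P\<close>. Hence one null sequence \<open>B\<close> majorizes the
  error for all x.\<close>

lemma edgeworth_limit:
  "(\<lambda>n. SUP x. \<bar>sqrt (real n) * leading_term M X n x - 1 / 6 * \<gamma> * (2 * x ^ 2 + 1) * std_normal_density x\<bar>) \<longlonglongrightarrow> 0"
proof -
  obtain C where C: "0 \<le> C" and exp: "\<And>n x. 0 < b n \<Longrightarrow> \<bar>leading_term M X n x - std_normal_density x * linear_part n x\<bar> \<le> C * quartic_part n"
    using leading_term_expansion by blast
  obtain P where P: "\<And>x. std_normal_density x * (\<bar>x\<bar> + 2)\<^sup>2 \<le> P"
    using std_normal_density_mult_power_bounded[of 2] by blast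
  define m1 m3 where "m1 n = sqrt (real n) * \<bar>real n / b n * mom 1 (b n)\<bar>" and "m3 n = sqrt (real n) * (real n / b n ^ 3 * mom 3 (b n))" for n
  define B where "B n = C * (sqrt (real n) * quartic_part n) + P * m1 n + 2 * P * \<bar>m3 n - \<gamma>\<bar>" for n
  have "(\<lambda>n. B n) \<longlonglongrightarrow> C * 0 + P * 0 + 2 * P * \<bar>\<gamma> - \<gamma>\<bar>"
    unfolding B_def m1_def m3_def
    by (intro tendsto_add tendsto_mult tendsto_const quartic_error linear_error tendsto_rabs tendsto_diff cubic_limit)
  then have B0: "B \<longlonglongrightarrow> 0" by simp
  have bound: "\<bar>sqrt (real n) * leading_term M X n x - 1 / 6 * \<gamma> * (2 * x ^ 2 + 1) * std_normal_density x\<bar> \<le> B n"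
    if bn: "0 < b n" for n x
  proof -
    let ?\<phi> = "std_normal_density x"
    have "1 \<le> (\<bar>x\<bar> + 2)\<^sup>2" "2 * x\<^sup>2 + 1 \<le> 2 * (\<bar>x\<bar> + 2)\<^sup>2" by (auto simp: power2_sum)
    then have p: "?\<phi> \<le> P" "?\<phi> * (2 * x\<^sup>2 + 1) \<le> 2 * P"
      using P[of x] mult_left_mono[of 1 "(\<bar>x\<bar> + 2)\<^sup>2" ?\<phi>]
        mult_left_mono[of "2 * x\<^sup>2 + 1" "2 * (\<bar>x\<bar> + 2)\<^sup>2" ?\<phi>] by auto
    have 1: "\<bar>sqrt (real n) * (leading_term M X n x - ?\<phi> * linear_part n x)\<bar> \<le> C * (sqrt (real n) * quartic_part n)"
      using mult_left_mono[OF exp[OF bn, of x], of "sqrt (real n)"] by (simp add: abs_mult mult_ac)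
    have 2: "\<bar>?\<phi> * (sqrt (real n) * (real n / b n * mom 1 (b n)))\<bar> \<le> P * m1 n"
    proof -
      have "\<bar>?\<phi> * (sqrt (real n) * (real n / b n * mom 1 (b n)))\<bar> = ?\<phi> * m1 n"
        by (simp add: m1_def abs_mult)
      also have "\<dots> \<le> P * m1 n" using p by (intro mult_right_mono) (auto simp: m1_def)
      finally show ?thesis .
    qed
    have 3: "\<bar>?\<phi> * (2 * x\<^sup>2 + 1) / 6 * (m3 n - \<gamma>)\<bar> \<le> 2 * P * \<bar>m3 n - \<gamma>\<bar>"
    proof -
      have "\<bar>?\<phi> * (2 * x\<^sup>2 + 1) / 6 * (m3 n - \<gamma>)\<bar> = ?\<phi> * (2 * x\<^sup>2 + 1) / 6 * \<bar>m3 n - \<gamma>\<bar>"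
        by (simp add: abs_mult)
      also have "\<dots> \<le> ?\<phi> * (2 * x\<^sup>2 + 1) * \<bar>m3 n - \<gamma>\<bar>" by (intro mult_right_mono) auto
      also have "\<dots> \<le> 2 * P * \<bar>m3 n - \<gamma>\<bar>" using p by (intro mult_right_mono) auto
      finally show ?thesis .
    qed
    have split: "sqrt (real n) * leading_term M X n x - 1 / 6 * \<gamma> * (2 * x ^ 2 + 1) * ?\<phi>
      = sqrt (real n) * (leading_term M X n x - ?\<phi> * linear_part n x)
        - ?\<phi> * (sqrt (real n) * (real n / b n * mom 1 (b n))) + ?\<phi> * (2 * x\<^sup>2 + 1) / 6 * (m3 n - \<gamma>)"
    proof -
      define k1 k3 where "k1 = real n / b n * mom 1 (b n)" and "k3 = real n / b n ^ 3 * mom 3 (b n)"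
      show ?thesis unfolding m3_def k1_def[symmetric] k3_def[symmetric] by (simp add: field_simps)
    qed
    have tri: "\<bar>y1 - y2 + y3\<bar> \<le> p1 + p2 + p3" if "\<bar>y1\<bar> \<le> p1" "\<bar>y2\<bar> \<le> p2" "\<bar>y3\<bar> \<le> p3" for y1 y2 y3 p1 p2 p3 :: real
      using that by linarith
    show ?thesis unfolding split B_def by (rule tri[OF 1 2 3])
  qed
  show ?thesis
  proof (rule tendsto_sandwich[OF _ _ tendsto_const B0])
    show "\<forall>\<^sub>F n in sequentially. 0 \<le> (SUP x. \<bar>sqrt (real n) * leading_term M X n x - 1 / 6 * \<gamma> * (2 * x ^ 2 + 1) * std_normal_density x\<bar>)"
      using scale_pos
    proof eventually_elim
      case (elim n)
      \<comment> \<open>Without an upper bound the real supremum would be unspecified, and even its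
        nonnegativity could not be concluded.\<close>
      have "bdd_above (range (\<lambda>x. \<bar>sqrt (real n) * leading_term M X n x - 1 / 6 * \<gamma> * (2 * x ^ 2 + 1) * std_normal_density x\<bar>))"
        using bound[OF elim] by (intro bdd_aboveI[of _ "B n"]) auto
      from cSUP_upper[OF UNIV_I this, of 0] show ?case by (rule order_trans[OF abs_ge_zero])
    qed
    show "\<forall>\<^sub>F n in sequentially. (SUP x. \<bar>sqrt (real n) * leading_term M X n x - 1 / 6 * \<gamma> * (2 * x ^ 2 + 1) * std_normal_density x\<bar>) \<le> B n"
      using scale_pos by eventually_elim (intro cSUP_least bound, auto)
  qed
qed

end

end

theorem theorem2p2:
  fixes M :: "'a measure" and X :: "'a \<Rightarrow> real"
  assumes "prob_space M"
    and "X \<in> borel_measurable M"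
    and "normal_domain_of_attraction M X"
    and "integrable M X"
    and "(\<integral>\<omega>. X \<omega> \<partial>M) = 0"
  shows "rate M X \<longlonglongrightarrow> 0
    \<and> asymp_same_order (\<lambda>n. SUP x. \<bar>leading_term M X n x\<bar>) (rate M X)
    \<and> (\<forall>x0 x1 :: real. x0 > sqrt 3 \<and> x1 \<noteq> x0 \<and> x1 \<noteq> - x0 \<longrightarrow>
         asymp_same_order (\<lambda>n. SUP x\<in>{- x0, x0, x1}. \<bar>leading_term M X n x\<bar>) (rate M X))
    \<and> (\<forall>\<gamma> :: real. integrable M (\<lambda>\<omega>. \<bar>X \<omega>\<bar> ^ 3)
           \<and> (\<integral>\<omega>. X \<omega> ^ 2 \<partial>M) = 1 \<and> (\<integral>\<omega>. X \<omega> ^ 3 \<partial>M) = \<gamma> \<longrightarrow>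
         (\<lambda>n. SUP x. \<bar>sqrt (real n) * leading_term M X n x
                       - 1 / 6 * \<gamma> * (2 * x ^ 2 + 1) * std_normal_density x\<bar>) \<longlonglongrightarrow> 0)"
proof -
  interpret prob_space M by fact
  interpret normal_tail M X
    by unfold_locales (use assms normal_domain_of_attraction_tail[OF assms(1-3)] in auto)
  \<comment> \<open>For the supremum over all x any admissible points serve; 2 and 0 are
    taken.\<close>
  have "sqrt 3 < (2::real)" by (rule real_less_lsqrt) auto
  then have "asymp_same_order (\<lambda>n. SUP x. \<bar>leading_term M X n x\<bar>) (rate M X)"
    using same_order_three_points[of 2 0 UNIV] by simp
  then show ?thesis
    using rate_tendsto_zero same_order_three_points edgeworth_limit by blast
qed

end
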